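(* Let $n>1$ be an odd integer and let $M$ be either $(n+1)/2$ or $n-1$. Then, modulo $[n]\Phi_n(q)^3$, \begin{align*} &\sum_{k=0}^{M}[4k-1]\frac{(q^{-1};q^2)_k^4(cq^{-1},dq^{-1};q^2)_k}{(q^2;q^2)_k^4(q^2/c,q^2/d;q^2)_k}\bigg(\frac{q^7}{cd}\bigg)^k\\ &\equiv\frac{\Omega_q(n)(1-q)^2(q^3/cd;q^2)_2}{(1+q)^2(q^2/c,q^2/d;q^2)_2} \sum_{k=0}^{(n-3)/2}\frac{(q^3;q^2)_k^3(q^7/cd;q^2)_k}{(q^2,q^6,q^6/c,q^6/d;q^2)_k}q^{2k}, \end{align*} where \[ \Omega_q(n)=[n]^3\bigg\{\frac{n^2(1-q)^2-(1+22q+q^2)}{24}-\frac{1}{q[n]^2[n-1][n+1]}\bigg\}\frac{q^{(n+5)/2}}{1+q^2}. \]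
   Context: Here $q,c,d$ are indeterminates. The $q$-shifted factorial is $(x;q)_0=1$, $(x;q)_k=(1-x)(1-xq)\cdots(1-xq^{k-1})$ for $k\ge1$, and $(x_1,\dots,x_m;q)_k=(x_1;q)_k\cdots(x_m;q)_k$. The $q$-integer is $[m]=(1-q^m)/(1-q)$, and $\Phi_n(q)$ is the $n$-th cyclotomic polynomial in $q$. A congruence $A\equiv B$ modulo a polynomial $P$ between rational functions means that $A-B$ is a rational function whose numerator is divisible by $P$ and whose denominator is coprime to $P$. *)

theory Defs
  imports "HOL-Computational_Algebra.Computational_Algebra" Complex_Main
begin

text \<open>Coefficient field: rational functions in c and d, i.e. the fraction field of Q[c][d].
  The rational functions in q, c, d are then the fraction field of (Q(c,d))[q].\<close>

type_synonym cd_field = "rat poly poly fract"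
type_synonym qpol = "cd_field poly"
type_synonym qrat = "qpol fract"

definition emb :: "qpol \<Rightarrow> qrat" where
  "emb p = Fract p 1"

definition qq :: qrat where
  "qq = emb [:0, 1:]"

definition cc :: qrat where
  "cc = emb [: Fract [:[:0, 1:]:] 1 :]"

definition dd :: qrat where
  "dd = emb [: Fract [:0, 1:] 1 :]"

definition qpoch :: "qrat \<Rightarrow> qrat \<Rightarrow> nat \<Rightarrow> qrat" where
  "qpoch x p k = (\<Prod>i<k. 1 - x * p ^ i)"

definition qint :: "int \<Rightarrow> qrat" where
  "qint m = (1 - qq powi m) / (1 - qq)"

definition cyclotomic :: "nat \<Rightarrow> int poly" where
  "cyclotomic n = (THE p. map_poly of_int p =
      (\<Prod>k\<in>{k\<in>{1..n}. coprime k n}. [:- cis (2 * pi * real k / real n), 1:] :: complex poly))"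

definition modulus :: "nat \<Rightarrow> qpol" where
  "modulus n = (\<Sum>i<n. monom 1 i) * (map_poly of_int (cyclotomic n)) ^ 3"

definition qcong :: "qrat \<Rightarrow> qrat \<Rightarrow> qpol \<Rightarrow> bool" where
  "qcong A B P \<longleftrightarrow> (\<exists>a b. b \<noteq> 0 \<and> P dvd a \<and> coprime b P \<and> A - B = Fract a b)"

definition Omega :: "nat \<Rightarrow> qrat" where
  "Omega n = qint (int n) ^ 3 *
     ((of_nat n ^ 2 * (1 - qq) ^ 2 - (1 + 22 * qq + qq ^ 2)) / 24
      - 1 / (qq * qint (int n) ^ 2 * qint (int n - 1) * qint (int n + 1)))
     * qq ^ ((n + 5) div 2) / (1 + qq ^ 2)"

end

theory Submission
  imports Defs "HOL-Number_Theory.Totient"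
begin

text \<open>
  Let \<open>G(a, b)\<close> be the sum on the left up to \<open>N = (n + 1)/2\<close>, where three of the four parameters \<open>1/q\<close>
  are deformed to \<open>a/q\<close>, \<open>1/(aq)\<close>, \<open>b/q\<close>. Modulo \<open>\<Phi>\<^sub>n\<close> the terms \<open>k\<close> and \<open>N - k\<close> cancel identically
  in \<open>a\<close> and \<open>b\<close>. As \<open>G\<close> depends on \<open>a\<close> only through \<open>(1 - a)\<^sup>2/a\<close>, its mixed difference over
  \<open>a \<in> {1, q\<^sup>n}\<close>, \<open>b \<in> {1, 1/q\<^sup>n}\<close> is divisible by \<open>\<Phi>\<^sub>n \<sqdot> \<Phi>\<^sub>n\<^sup>2 \<sqdot> \<Phi>\<^sub>n\<close>, so that
  \<open>G(1, 1) \<equiv> G(q\<^sup>n, 1) + G(1, 1/q\<^sup>n) - G(q\<^sup>n, 1/q\<^sup>n)\<close> modulo \<open>\<Phi>\<^sub>n\<^sup>4\<close>. The three series on the right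
  terminate and are transformed by Watson's formula; the constant \<open>n\<^sup>2(1 - q)\<^sup>2 - (1 + 22q + q\<^sup>2)\<close> comes from
  \<open>\<Sum> \<zeta>\<^sup>j / (1 - \<zeta>\<^sup>j)\<^sup>2 = (1 - n\<^sup>2)/12\<close> over the nontrivial \<open>n\<close>-th roots of unity. Modulo \<open>\<Phi>\<^sub>m\<close> for a
  proper divisor \<open>m\<close> of \<open>n\<close> the left side splits into blocks of length \<open>m\<close> that vanish by the
  same cancellation.
\<close>

section \<open>Watson's transformation\<close>

text \<open>Termination requires an upper parameter \<open>q^(-n-1)\<close>. At
  \<open>a = q^n\<close> it is \<open>1/(aq)\<close>, at \<open>b = 1/q^n\<close> it is
  \<open>b/q\<close>; only (1, 1), the corner that is wanted, has none. Deforming \<open>1/q\<close>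
  in a pair \<open>a/q\<close>, \<open>1/(aq)\<close> makes the dependence on \<open>a\<close> of
  second order, and the single parameter \<open>b\<close> supplies one more factor. The obstacle is
  the corner (\<open>q^n\<close>, 1): there the balanced series of the usual Watson formula acquires
  the lower parameter \<open>q^-2\<close>, so that its denominators vanish from index 2 on, and the
  product in front of it vanishes as well. With the product kept inside the sum, the terms 0 and 1
  disappear and the others stay finite. This is why the sum on the right stops at
  \<open>(n-3)/2\<close> and contains \<open>q^6\<close>, \<open>q^7/(cd)\<close> where Watson's
  formula has \<open>q^2\<close>, \<open>q^3/(cd)\<close>. At the two other corners the terms 0 and
  1 remain, but their difference is negligible. The coefficient of the balanced series at
  (\<open>q^n\<close>, 1) has an exact closed form and yields the term
  \<open>1/(q[n]^2[n-1][n+1])\<close>; the difference of the coefficients at the two other corners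
  yields the term with denominator 24.\<close>

definition qfact :: "'a::field \<Rightarrow> 'a \<Rightarrow> nat \<Rightarrow> 'a" where
  "qfact x p k = (\<Prod>i<k. 1 - x * p ^ i)"

lemma qfact_0 [simp]: "qfact x p 0 = 1"
  by (simp add: qfact_def)

lemma qfact_Suc: "qfact x p (Suc k) = qfact x p k * (1 - x * p ^ k)"
  by (simp add: qfact_def)

lemma qfact_add: "qfact x p (j + k) = qfact x p j * qfact (x * p ^ j) p k"
  by (induction k) (simp_all add: qfact_Suc power_add algebra_simps)

lemma qfact_eq_0_iff: "qfact x p k = 0 \<longleftrightarrow> (\<exists>i<k. x * p ^ i = 1)"
  by (auto simp: qfact_def)

text \<open>The relation \<open>step\<close> of the next proof with denominators cleared:
  \<open>P\<close> is \<open>p ^ (n - i)\<close>, \<open>s\<close> is \<open>p ^ i\<close>, and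
  \<open>L\<close> is the factor common to the summands and to the values of the mate.\<close>

lemma saalschuetz_step:
  fixes p x y X P s L :: "'a::comm_ring_1"
  shows "(1 - p * (P * s)) * (1 - x * y * X * (P * s)) * (L * (1 - X * P)) =
    (1 - x * X * (P * s)) * (1 - y * X * (P * s)) * (L * (1 - p * P)) +
    (- P * (L * (1 - p * P) * (1 - x * s) * (1 - y * s) * X)
     - - P * (L * (1 - X * P)) * (1 - s) * (p - x * y * X * s))"
  by (simp add: algebra_simps)

text \<open>The balanced sum with upper parameters \<open>x\<close>, \<open>y\<close>,
  \<open>p^-n\<close>. The parameter \<open>p^-n\<close> and the second lower parameter are absorbed
  in the products of length \<open>n - i\<close>, so that no negative power of \<open>p\<close>
  occurs. Creative telescoping gives a recurrence of order one in \<open>n\<close>.\<close>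

lemma q_saalschuetz:
  fixes x y X p :: "'a::field"
  assumes p0: "p \<noteq> 0" and p: "\<And>i. i > 0 \<Longrightarrow> p ^ i \<noteq> 1" and C: "\<And>i. x * y * X * p ^ i \<noteq> 1"
  shows "(\<Sum>i\<le>n. qfact x p i * qfact y p i * qfact X p (n - i) * X ^ i
            / (qfact p p (n - i) * qfact p p i * qfact (x * y * X) p i))
         = qfact (x * X) p n * qfact (y * X) p n / (qfact p p n * qfact (x * y * X) p n)"
proof (induction n)
  case (Suc n)
  define C where "C = x * y * X"
  have pn: "1 - p * p ^ i \<noteq> 0" for i
    using p[of "Suc i"] by simp
  have Cn: "1 - C * p ^ i \<noteq> 0" for i
    using C[of i] by (simp add: C_def)
  define F where "F n i = qfact x p i * qfact y p i * qfact X p (n - i) * X ^ i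
            / (qfact p p (n - i) * qfact p p i * qfact C p i)" for n i
  \<comment> \<open>The WZ mate of the summand.\<close>
  define G where "G i = - (p ^ (Suc n - i)) * (qfact x p i * qfact y p i * qfact X p (Suc n - i) * X ^ i
            / (qfact p p (Suc n - i) * qfact p p i * qfact C p i)) * (1 - p ^ i) * (1 - C * p ^ i / p)" for i
  define a where "a = (1 - p * p ^ n) * (1 - C * p ^ n)"
  define b where "b = (1 - x * X * p ^ n) * (1 - y * X * p ^ n)"
  have step: "a * F (Suc n) i = b * F n i + (G (Suc i) - G i)" if "i \<le> n" for i
  proof -
    define m where "m = n - i"
    have m: "n = m + i" using that by (simp add: m_def)
    have e: "n - i = m" "Suc n - i = Suc m" "Suc n - Suc i = m" using m by auto
    define K where "K = qfact x p i * qfact y p i * qfact X p m * X ^ i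
      / (qfact p p m * qfact p p i * qfact C p i)"
    define L where "L = K / (1 - p * p ^ m)"
    have K: "K = L * (1 - p * p ^ m)" using pn[of m] by (simp add: L_def)
    have F1: "F n i = L * (1 - p * p ^ m)" unfolding K[symmetric] by (simp add: F_def K_def e)
    have F2: "F (Suc n) i = L * (1 - X * p ^ m)"
      by (simp add: F_def K_def e qfact_Suc L_def mult_ac)
    have "p * G i = p * (- (p * p ^ m) * (L * (1 - X * p ^ m)) * (1 - p ^ i) * (1 - C * p ^ i / p))"
      by (simp add: G_def K_def e qfact_Suc L_def mult_ac)
    also have "\<dots> = p * (- (p ^ m) * (L * (1 - X * p ^ m)) * (1 - p ^ i) * (p - C * p ^ i))"
      using p0 by (simp add: field_simps)
    finally have G1: "G i = - (p ^ m) * (L * (1 - X * p ^ m)) * (1 - p ^ i) * (p - C * p ^ i)"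
      by (rule mult_left_cancel[OF p0, THEN iffD1])
    have "G (Suc i) = - (p ^ m) * (K * (1 - x * p ^ i) * (1 - y * p ^ i) * X
        / ((1 - p * p ^ i) * (1 - C * p ^ i))) * (1 - p * p ^ i) * (1 - C * p ^ i)"
      using p0 by (simp add: G_def K_def e qfact_Suc)
    also have "\<dots> = - (p ^ m) * (K * (1 - x * p ^ i) * (1 - y * p ^ i) * X)"
      using pn[of i] Cn[of i] by simp
    finally have G2: "G (Suc i) = - (p ^ m) * (L * (1 - p * p ^ m) * (1 - x * p ^ i) * (1 - y * p ^ i) * X)"
      unfolding K by simp
    show ?thesis
      unfolding F1 F2 G1 G2 a_def b_def C_def unfolding m power_add by (rule saalschuetz_step)
  qed
  have G0: "G 0 = 0" by (simp add: G_def)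
  \<comment> \<open>The recurrence is confined to \<open>i \<le> n\<close>: with truncated
    subtraction \<open>F n (Suc n)\<close> is not the 0 that it would need. The top term is matched
    with the mate directly.\<close>
  have last: "a * F (Suc n) (Suc n) = - G (Suc n)"
    by (simp add: G_def F_def a_def p0)
  have "a * (\<Sum>i\<le>Suc n. F (Suc n) i) = (\<Sum>i\<le>n. a * F (Suc n) i) + a * F (Suc n) (Suc n)"
    by (simp add: sum_distrib_left distrib_left)
  also have "(\<Sum>i\<le>n. a * F (Suc n) i) = (\<Sum>i\<le>n. b * F n i + (G (Suc i) - G i))"
    using step by (intro sum.cong) auto
  also have "\<dots> = b * (\<Sum>i\<le>n. F n i) + (\<Sum>i\<le>n. G (Suc i) - G i)"
    by (simp add: sum.distrib sum_distrib_left)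
  also have "(\<Sum>i\<le>n. G (Suc i) - G i) = G (Suc n) - G 0"
    by (induction n) (auto simp: lessThan_Suc_atMost[symmetric] sum_lessThan_telescope)
  finally have "a * (\<Sum>i\<le>Suc n. F (Suc n) i) = b * (\<Sum>i\<le>n. F n i)"
    using G0 last by simp
  moreover have "a \<noteq> 0" using pn[of n] Cn[of n] by (simp add: a_def)
  ultimately have "(\<Sum>i\<le>Suc n. F (Suc n) i) = b / a * (\<Sum>i\<le>n. F n i)"
    by (simp add: field_simps)
  also have "(\<Sum>i\<le>n. F n i) = qfact (x * X) p n * qfact (y * X) p n / (qfact p p n * qfact C p n)"
    using Suc by (simp add: F_def C_def)
  finally show ?case
    unfolding F_def C_def[symmetric] qfact_Suc a_def b_def by (simp add: mult_ac)
qed simp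

text \<open>Every partial sum is a product, hence induction on \<open>s\<close>. At
  \<open>s = m\<close> the factor \<open>1 - p ^ (m - s)\<close> vanishes, which gives the unit
  Bailey pair.\<close>

lemma unit_bailey_pair_partial:
  fixes A p :: "'a::field"
  assumes p: "\<And>i. i > 0 \<Longrightarrow> p ^ i \<noteq> 1" and A: "\<And>i. A * p ^ i \<noteq> 1" and "0 < m" "s \<le> m"
  shows "(\<Sum>r\<le>s. qfact A p r * (1 - A * p ^ (2 * r)) * (\<Prod>i<r. - (p ^ i)) / (qfact p p r * (1 - A))
            / (qfact p p (m - r) * qfact (A * p) p (m + r)))
       = (\<Prod>i<s. - (p ^ Suc i)) * qfact (A * p) p s * (1 - p ^ (m - s))
            / (qfact p p s * qfact p p (m - s) * qfact (A * p) p (m + s) * (1 - p ^ m))"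
  using \<open>s \<le> m\<close>
proof (induction s)
  case 0
  then show ?case using p[OF \<open>0 < m\<close>] A[of 0] by simp
next
  case (Suc s)
  define l where "l = m - Suc s"
  have l: "m = Suc (s + l)" using Suc.prems by (simp add: l_def)
  have e: "m - s = Suc l" "m - Suc s = l" "m + Suc s = Suc (m + s)" using l by auto
  have pn: "1 - p * p ^ i \<noteq> 0" for i
    using p[of "Suc i"] by simp
  have An: "1 - A * p ^ i \<noteq> 0" for i
    using A[of i] by simp
  have pf: "qfact p p i \<noteq> 0" for i
    using pn by (simp add: qfact_def)
  have Af: "qfact (A * p) p i \<noteq> 0" for i
    using An[of "Suc _"] by (simp add: qfact_def mult.assoc)
  have AS: "qfact A p (Suc s) = (1 - A) * qfact (A * p) p s"
    using qfact_add[of A p 1 s] by (simp add: qfact_Suc)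
  have pr: "(\<Prod>i<Suc s. - (p ^ i)) = (\<Prod>i<s. - (p ^ Suc i)) * (-1)"
    by (subst prod.lessThan_Suc_shift) simp
  have pr2: "(\<Prod>i<Suc s. - (p ^ Suc i)) = (\<Prod>i<s. - (p ^ Suc i)) * (- (p * p ^ s))"
    by simp
  define Z where "Z = (\<Prod>i<s. - (p ^ Suc i)) * qfact (A * p) p s"
  define D where "D = qfact p p s * (1 - p * p ^ s) * (qfact p p l * (1 - p * p ^ l))
    * qfact (A * p) p (m + s)
     * (1 - A * p * p ^ (m + s)) * (1 - p ^ m)"
  have m0: "1 - p ^ m \<noteq> 0" using p[OF \<open>0 < m\<close>] by simp
  have ApN: "1 - A * p * p ^ (m + s) \<noteq> 0" using An[of "Suc (m + s)"] by (simp add: mult.assoc)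
  have A1: "1 - A \<noteq> 0" using An[of 0] by simp
  have t1: "Z * (1 - p ^ (m - s)) / (qfact p p s * qfact p p (m - s) * qfact (A * p) p (m + s) * (1 - p ^ m))
     = Z * (1 - p * p ^ s) * (1 - p * p ^ l) * (1 - A * p * p ^ (m + s)) / D"
    unfolding e D_def qfact_Suc using pf Af pn m0 ApN by simp
  have t2: "qfact A p (Suc s) * (1 - A * p ^ (2 * Suc s)) * (\<Prod>i<Suc s. - (p ^ i))
    / (qfact p p (Suc s) * (1 - A))
            / (qfact p p (m - Suc s) * qfact (A * p) p (m + Suc s))
      = - Z * (1 - A * p ^ (2 * Suc s)) * (1 - p * p ^ l) * (1 - p ^ m) / D"
    unfolding e D_def AS pr Z_def qfact_Suc[of p] qfact_Suc[of "A * p"] using pf Af pn m0 ApN A1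
    by (simp add: mult_ac)
  have t3: "(\<Prod>i<Suc s. - (p ^ Suc i)) * qfact (A * p) p (Suc s) * (1 - p ^ (m - Suc s))
            / (qfact p p (Suc s) * qfact p p (m - Suc s) * qfact (A * p) p (m + Suc s) * (1 - p ^ m))
     = Z * (- (p * p ^ s)) * (1 - A * p * p ^ s) * (1 - p ^ l) * (1 - p * p ^ l) / D"
    unfolding e D_def pr2 Z_def qfact_Suc[of p] qfact_Suc[of "A * p"] using pf Af pn m0 ApN A1
    by (simp add: mult_ac)
  have key: "Z * (1 - p * p ^ s) * (1 - p * p ^ l) * (1 - A * p * p ^ (m + s)) + - Z
    * (1 - A * p ^ (2 * Suc s)) * (1 - p * p ^ l) * (1 - p ^ m)
      = Z * (- (p * p ^ s)) * (1 - A * p * p ^ s) * (1 - p ^ l) * (1 - p * p ^ l)"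
    unfolding l by (simp add: power_add mult_2 mult_2_right algebra_simps)
  show ?case
    unfolding sum.atMost_Suc t2 t3 Suc.IH[OF Suc_leD[OF Suc.prems]] Z_def[symmetric] t1 key[symmetric]
    add_divide_distrib ..
qed

lemma unit_bailey_pair:
  fixes A p :: "'a::field"
  assumes p: "\<And>i. i > 0 \<Longrightarrow> p ^ i \<noteq> 1" and A: "\<And>i. A * p ^ i \<noteq> 1"
  shows "(\<Sum>r\<le>m. qfact A p r * (1 - A * p ^ (2 * r)) * (\<Prod>i<r. - (p ^ i)) / (qfact p p r * (1 - A))
            / (qfact p p (m - r) * qfact (A * p) p (m + r))) = (if m = 0 then 1 else 0)"
proof (cases "m = 0")
  case False
  then show ?thesis
    using unit_bailey_pair_partial[OF p A, of m m] by simp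
qed (use A[of 0] in simp)

text \<open>Inserting \<open>\<beta>\<close> and interchanging the sums leaves, for fixed
  \<open>r\<close>, an inner sum over \<open>j \<ge> r\<close>. Shifted by \<open>r\<close> it is
  the q-Saalschuetz sum with \<open>x * p ^ r\<close>, \<open>y * p ^ r\<close> and the same
  \<open>X\<close>.\<close>

lemma bailey_lemma:
  fixes A p x y :: "'a::field" and \<alpha> \<beta> :: "nat \<Rightarrow> 'a"
  assumes p0: "p \<noteq> 0" and p: "\<And>i. i > 0 \<Longrightarrow> p ^ i \<noteq> 1" and A: "\<And>i. A * p ^ i \<noteq> 1"
    and xy: "x \<noteq> 0" "y \<noteq> 0"
    and xn: "qfact (A * p / x) p m \<noteq> 0" and yn: "qfact (A * p / y) p m \<noteq> 0"
    and \<beta>: "\<And>j. \<beta> j = (\<Sum>r\<le>j. \<alpha> r / (qfact p p (j - r) * qfact (A * p) p (j + r)))"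
  defines "X \<equiv> A * p / (x * y)"
  shows "(\<Sum>r\<le>m. \<alpha> r * (qfact x p r * qfact y p r * X ^ r / (qfact (A * p / x) p r * qfact (A * p / y) p r))
             / (qfact p p (m - r) * qfact (A * p) p (m + r)))
       = (\<Sum>j\<le>m. qfact x p j * qfact y p j * qfact X p (m - j) * X ^ j
             / (qfact p p (m - j) * qfact (A * p / x) p m * qfact (A * p / y) p m) * \<beta> j)"
proof -
  have Ap: "A * p * p ^ i \<noteq> 1" for i using A[of "Suc i"] by (simp add: mult_ac)
  define V where "V r = qfact x p r * qfact y p r * X ^ r / (qfact (A * p / x) p r * qfact (A * p / y) p r)"
    for r
  define D where "D = qfact (A * p / x) p m * qfact (A * p / y) p m"
  define H where "H j = qfact x p j * qfact y p j * qfact X p (m - j) * X ^ j / qfact p p (m - j)" for j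
  have inner: "(\<Sum>j=r..m. H j / (qfact p p (j - r) * qfact (A * p) p (j + r)))
      = D * V r
          / (qfact p p (m - r) * qfact (A * p) p (m + r))" if "r \<le> m" for r
  proof -
    define k where "k = m - r"
    have m: "m = r + k" using that by (simp add: k_def)
    define x' y' where "x' = x * p ^ r" and "y' = y * p ^ r"
    have xyX: "x' * y' * X = A * p * p ^ (2 * r)"
      using xy by (simp add: x'_def y'_def X_def power_add mult_2)
    have x'X: "x' * X = A * p / y * p ^ r" and y'X: "y' * X = A * p / x * p ^ r"
      using xy by (simp_all add: x'_def y'_def X_def)
    have "(\<Sum>j=r..m. H j / (qfact p p (j - r) * qfact (A * p) p (j + r)))
        = (\<Sum>i=0..k. H (i + r) / (qfact p p i * qfact (A * p) p (i + r + r)))"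
      using sum.shift_bounds_cl_nat_ivl[of "\<lambda>j. H j / (qfact p p (j - r) * qfact (A * p) p (j + r))" 0 r k]
      by (simp add: m add.commute)
    also have "\<dots> = (\<Sum>i\<le>k. qfact x p r * qfact y p r * X ^ r / qfact (A * p) p (2 * r) *
         (qfact x' p i * qfact y' p i * qfact X p (k - i) * X ^ i
            / (qfact p p (k - i) * qfact p p i * qfact (x' * y' * X) p i)))"
    proof (intro sum.cong)
      fix i assume "i \<in> {..k}"
      have "qfact x p (i + r) = qfact x p r * qfact x' p i" "qfact y p (i + r) = qfact y p r * qfact y' p i"
        using qfact_add[of _ p r i] by (simp_all add: x'_def y'_def add.commute)
      moreover have "qfact (A * p) p (i + r + r) = qfact (A * p) p (2 * r) * qfact (x' * y' * X) p i"
        using qfact_add[of "A * p" p "2 * r" i] by (simp add: xyX mult_2 add_ac)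
      moreover have "m - (i + r) = k - i" by (simp add: m)
      ultimately show "H (i + r) / (qfact p p i * qfact (A * p) p (i + r + r)) =
         qfact x p r * qfact y p r * X ^ r / qfact (A * p) p (2 * r) *
         (qfact x' p i * qfact y' p i * qfact X p (k - i) * X ^ i
            / (qfact p p (k - i) * qfact p p i * qfact (x' * y' * X) p i))"
        unfolding H_def by (simp add: power_add mult_ac)
    qed auto
    also have "\<dots> = qfact x p r * qfact y p r * X ^ r / qfact (A * p) p (2 * r) *
         (qfact (x' * X) p k * qfact (y' * X) p k / (qfact p p k * qfact (x' * y' * X) p k))"
    proof -
      have "x' * y' * X * p ^ i \<noteq> 1" for i
        unfolding xyX using Ap[of "2 * r + i"] by (simp add: power_add mult_ac)
      from q_saalschuetz[OF p0 p this, of k] show ?thesis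
        by (subst sum_distrib_left[symmetric]) (simp only:)
    qed
    also have "\<dots> = qfact x p r * qfact y p r * X ^ r *
        (qfact (A * p / y * p ^ r) p k * qfact (A * p / x * p ^ r) p k) /
        (qfact p p k * qfact (A * p) p (m + r))"
    proof -
      have "m + r = 2 * r + k" by (simp add: m)
      thus ?thesis by (simp only: x'X y'X xyX qfact_add) simp
    qed
    also have "\<dots> = D * V r
          / (qfact p p (m - r) * qfact (A * p) p (m + r))"
    proof -
      have "qfact (A * p / x) p m = qfact (A * p / x) p r * qfact (A * p / x * p ^ r) p k"
           "qfact (A * p / y) p m = qfact (A * p / y) p r * qfact (A * p / y * p ^ r) p k"
        unfolding m by (rule qfact_add)+
      with xn yn show ?thesis unfolding D_def V_def k_def[symmetric] by (simp add: mult_ac)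
    qed
    finally show ?thesis .
  qed
  have D0: "D \<noteq> 0" using xn yn by (simp add: D_def)
  have "D * (\<Sum>r\<le>m. \<alpha> r * V r
             / (qfact p p (m - r) * qfact (A * p) p (m + r)))
      = (\<Sum>r\<le>m. \<alpha> r * (\<Sum>j=r..m. H j / (qfact p p (j - r) * qfact (A * p) p (j + r))))"
    by (subst sum_distrib_left, intro sum.cong) (simp_all add: inner)
  also have "\<dots> = (\<Sum>r\<le>m. \<Sum>j\<in>{j\<in>{..m}. r \<le> j}. H j * (\<alpha> r / (qfact p p (j - r) * qfact (A * p) p (j + r))))"
    by (intro sum.cong, simp, subst sum_distrib_left, intro sum.cong) auto
  also have "\<dots> = (\<Sum>j\<le>m. \<Sum>r\<in>{r\<in>{..m}. r \<le> j}. H j * (\<alpha> r / (qfact p p (j - r) * qfact (A * p) p (j + r))))"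
    by (intro sum.swap_restrict) auto
  also have "\<dots> = (\<Sum>j\<le>m. H j * \<beta> j)"
    by (intro sum.cong, simp, subst \<beta>, subst sum_distrib_left, intro sum.cong) auto
  finally have "D * (\<Sum>r\<le>m. \<alpha> r * V r
             / (qfact p p (m - r) * qfact (A * p) p (m + r))) = (\<Sum>j\<le>m. H j * \<beta> j)" .
  hence "(\<Sum>r\<le>m. \<alpha> r * V r
             / (qfact p p (m - r) * qfact (A * p) p (m + r))) = (\<Sum>j\<le>m. H j * \<beta> j) / D"
    using D0 by (simp add: field_simps)
  also have "\<dots> = (\<Sum>j\<le>m. qfact x p j * qfact y p j * qfact X p (m - j) * X ^ j
             / (qfact p p (m - j) * qfact (A * p / x) p m * qfact (A * p / y) p m) * \<beta> j)"
    unfolding sum_divide_distrib by (intro sum.cong) (simp_all add: H_def D_def mult_ac)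
  finally show ?thesis unfolding V_def .
qed

text \<open>Watson's transformation of a terminating very-well-poised series, obtained from two steps along
  the Bailey chain. Both sides are divided by \<open>(p, Ap; p)\<^sub>N\<close>, and the product that usually
  stands in front of the balanced series is kept inside the sum, so that no denominator can vanish
  when \<open>x' y'\<close> degenerates.\<close>

lemma watson:
  fixes A p x y x' y' :: "'a::field"
  assumes p0: "p \<noteq> 0" and p: "\<And>i. i > 0 \<Longrightarrow> p ^ i \<noteq> 1" and A: "\<And>i. A * p ^ i \<noteq> 1"
    and xy: "x \<noteq> 0" "y \<noteq> 0" "x' \<noteq> 0" "y' \<noteq> 0"
    and nz: "\<And>j. qfact (A * p / x) p j \<noteq> 0" "\<And>j. qfact (A * p / y) p j \<noteq> 0"
      "qfact (A * p / x') p N \<noteq> 0" "qfact (A * p / y') p N \<noteq> 0"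
  shows "(\<Sum>r\<le>N. qfact A p r * (1 - A * p ^ (2 * r)) * (\<Prod>i<r. - (p ^ i)) / (qfact p p r * (1 - A))
             * (qfact x p r * qfact y p r * (A * p / (x * y)) ^ r /
             (qfact (A * p / x) p r * qfact (A * p / y) p r))
             * (qfact x' p r * qfact y' p r * (A * p / (x' * y')) ^ r /
             (qfact (A * p / x') p r * qfact (A * p / y') p r))
             / (qfact p p (N - r) * qfact (A * p) p (N + r)))
       = (\<Sum>j\<le>N. qfact x' p j * qfact y' p j * qfact (A * p / (x' * y')) p (N - j) * (A * p / (x' * y')) ^ j
             / (qfact p p (N - j) * qfact (A * p / x') p N * qfact (A * p / y') p N)
             * (qfact (A * p / (x * y)) p j / (qfact p p j * qfact (A * p / x) p j * qfact (A * p / y) p j)))"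
proof (rule bailey_lemma[OF p0 p A xy(3,4) nz(3,4)])
  fix m
  define \<alpha> where "\<alpha> r = qfact A p r * (1 - A * p ^ (2 * r)) * (\<Prod>i<r. - (p ^ i)) / (qfact p p r * (1 - A))"
    for r
  show "qfact (A * p / (x * y)) p m / (qfact p p m * qfact (A * p / x) p m * qfact (A * p / y) p m) =
    (\<Sum>r\<le>m. qfact A p r * (1 - A * p ^ (2 * r)) * (\<Prod>i<r. - (p ^ i)) / (qfact p p r * (1 - A))
             * (qfact x p r * qfact y p r * (A * p / (x * y)) ^ r /
             (qfact (A * p / x) p r * qfact (A * p / y) p r))
             / (qfact p p (m - r) * qfact (A * p) p (m + r)))"
    unfolding \<alpha>_def[symmetric]
  \<comment> \<open>The inner step of the chain: for the unit pair only \<open>j = 0\<close>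
    survives, so the new \<open>\<beta>\<close> is a product. It is applied for every length
    \<open>m\<close>, hence the conditions on \<open>x\<close> and \<open>y\<close> for all
    \<open>j\<close>.\<close>
  proof (subst bailey_lemma[OF p0 p A xy(1,2) nz(1,2), where \<beta> = "\<lambda>m. if m = 0 then 1 else 0"])
    show "(if j = 0 then 1 else 0) = (\<Sum>r\<le>j. \<alpha> r / (qfact p p (j - r) * qfact (A * p) p (j + r)))" for j
      unfolding \<alpha>_def by (rule unit_bailey_pair[OF p A, symmetric])
  qed (simp_all add: if_distrib cong: if_cong)
qed

section \<open>The very-well-poised series and its terminating cases\<close>

locale wp_series =
  fixes q c d :: "'a::field"
  assumes q0: "q \<noteq> 0" and q_pow: "\<And>i. i > 0 \<Longrightarrow> q ^ i \<noteq> 1"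
    and c0: "c \<noteq> 0" and d0: "d \<noteq> 0" and qc: "\<And>i. q ^ i \<noteq> c" and qd: "\<And>i. q ^ i \<noteq> d"
begin

abbreviation qf :: "'a \<Rightarrow> nat \<Rightarrow> 'a" where "qf x k \<equiv> qfact x (q^2) k"

definition factor :: "'a \<Rightarrow> nat \<Rightarrow> 'a" where
  "factor e i = (1 - e * (q ^ (2 * i) / q)) / (1 - q ^ (2 * i + 2) / e)"

text \<open>The quotient of consecutive terms apart from \<open>qnum\<close>; at
  \<open>e1 = e2 = e3 = 1\<close> it belongs to the left side of the theorem. In terms of quotients
  the reversal of the series becomes a statement about single factors.\<close>

definition ratio :: "'a \<Rightarrow> 'a \<Rightarrow> 'a \<Rightarrow> nat \<Rightarrow> 'a" where
  "ratio e1 e2 e3 i = factor 1 i * factor e1 i * factor e2 i * factor e3 i * factor c i * factor d i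
     * (q ^ 7 / (e1 * e2 * e3 * c * d))"

definition qnum :: "nat \<Rightarrow> 'a" where
  "qnum k = (1 - q ^ (4 * k) / q) / (1 - q)"

definition S :: "'a \<Rightarrow> 'a \<Rightarrow> 'a \<Rightarrow> nat \<Rightarrow> 'a" where
  "S e1 e2 e3 M = (\<Sum>k\<le>M. qnum k * (\<Prod>i<k. ratio e1 e2 e3 i))"

lemma prod_factor: "(\<Prod>i<k. factor e i) = qf (e / q) k / qf (q^2 / e) k"
proof -
  have e: "q ^ (2 * i + 2) = q^2 * (q^2) ^ i" "q ^ (2 * i) = (q^2) ^ i" for i
    by (simp_all only: power_mult power_add mult.commute[of _ "q^2"])
  show ?thesis
    unfolding factor_def qfact_def prod_dividef e by (simp only: times_divide_eq_right times_divide_eq_left)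
qed

lemma prod_ratio:
  "(\<Prod>i<k. ratio e1 e2 e3 i) =
     qf (1 / q) k / qf (q^2) k * (qf (e1 / q) k / qf (q^2 / e1) k)
     * (qf (e2 / q) k / qf (q^2 / e2) k) * (qf (e3 / q) k / qf (q^2 / e3) k)
     * (qf (c / q) k / qf (q^2 / c) k) * (qf (d / q) k / qf (q^2 / d) k)
     * (q ^ 7 / (e1 * e2 * e3 * c * d)) ^ k"
  unfolding ratio_def prod.distrib prod_factor by simp

lemma qfact_square_nz [simp]: "qf (q^2) k \<noteq> 0"
  using q_pow[of "2 * Suc _"] by (auto simp: qfact_eq_0_iff power_mult[symmetric] power_add[symmetric])

lemma qfact_q_nz [simp]: "qf q k \<noteq> 0"
  using q_pow[of "Suc (2 * _)"] by (auto simp: qfact_eq_0_iff power_mult[symmetric])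

lemma qfact_c_nz [simp]: "qf (q^2 / c) k \<noteq> 0"
proof
  assume "qf (q^2 / c) k = 0"
  then obtain i where "q^2 / c * (q^2) ^ i = 1" by (auto simp: qfact_eq_0_iff)
  hence "q ^ (2 + 2 * i) = c" unfolding power_add power_mult using c0 by (simp add: field_simps)
  thus False using qc by blast
qed

lemma qfact_d_nz [simp]: "qf (q^2 / d) k \<noteq> 0"
proof
  assume "qf (q^2 / d) k = 0"
  then obtain i where "q^2 / d * (q^2) ^ i = 1" by (auto simp: qfact_eq_0_iff)
  hence "q ^ (2 + 2 * i) = d" unfolding power_add power_mult using d0 by (simp add: field_simps)
  thus False using qd by blast
qed

text \<open>As \<open>1 / Q / q\<close> is \<open>(q^2)^-N\<close>, this is the reversal formula for
  the shifted factorial of a terminating parameter.\<close>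

lemma qfact_square_top:
  assumes "r \<le> N" and Q: "(q^2) ^ N = q * Q"
  shows "(\<Prod>i<r. - ((q^2) ^ i)) * qf (q^2) N
    = (q * Q) ^ r * qf (1 / Q / q) r * qf (q^2) (N - r)"
  using \<open>r \<le> N\<close>
proof (induction r)
  case (Suc r)
  have Q0: "Q \<noteq> 0" using Q q0 by auto
  have e: "N - r = Suc (N - Suc r)" using Suc.prems by simp
  define u where "u = (q^2) ^ (N - Suc r)"
  have u: "q^2 * u * (q^2) ^ r = q * Q"
  proof -
    have "q^2 * u * (q^2) ^ r = (q^2) ^ (Suc (N - Suc r) + r)"
      by (simp only: u_def power_add power_Suc)
    also have "Suc (N - Suc r) + r = N" using Suc.prems by simp
    finally show ?thesis using Q by simp
  qed
  have "(\<Prod>i<Suc r. - ((q^2) ^ i)) * qf (q^2) N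
      = (- ((q^2) ^ r)) * ((q * Q) ^ r * qf (1 / Q / q) r * qf (q^2) (N - r))"
    using Suc.IH Suc.prems by (simp add: mult_ac)
  also have "\<dots> = (- ((q^2) ^ r) * (1 - q^2 * u)) * ((q * Q) ^ r * qf (1 / Q / q) r * qf (q^2) (N - Suc r))"
    unfolding e qfact_Suc u_def by (simp add: mult_ac)
  also have "- ((q^2) ^ r) * (1 - q^2 * u) = q * Q * (1 - 1 / Q / q * (q^2) ^ r)"
    using u Q0 q0 by (simp add: algebra_simps)
  finally show ?case by (simp add: qfact_Suc mult_ac)
qed simp

text \<open>Watson's formula with base \<open>q^2\<close> and \<open>A = 1 / q\<close>. The
  deformation \<open>1 / Q\<close> produces the parameter \<open>(q^2)^-N\<close>, which
  \<open>watson\<close> hides in the products of lengths \<open>N - r\<close> and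
  \<open>N + r\<close>.\<close>

lemma terminating:
  assumes Q: "(q^2) ^ N = q * Q" and e: "e1 \<noteq> 0" "e2 \<noteq> 0"
    and nz: "qf (q^2 / e1) N \<noteq> 0" "qf (q^2 / e2) N \<noteq> 0"
  defines "X \<equiv> q ^ 3 / (e1 * e2)"
  shows "S e1 e2 (1 / Q) N = - (1 / q) * qf q N / (qf (q^2 / e1) N * qf (q^2 / e2) N)
     * (\<Sum>j\<le>N. qf (q^2) N / (qf (q^2) (N - j) * qf (q^2) j)
          * (qf (e1 / q) j * qf (e2 / q) j * qf X (N - j) * X ^ j)
          * (qf (q ^ 3 / (c * d)) j / (qf (q^2 / c) j * qf (q^2 / d) j)))"
    (is "_ = ?B / _ * _")
proof -
  define p where "p = q^2"
  have p0: "p \<noteq> 0" using q0 by (simp add: p_def)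
  have pp: "p ^ i \<noteq> 1" if "i > 0" for i
    using q_pow[of "2 * i"] that by (simp add: p_def power_mult)
  have Ap: "1 / q * p = q" by (simp add: p_def power2_eq_square)
  have A: "1 / q * p ^ i \<noteq> 1" for i
  proof (cases i)
    case 0
    then show ?thesis using q_pow[of 1] by simp
  next
    case (Suc j)
    have "1 / q * p ^ i = q ^ (2 * j + 1)"
      using q0 by (simp add: Suc p_def power_add power_mult power2_eq_square)
    then show ?thesis using q_pow[of "2 * j + 1"] by simp
  qed
  have div: "q / (e / q) = p / e" for e
    by (simp add: p_def power2_eq_square)
  have div2: "q / (e / q * (e' / q)) = q ^ 3 / (e * e')" for e e'
    by (simp add: power3_eq_cube)
  define wt where "wt r = qfact (1 / q) p r * (1 - 1 / q * p ^ (2 * r)) * (\<Prod>i<r. - (p ^ i))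
    / (qfact p p r * (1 - 1 / q))
             * (qfact (c / q) p r * qfact (d / q) p r * (q ^ 3 / (c * d)) ^ r /
             (qfact (p / c) p r * qfact (p / d) p r))
             * (qfact (e1 / q) p r * qfact (e2 / q) p r * X ^ r / (qfact (p / e1) p r * qfact (p / e2) p r))
             / (qfact p p (N - r) * qfact q p (N + r))" for r
  have W: "(\<Sum>r\<le>N. wt r)
       = (\<Sum>j\<le>N. qfact (e1 / q) p j * qfact (e2 / q) p j * qfact X p (N - j) * X ^ j
             / (qfact p p (N - j) * qfact (p / e1) p N * qfact (p / e2) p N)
             * (qfact (q ^ 3 / (c * d)) p j / (qfact p p j * qfact (p / c) p j * qfact (p / d) p j)))"
    using watson[OF p0 pp A, of "c / q" "d / q" "e1 / q" "e2 / q" N]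
    unfolding Ap div div2 X_def wt_def using q0 c0 d0 e nz by (simp add: p_def)
  have trm: "qnum r * (\<Prod>i<r. ratio e1 e2 (1 / Q) i) = - (1 / q) * qfact q p N * qfact p p N *
       wt r" if "r \<le> N" for r
  proof -
    define Z where "Z = qfact (1 / q) p r / qfact p p r * (qfact (e1 / q) p r / qfact (p / e1) p r)
     * (qfact (e2 / q) p r / qfact (p / e2) p r)
     * (qfact (c / q) p r / qfact (p / c) p r) * (qfact (d / q) p r / qfact (p / d) p r)"
    have "q * p ^ N = p / (1 / Q)" using Q by (simp add: p_def power2_eq_square mult_ac)
    hence a1: "qfact q p (N + r) = qfact q p N * qfact (p / (1 / Q)) p r"
      by (simp add: qfact_add)
    have a2: "(\<Prod>i<r. - (p ^ i)) * qfact p p N / qfact p p (N - r) = (q * Q) ^ r * qfact (1 / Q / q) p r"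
      using qfact_square_top[OF that Q] by (simp add: p_def field_simps)
    \<comment> \<open>The very-well-poised factor is 1 at \<open>r = 0\<close>, whereas
      \<open>qnum 0 = - (1 / q)\<close>; this is the origin of the leading constant.\<close>
    have a3: "qnum r = - (1 / q) * ((1 - 1 / q * p ^ (2 * r)) / (1 - 1 / q))"
    proof -
      define P where "P = q ^ (4 * r) / q"
      have "1 / q * p ^ (2 * r) = P" by (simp add: P_def p_def power_mult[symmetric])
      moreover have "1 - 1 / q = (q - 1) / q" using q0 by (simp add: field_simps)
      moreover have "(1 - P) / (1 - q) = (P - 1) / (q - 1)" by (metis minus_diff_eq minus_divide_divide)
      ultimately show ?thesis unfolding qnum_def P_def[symmetric] using q0 by simp
    qed
    have q7: "q ^ 7 = q ^ 3 * q ^ 3 * q" by (simp add: numeral_eq_Suc)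
    have a4: "(q ^ 7 / (e1 * e2 * (1 / Q) * c * d)) ^ r = (q ^ 3 / (c * d)) ^ r * X ^ r * (q * Q) ^ r"
      unfolding power_mult_distrib[symmetric] X_def
      by (rule arg_cong[where f = "\<lambda>t. t ^ r"]) (simp add: q7 divide_inverse mult_ac)
    have nq: "qfact q p N \<noteq> 0" by (simp add: p_def)
    have "- (1 / q) * qfact q p N * qfact p p N *
       wt r
       = (- (1 / q) * ((1 - 1 / q * p ^ (2 * r)) / (1 - 1 / q))) * Z * ((q ^ 3 / (c * d)) ^ r * X ^ r)
          * ((\<Prod>i<r. - (p ^ i)) * qfact p p N / qfact p p (N - r)) * (qfact q p N / qfact q p (N + r))"
      unfolding Z_def wt_def by (simp add: mult_ac)
    also have "\<dots> = qnum r * Z * ((q ^ 3 / (c * d)) ^ r * X ^ r)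
          * ((q * Q) ^ r * qfact (1 / Q / q) p r) * (1 / qfact (p / (1 / Q)) p r)"
      unfolding a2 a3[symmetric] a1 using nq by simp
    also have "\<dots> = qnum r * (\<Prod>i<r. ratio e1 e2 (1 / Q) i)"
      unfolding prod_ratio a4 Z_def p_def[symmetric] by (simp add: mult_ac)
    finally show ?thesis by simp
  qed
  have "S e1 e2 (1 / Q) N = - (1 / q) * qfact q p N * qfact p p N * (\<Sum>r\<le>N. wt r)"
    unfolding S_def by (subst sum_distrib_left, intro sum.cong refl trm) simp
  also have "\<dots> = - (1 / q) * qfact q p N / (qfact (p / e1) p N * qfact (p / e2) p N)
     * (\<Sum>j\<le>N. qfact p p N / (qfact p p (N - j) * qfact p p j)
          * (qfact (e1 / q) p j * qfact (e2 / q) p j * qfact X p (N - j) * X ^ j)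
          * (qfact (q ^ 3 / (c * d)) p j / (qfact (p / c) p j * qfact (p / d) p j)))"
    unfolding W sum_distrib_left by (intro sum.cong) (simp_all add: mult_ac)
  finally show ?thesis unfolding p_def .
qed

text \<open>Reversing \<open>(X; q^2)\<^sub>N\<^sub>-\<^sub>j\<close> exposes the balanced series with all indices shifted by two.\<close>

lemma balanced_shift:
  assumes Q: "(q^2) ^ N = q * Q" and s: "s \<noteq> 0" and "i + 2 \<le> N"
  shows "qf (q ^ 3 / s) (N - (i + 2)) * (q ^ 3 / s) ^ (i + 2) * qf (q^2) N * qf (q^2 * s / Q) i
    = q^2 * (Q / s)\<^sup>2 * qf (q ^ 3 / s) (N - 2) * (q^2) ^ (i + 2) * qf (1 / Q / q) (i + 2)
       * qf (q^2) (N - (i + 2))"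
  using \<open>i + 2 \<le> N\<close>
proof (induction i)
  case 0
  have Q0: "Q \<noteq> 0" using Q q0 by auto
  have t: "(- 1) * (- (q^2)) * qf (q^2) N = (q * Q)\<^sup>2 * qf (1 / Q / q) 2 * qf (q^2) (N - 2)"
    using qfact_square_top[OF 0[simplified] Q] by (simp add: numeral_2_eq_2)
  have "q^2 * (qf (q ^ 3 / s) (N - 2) * (q ^ 3 / s)\<^sup>2 * qf (q^2) N)
     = qf (q ^ 3 / s) (N - 2) * (q ^ 3 / s)\<^sup>2 * ((q * Q)\<^sup>2 * qf (1 / Q / q) 2 * qf (q^2) (N - 2))"
    unfolding t[symmetric] by simp
  also have "\<dots> = q^2 * (q^2 * (Q / s)\<^sup>2 * qf (q ^ 3 / s) (N - 2) * (q^2) ^ 2 * qf (1 / Q / q) 2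
    * qf (q^2) (N - 2))"
    by (simp add: power_divide power_mult_distrib power_mult[symmetric] mult_ac power_add[symmetric])
  finally have "qf (q ^ 3 / s) (N - 2) * (q ^ 3 / s)\<^sup>2 * qf (q^2) N
     = q^2 * (Q / s)\<^sup>2 * qf (q ^ 3 / s) (N - 2) * (q^2) ^ 2 * qf (1 / Q / q) 2 * qf (q^2) (N - 2)"
    by (rule mult_left_cancel[THEN iffD1, rotated]) (simp add: q0)
  thus ?case by (simp only: add_0 qfact_0 mult_1_right)
next
  case (Suc i)
  have Q0: "Q \<noteq> 0" using Q q0 by auto
  define K where "K = N - (Suc i + 2)"
  have K: "N - (i + 2) = Suc K" using Suc.prems by (simp add: K_def)
  define u where "u = (q^2) ^ K"
  have u0: "u \<noteq> 0" using q0 by (simp add: u_def)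
  have u: "u * (q^2) ^ (i + 3) = q * Q"
  proof -
    have "u * (q^2) ^ (i + 3) = (q^2) ^ (K + (i + 3))" by (simp only: u_def power_add)
    also have "K + (i + 3) = N" using Suc.prems by (simp add: K_def)
    finally show ?thesis using Q by simp
  qed
  define w where "w = (q^2) ^ i"
  have w: "u * (w * q ^ 6) = q * Q"
    using u by (simp add: w_def power_add power_mult[symmetric] mult_ac)
  define X where "X = q ^ 3 / s"
  have "X * u * (q^2 * s / Q * w) = q ^ 5 * (u * w) / Q" using s
    by (simp add: X_def field_simps power_add[symmetric])
  also have "q * (q ^ 5 * (u * w)) = u * (w * q ^ 6)" by (simp add: numeral_eq_Suc mult_ac)
  hence "q * (q ^ 5 * (u * w)) = q * Q" using w by simp
  hence "q ^ 5 * (u * w) = Q" using q0 by simp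
  finally have z1: "X * u * (q^2 * s / Q * w) = 1" using Q0 by simp
  have w2: "(q^2) ^ (i + 2) = w * q ^ 4" by (simp add: w_def power_add power_mult[symmetric])
  have "q^2 * u * (1 / Q / q * (w * q ^ 4)) = u * (w * q ^ 6) / (q * Q)"
    by (simp add: power_add[symmetric] mult_ac)
  hence z2: "q^2 * u * (1 / Q / q * (q^2) ^ (i + 2)) = 1" unfolding w2 using w Q0 q0 by simp
  \<comment> \<open>By \<open>z1\<close> and \<open>z2\<close>, the factor that leaves a reversed
    product and the factor that enters the shifted one have reciprocal arguments, and
    \<open>1 - t = - t * (1 - 1 / t)\<close>.\<close>
  have f1: "1 - X * u = - (X * u) * (1 - q^2 * s / Q * w)"
    unfolding right_diff_distrib mult_minus_left z1 by simp
  have f2: "1 - q^2 * u = - (q^2 * u) * (1 - 1 / Q / q * (q^2) ^ (i + 2))"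
    unfolding right_diff_distrib mult_minus_left z2 by simp
  have IH: "qf X K * (1 - X * u) * X ^ (i + 2) * qf (q^2) N * qf (q^2 * s / Q) i
    = q^2 * (Q / s)\<^sup>2 * qf X (N - 2) * (q^2) ^ (i + 2) * qf (1 / Q / q) (i + 2)
       * (qf (q^2) K * (1 - q^2 * u))"
    using Suc.IH Suc.prems unfolding K X_def[symmetric] qfact_Suc u_def by simp
  have e: "Suc i + 2 = Suc (i + 2)" by simp
  have "- u * (qf X K * X ^ (Suc i + 2) * qf (q^2) N * qf (q^2 * s / Q) (Suc i))
     = qf X K * (1 - X * u) * X ^ (i + 2) * qf (q^2) N * qf (q^2 * s / Q) i"
    unfolding f1 e qfact_Suc w_def[symmetric] by (simp add: mult_ac)
  also have "\<dots> = - u * (q^2 * (Q / s)\<^sup>2 * qf X (N - 2) * (q^2) ^ (Suc i + 2) * qf (1 / Q / q) (Suc i + 2)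
       * qf (q^2) K)"
    unfolding IH f2 e qfact_Suc power_Suc by (simp only: mult_ac mult_minus_left mult_minus_right)
  finally show ?case using u0 unfolding K_def[symmetric] X_def[symmetric] by simp
qed

section \<open>The balanced series without its first two terms\<close>

definition Y :: "nat \<Rightarrow> 'a" where
  "Y j = qf (q ^ 3 / (c * d)) j / (qf (q^2) j * qf (q^2 / c) j * qf (q^2 / d) j)
     * (q^2) ^ j"

text \<open>In Watson's balanced series the lower parameter is \<open>e1 * e2 * e3 / q^2\<close>,
  here \<open>b / q^2\<close>. Its first two factors are dropped, since one of them is 0 at
  \<open>b = 1\<close>; what remains is \<open>qf (q^2 * b) i\<close>.\<close>

definition T :: "nat \<Rightarrow> 'a \<Rightarrow> 'a \<Rightarrow> 'a" where
  "T N a b = (\<Sum>i\<le>N - 2. Y (i + 2) * (qf (a / q) (i + 2) * qf (1 / a / q) (i + 2)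
     * qf (b / q) (i + 2) / qf (q^2 * b) i))"

text \<open>The part of the term with index 1 that does not depend on the deformation.\<close>

definition E1 :: "nat \<Rightarrow> 'a" where
  "E1 N = (1 - (q^2) ^ N) / (1 - q^2) * ((1 - q ^ 3 / (c * d)) / ((1 - q^2 / c) * (1 - q^2 / d)))"

text \<open>The terms 0 and 1 are kept apart because they carry the products \<open>qf X N\<close>
  and \<open>qf X (N - 1)\<close>, which at the corners of the grid are 0 or multiples of
  \<open>1 - Q\<close>; the other terms have \<open>qf X (N - 2)\<close> in common.\<close>

lemma terminating_shifted:
  assumes Q: "(q^2) ^ N = q * Q" and e: "e1 \<noteq> 0" "e2 \<noteq> 0" and N: "2 \<le> N"
    and nz: "qf (q^2 / e1) N \<noteq> 0" "qf (q^2 / e2) N \<noteq> 0"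
    and nz': "\<And>i. i \<le> N - 2 \<Longrightarrow> qf (q^2 * (e1 * e2) / Q) i \<noteq> 0"
  defines "X \<equiv> q ^ 3 / (e1 * e2)"
  shows "S e1 e2 (1 / Q) N = - (1 / q) * qf q N / (qf (q^2 / e1) N * qf (q^2 / e2) N)
     * (qf X N + E1 N * ((1 - e1 / q) * (1 - e2 / q)) * (qf X (N - 1) * X)
        + q^2 * (Q / (e1 * e2))\<^sup>2 * qf X (N - 2)
          * (\<Sum>i\<le>N - 2. Y (i + 2) * (qf (e1 / q) (i + 2) * qf (e2 / q) (i + 2)
               * qf (1 / Q / q) (i + 2) / qf (q^2 * (e1 * e2) / Q) i)))"
proof -
  define t where "t j = qf (q^2) N / (qf (q^2) (N - j) * qf (q^2) j)
          * (qf (e1 / q) j * qf (e2 / q) j * qf X (N - j) * X ^ j)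
          * (qf (q ^ 3 / (c * d)) j / (qf (q^2 / c) j * qf (q^2 / d) j))" for j
  have NN: "N = Suc (Suc (N - 2))" using N by simp
  have "(\<Sum>j\<le>N. t j) = t 0 + t 1 + (\<Sum>i\<le>N - 2. t (i + 2))"
    by (subst NN) (simp only: sum.atMost_Suc_shift[of t] sum.atMost_Suc_shift[of
    "\<lambda>i. t (Suc i)"], simp add: add.assoc)
  also have "t 0 = qf X N" by (simp add: t_def)
  also have "t 1 = E1 N * ((1 - e1 / q) * (1 - e2 / q)) * (qf X (N - 1) * X)"
  proof -
    have "qf (q^2) N = qf (q^2) (N - 1) * (1 - (q^2) ^ N)"
      using qfact_Suc[of "q^2" "q^2" "N - 1"] N by (simp flip: power_Suc)
    moreover have "qf x 1 = 1 - x" for x by (simp add: qfact_def)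
    ultimately show ?thesis by (simp add: t_def E1_def mult_ac)
  qed
  also have "(\<Sum>i\<le>N - 2. t (i + 2)) = q^2 * (Q / (e1 * e2))\<^sup>2 * qf X (N - 2)
          * (\<Sum>i\<le>N - 2. Y (i + 2) * (qf (e1 / q) (i + 2) * qf (e2 / q) (i + 2)
               * qf (1 / Q / q) (i + 2) / qf (q^2 * (e1 * e2) / Q) i))"
    unfolding sum_distrib_left
  proof (intro sum.cong refl)
    fix i assume "i \<in> {..N - 2}"
    hence i: "i \<le> N - 2" "i + 2 \<le> N" using N by auto
    define z where "z = qf (q^2 * (e1 * e2) / Q) i"
    define y where "y = qf (q^2) (N - (i + 2))"
    have z0: "z \<noteq> 0" using nz'[OF i(1)] by (simp add: z_def)
    have y0: "y \<noteq> 0" by (simp add: y_def)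
    have "e1 * e2 \<noteq> 0" using e by simp
    from balanced_shift[OF Q this i(2)]
    have bs: "qf (q^2) N / y * (qf X (N - (i + 2)) * X ^ (i + 2))
       = q^2 * (Q / (e1 * e2))\<^sup>2 * qf X (N - 2) * (q^2) ^ (i + 2) * qf (1 / Q / q) (i + 2) / z"
      using z0 y0 unfolding X_def[symmetric] y_def[symmetric] z_def[symmetric]
      by (simp add: divide_eq_eq eq_divide_eq mult_ac)
    have "t (i + 2) = qf (q^2) N / y * (qf X (N - (i + 2)) * X ^ (i + 2)) *
        (qf (e1 / q) (i + 2) * qf (e2 / q) (i + 2) / qf (q^2) (i + 2)
        * (qf (q ^ 3 / (c * d)) (i + 2) / (qf (q^2 / c) (i + 2) * qf (q^2 / d) (i + 2))))"
      unfolding t_def y_def by (simp add: mult_ac del: add_2_eq_Suc')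
    also have "\<dots> = q^2 * (Q / (e1 * e2))\<^sup>2 * qf X (N - 2)
         * (Y (i + 2) * (qf (e1 / q) (i + 2) * qf (e2 / q) (i + 2)
               * qf (1 / Q / q) (i + 2) / z))"
      unfolding bs Y_def by (simp add: mult_ac del: add_2_eq_Suc')
    finally show "t (i + 2) = q^2 * (Q / (e1 * e2))\<^sup>2 * qf X (N - 2)
         * (Y (i + 2) * (qf (e1 / q) (i + 2) * qf (e2 / q) (i + 2)
               * qf (1 / Q / q) (i + 2) / qf (q^2 * (e1 * e2) / Q) i))"
      unfolding z_def .
  qed
  finally show ?thesis
    using terminating[OF Q e nz] unfolding t_def X_def by simp
qed

section \<open>The right side of the congruence as a multiple of the balanced series\<close>

definition omega :: "nat \<Rightarrow> 'a" where
  "omega n = ((1 - q ^ n) / (1 - q)) ^ 3 *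
     (((of_nat n)\<^sup>2 * (1 - q)\<^sup>2 - (1 + 22 * q + q^2)) / 24
      - 1 / (q * ((1 - q ^ n) / (1 - q))\<^sup>2 * ((1 - q ^ (n - 1)) / (1 - q)) * ((1 - q ^ (n + 1)) / (1 - q))))
     * q ^ ((n + 5) div 2) / (1 + q^2)"

definition tail :: "nat \<Rightarrow> 'a" where
  "tail k = qf (q ^ 3) k ^ 3 * qf (q ^ 7 / (c * d)) k
     / (qf (q^2) k * qf (q ^ 6) k * qf (q ^ 6 / c) k * qf (q ^ 6 / d) k)
     * q ^ (2 * k)"

definition rhs :: "nat \<Rightarrow> 'a" where
  "rhs n = omega n * (1 - q)\<^sup>2 * qf (q ^ 3 / (c * d)) 2
     / ((1 + q)\<^sup>2 * qf (q^2 / c) 2 * qf (q^2 / d) 2) * (\<Sum>k\<le>(n - 3) div 2. tail k)"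

lemma qfact_shift2: "qf e (i + 2) = qf e 2 * qf (e * q ^ 4) i"
proof -
  have "qf e (2 + i) = qf e 2 * qf (e * (q^2) ^ 2) i" by (rule qfact_add)
  moreover have "(q^2) ^ 2 = q ^ 4" by (simp add: power_mult[symmetric])
  ultimately show ?thesis by (simp only: add.commute[of i])
qed

lemma one_minus_q_nz: "1 - q \<noteq> 0" using q_pow[of 1] by simp

lemma one_plus_q_nz: "1 + q \<noteq> 0" "1 + q^2 \<noteq> 0"
proof -
  have "(1 + q) * (1 - q) = 1 - q ^ 2" "(1 + q^2) * (1 - q ^ 2) = 1 - q ^ 4"
    by (simp_all add: algebra_simps eval_nat_numeral)
  moreover have "1 - q ^ 2 \<noteq> 0" "1 - q ^ 4 \<noteq> 0" using q_pow[of 2] q_pow[of 4] by auto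
  ultimately show "1 + q \<noteq> 0" "1 + q^2 \<noteq> 0" by auto
qed

text \<open>Splitting off the first two factors of each product turns the parameters
  \<open>1/q\<close>, \<open>q^3/(cd)\<close>, \<open>q^2/c\<close>, \<open>q^2/d\<close> of
  \<open>T\<close> into \<open>q^3\<close>, \<open>q^7/(cd)\<close>, \<open>q^6/c\<close>,
  \<open>q^6/d\<close>.\<close>

lemma T_1_1:
  "(1 - q)\<^sup>2 * qf (q ^ 3 / (c * d)) 2
     / ((1 + q)\<^sup>2 * qf (q^2 / c) 2 * qf (q^2 / d) 2) * (\<Sum>k\<le>N - 2. tail k)
   = - ((1 + q^2) / (q * (1 - q)\<^sup>2)) * T N 1 1"
proof -
  define C where "C = qf (q ^ 3 / (c * d)) 2 / (qf (q^2 / c) 2 * qf (q^2 / d) 2)"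
  define A where "A = qf (1 / q) 2 ^ 3 * q ^ 4 / qf (q^2) 2"
  have t: "Y (i + 2) * (qf (1 / q) (i + 2) * qf (1 / 1 / q) (i + 2)
     * qf (1 / q) (i + 2) / qf (q^2 * 1) i) = A * C * tail i" for i
  proof -
    have e: "1 / q * q ^ 4 = q ^ 3" "q ^ 3 / (c * d) * q ^ 4 = q ^ 7 / (c * d)" "q^2 * q ^ 4 = q ^ 6"
      "q^2 / c * q ^ 4 = q ^ 6 / c" "q^2 / d * q ^ 4 = q ^ 6 / d"
      using q0 by (simp_all add: eval_nat_numeral mult_ac)
    have e': "(q^2) ^ (i + 2) = q ^ (2 * i) * q ^ 4"
      unfolding power_add power_mult[of q 2 i] by (simp add: power_mult[symmetric])
    show ?thesis
      unfolding Y_def qfact_shift2 e e' A_def C_def tail_def div_by_1 mult_1_right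
      by (simp add: power3_eq_cube mult_ac)
  qed
  have T: "T N 1 1 = A * C * (\<Sum>k\<le>N - 2. tail k)"
    unfolding T_def t sum_distrib_left ..
  have A: "(1 - q)\<^sup>2 / (1 + q)\<^sup>2 = - ((1 + q^2) / (q * (1 - q)\<^sup>2)) * A"
  proof -
    have 1: "qf (1 / q) 2 = - ((1 - q)\<^sup>2 / q)"
      using q0 by (simp add: qfact_def eval_nat_numeral field_simps)
    have 2: "qf (q^2) 2 = (1 - q)\<^sup>2 * ((1 + q)\<^sup>2 * (1 + q^2))"
      by (simp add: qfact_def eval_nat_numeral algebra_simps)
    have "A = - (((1 - q)\<^sup>2) ^ 3 / q ^ 3 * q ^ 4 / ((1 - q)\<^sup>2 * ((1 + q)\<^sup>2 * (1 + q^2))))"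
      unfolding A_def 1 2 by (simp add: power_divide)
    also have "\<dots> = - (q * ((1 - q)\<^sup>2 * (1 - q)\<^sup>2) / ((1 + q)\<^sup>2 * (1 + q^2)))"
      using q0 one_minus_q_nz by (simp add: eval_nat_numeral mult_ac)
    finally show ?thesis using q0 one_minus_q_nz one_plus_q_nz by (simp add: eval_nat_numeral)
  qed
  have "(1 - q)\<^sup>2 * qf (q ^ 3 / (c * d)) 2
     / ((1 + q)\<^sup>2 * qf (q^2 / c) 2 * qf (q^2 / d) 2) * (\<Sum>k\<le>N - 2. tail k)
    = (1 - q)\<^sup>2 / (1 + q)\<^sup>2 * (C * (\<Sum>k\<le>N - 2. tail k))"
    by (simp add: C_def mult_ac)
  also have "\<dots> = - ((1 + q^2) / (q * (1 - q)\<^sup>2)) * T N 1 1"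
    unfolding A T by (simp only: mult_ac mult_minus_left mult_minus_right)
  finally show ?thesis .
qed

end

section \<open>Subrings with a radical element and their deformations\<close>

text \<open>Later \<open>R\<close> consists of the fractions whose denominator is invertible modulo
  \<Phi>_m, and \<open>f\<close> is \<Phi>_m. By \<open>f_radical\<close>, \<open>f\<close> lies in
  the Jacobson radical, so units can be recognized modulo \<open>f\<close>;
  \<open>of_nat_inverse\<close> permits division by 2, 24 and \<open>m\<close>.\<close>

locale radical_subring =
  fixes R :: "'a::field set" and f :: 'a
  assumes R1 [simp, intro]: "1 \<in> R"
    and R_diff [intro]: "x \<in> R \<Longrightarrow> y \<in> R \<Longrightarrow> x - y \<in> R"
    and R_mult [intro]: "x \<in> R \<Longrightarrow> y \<in> R \<Longrightarrow> x * y \<in> R"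
    and f_R [simp, intro]: "f \<in> R"
    and f_radical: "x \<in> R \<Longrightarrow> 1 + f * x \<noteq> 0 \<and> inverse (1 + f * x) \<in> R"
    and of_nat_inverse: "k > 0 \<Longrightarrow> (of_nat k :: 'a) \<noteq> 0 \<and> inverse (of_nat k :: 'a) \<in> R"
begin

lemma R0 [simp, intro]: "0 \<in> R"
  using R_diff[OF R1 R1] by simp

lemma R_uminus [intro]: "x \<in> R \<Longrightarrow> - x \<in> R"
  using R_diff[OF R0, of x] by simp

lemma R_add [intro]: "x \<in> R \<Longrightarrow> y \<in> R \<Longrightarrow> x + y \<in> R"
  using R_diff[OF _ R_uminus, of x y] by simp

lemma R_of_nat [simp, intro]: "of_nat k \<in> R"
  by (induction k) auto

lemma R_numeral [simp, intro]: "numeral k \<in> R"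
  using R_of_nat[of "numeral k"] by simp

lemma R_power [intro]: "x \<in> R \<Longrightarrow> x ^ k \<in> R"
  by (induction k) auto

lemma R_sum [intro]: "(\<And>i. i \<in> A \<Longrightarrow> g i \<in> R) \<Longrightarrow> sum g A \<in> R"
  by (induction A rule: infinite_finite_induct) auto

lemma R_prod [intro]: "(\<And>i. i \<in> A \<Longrightarrow> g i \<in> R) \<Longrightarrow> prod g A \<in> R"
  by (induction A rule: infinite_finite_induct) auto

definition U :: "'a set" where
  "U = {x \<in> R. x \<noteq> 0 \<and> inverse x \<in> R}"

lemma U_R: "x \<in> U \<Longrightarrow> x \<in> R" and U_nz: "x \<in> U \<Longrightarrow> x \<noteq> 0" and U_inverse_R: "x \<in> U \<Longrightarrow> inverse x \<in> R"
  by (auto simp: U_def)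

lemma U1 [simp, intro]: "1 \<in> U"
  by (auto simp: U_def)

lemma U_mult [intro]: "x \<in> U \<Longrightarrow> y \<in> U \<Longrightarrow> x * y \<in> U"
  by (auto simp: U_def)

lemma U_inverse [intro]: "x \<in> U \<Longrightarrow> inverse x \<in> U"
  by (auto simp: U_def)

lemma U_divide [intro]: "x \<in> U \<Longrightarrow> y \<in> U \<Longrightarrow> x / y \<in> U"
  by (auto simp: divide_inverse)

lemma U_uminus [intro]: "x \<in> U \<Longrightarrow> - x \<in> U"
  by (auto simp: U_def)

lemma U_power [intro]: "x \<in> U \<Longrightarrow> x ^ k \<in> U"
  by (induction k) auto

lemma U_prod [intro]: "(\<And>i. i \<in> A \<Longrightarrow> g i \<in> U) \<Longrightarrow> prod g A \<in> U"
  by (induction A rule: infinite_finite_induct) auto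

lemma R_divide [intro]: "x \<in> R \<Longrightarrow> y \<in> U \<Longrightarrow> x / y \<in> R"
  by (auto simp: divide_inverse U_def)

lemma U_of_nat: "k > 0 \<Longrightarrow> of_nat k \<in> U"
  using of_nat_inverse[of k] by (auto simp: U_def)

lemma U_numeral [simp, intro]: "numeral k \<in> U"
  using U_of_nat[of "numeral k"] by simp

lemma U_factor:
  assumes "x \<in> R" "y \<in> R" "x * y \<in> U"
  shows "x \<in> U"
proof -
  have nz: "x \<noteq> 0" and eq: "inverse x = y * inverse (x * y)"
    using assms(3) by (auto simp: U_def field_simps)
  have "inverse x \<in> R" unfolding eq using assms(2,3) by (intro R_mult) (auto simp: U_def)
  thus ?thesis using assms(1) nz by (simp add: U_def)
qed

section \<open>Powers of the ideal generated by f\<close>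

definition J :: "nat \<Rightarrow> 'a set" where
  "J k = {f ^ k * x | x. x \<in> R}"

lemma J_I: "x \<in> R \<Longrightarrow> f ^ k * x \<in> J k"
  by (auto simp: J_def)

lemma J_0 [simp]: "J 0 = R"
  by (auto simp: J_def)

lemma J0 [simp, intro]: "0 \<in> J k"
  by (auto simp: J_def intro!: exI[of _ 0])

lemma J_add [intro]: "x \<in> J k \<Longrightarrow> y \<in> J k \<Longrightarrow> x + y \<in> J k"
  by (auto simp: J_def) (metis R_add distrib_left)

lemma J_diff [intro]: "x \<in> J k \<Longrightarrow> y \<in> J k \<Longrightarrow> x - y \<in> J k"
  by (auto simp: J_def) (metis R_diff right_diff_distrib)

lemma J_uminus [intro]: "x \<in> J k \<Longrightarrow> - x \<in> J k"
  using J_diff[OF J0, of x] by simp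

lemma J_mult: "x \<in> J i \<Longrightarrow> y \<in> J j \<Longrightarrow> x * y \<in> J (i + j)"
proof -
  assume "x \<in> J i" "y \<in> J j"
  then obtain a b where "x = f ^ i * a" "y = f ^ j * b" "a \<in> R" "b \<in> R" by (auto simp: J_def)
  hence "x * y = f ^ (i + j) * (a * b)" "a * b \<in> R" by (auto simp: power_add mult_ac)
  thus ?thesis by (auto simp: J_def)
qed

lemma J_multR [intro]: "x \<in> J k \<Longrightarrow> y \<in> R \<Longrightarrow> x * y \<in> J k"
  using J_mult[of x k y 0] by simp

lemma J_Rmult [intro]: "x \<in> R \<Longrightarrow> y \<in> J k \<Longrightarrow> x * y \<in> J k"
  using J_mult[of x 0 y k] by simp

lemma J_divide [intro]: "x \<in> J k \<Longrightarrow> y \<in> U \<Longrightarrow> x / y \<in> J k"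
  by (auto simp: divide_inverse U_def)

lemma J_mono: "x \<in> J i \<Longrightarrow> j \<le> i \<Longrightarrow> x \<in> J j"
proof -
  assume "x \<in> J i" "j \<le> i"
  then obtain a where "x = f ^ i * a" "a \<in> R" by (auto simp: J_def)
  moreover have "f ^ i = f ^ j * f ^ (i - j)" using \<open>j \<le> i\<close> by (simp flip: power_add)
  ultimately have "x = f ^ j * (f ^ (i - j) * a)" "f ^ (i - j) * a \<in> R" by (auto simp: mult_ac)
  thus ?thesis by (auto simp: J_def)
qed

lemma J_R: "x \<in> J k \<Longrightarrow> x \<in> R"
  using J_mono[of x k 0] by simp

lemma J_power: "x \<in> J i \<Longrightarrow> x ^ k \<in> J (k * i)"
  by (induction k) (auto dest: J_mult)

lemma J_sum [intro]: "(\<And>i. i \<in> A \<Longrightarrow> g i \<in> J k) \<Longrightarrow> sum g A \<in> J k"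
  by (induction A rule: infinite_finite_induct) auto

lemma U_add_J: "x \<in> U \<Longrightarrow> y \<in> J 1 \<Longrightarrow> x + y \<in> U"
proof -
  assume x: "x \<in> U" and "y \<in> J 1"
  then obtain a where y: "y = f * a" "a \<in> R" by (auto simp: J_def)
  have "x + y = x * (1 + f * (a / x))" using y U_nz[OF x] by (simp add: field_simps)
  moreover have "1 + f * (a / x) \<in> U"
    using f_radical[of "a / x"] x y by (auto simp: U_def divide_inverse)
  ultimately show ?thesis using x by auto
qed

section \<open>Congruence modulo f\<close>

definition cong (infix "\<approx>" 50) where
  "x \<approx> y \<longleftrightarrow> x - y \<in> J 1"

lemma cong_refl [simp, intro]: "x \<approx> x"
  by (simp add: cong_def)

lemma cong_sym: "x \<approx> y \<Longrightarrow> y \<approx> x"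
  unfolding cong_def using J_uminus[of "x - y" 1] by simp

lemma cong_trans [trans]: "x \<approx> y \<Longrightarrow> y \<approx> z \<Longrightarrow> x \<approx> z"
  unfolding cong_def using J_add[of "x - y" 1 "y - z"] by simp

lemma cong_0_iff: "x \<approx> 0 \<longleftrightarrow> x \<in> J 1"
  by (simp add: cong_def)

lemma cong_add: "x \<approx> y \<Longrightarrow> x' \<approx> y' \<Longrightarrow> x + x' \<approx> y + y'"
  unfolding cong_def using J_add[of "x - y" 1 "x' - y'"] by (simp add: algebra_simps)

lemma cong_diff: "x \<approx> y \<Longrightarrow> x' \<approx> y' \<Longrightarrow> x - x' \<approx> y - y'"
  unfolding cong_def using J_diff[of "x - y" 1 "x' - y'"] by (simp add: algebra_simps)

lemma cong_R: "x \<approx> y \<Longrightarrow> y \<in> R \<Longrightarrow> x \<in> R"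
  unfolding cong_def using J_R[of "x - y" 1] R_add[of "x - y" y] by simp

lemma cong_U: "x \<approx> y \<Longrightarrow> y \<in> U \<Longrightarrow> x \<in> U"
  unfolding cong_def using U_add_J[of y "x - y"] by simp

lemma cong_mult:
  assumes "x \<approx> y" "x' \<approx> y'" "y \<in> R" "y' \<in> R"
  shows "x * x' \<approx> y * y'"
proof -
  have "x * x' - y * y' = (x - y) * x' + y * (x' - y')" by (simp add: algebra_simps)
  moreover have "x' \<in> R" using assms cong_R by blast
  ultimately show ?thesis using assms unfolding cong_def by auto
qed

lemma cong_power:
  assumes "x \<approx> y" "y \<in> R"
  shows "x ^ k \<approx> y ^ k"
  by (induction k) (use assms in \<open>auto intro!: cong_mult\<close>)

lemma cong_inverse:
  assumes "x \<approx> y" "y \<in> U"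
  shows "inverse x \<approx> inverse y"
proof -
  have x: "x \<in> U" using assms by (rule cong_U)
  have "inverse x - inverse y = (x - y) * (- (inverse x * inverse y))"
    using U_nz[OF x] U_nz[OF assms(2)] by (simp add: field_simps)
  thus ?thesis using assms(1) U_inverse_R[OF x] U_inverse_R[OF assms(2)] unfolding cong_def by auto
qed

lemma cong_divide:
  assumes "x \<approx> y" "x' \<approx> y'" "y \<in> R" "y' \<in> U"
  shows "x / x' \<approx> y / y'"
  unfolding divide_inverse using assms U_inverse_R by (intro cong_mult cong_inverse) auto

lemma cong_sum: "(\<And>i. i \<in> A \<Longrightarrow> g i \<approx> h i) \<Longrightarrow> sum g A \<approx> sum h A"
  unfolding cong_def sum_subtractf[symmetric] by auto

lemma cong_prod: "(\<And>i. i \<in> A \<Longrightarrow> g i \<approx> h i \<and> h i \<in> R) \<Longrightarrow> prod g A \<approx> prod h A"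
  by (induction A rule: infinite_finite_induct) (auto intro!: cong_mult)

text \<open>\<open>1 - y\<close> divides \<open>1 - y ^ n\<close>. This reduces the invertibility of
  all \<open>1 - q ^ i / c\<close> to that of \<open>1 - c ^ m\<close>.\<close>

lemma U_one_minus:
  assumes "y \<in> R" "1 - y ^ n \<in> U"
  shows "1 - y \<in> U"
proof (rule U_factor)
  show "(1 - y) * (\<Sum>i<n. y ^ i) \<in> U"
    using assms(2) by (simp add: one_diff_power_eq)
qed (use assms(1) in auto)

end

text \<open>The functions on the grid \<open>{1, Q} \<times> {1, 1/Q}\<close> which are induced by the elements of
  \<open>K[V, W] / (V\<^sup>2 - vV, W\<^sup>2 - wW)\<close>, where \<open>V = (1 - a)\<^sup>2 / a\<close> and \<open>W = b - 1\<close>.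
  They replace power series in the two parameters \<open>a\<close> and \<open>b\<close>: the coefficient of \<open>VW\<close> measures by
  how much the value at \<open>(1, 1)\<close> fails to be the alternating sum of the other three values.\<close>

locale deformation = radical_subring +
  fixes Q :: 'a
  assumes Q_J: "1 - Q \<in> J 1"
begin

lemma Q_U: "Q \<in> U"
  using U_add_J[OF U1 J_uminus[OF Q_J]] by simp

lemma Q0 [simp]: "Q \<noteq> 0"
  using U_nz[OF Q_U] .

lemma Q_R [simp, intro]: "Q \<in> R"
  using U_R[OF Q_U] .

lemma Q_cong: "Q \<approx> 1"
  using J_uminus[OF Q_J] by (simp add: cong_def)

definition v where "v = (1 - Q)\<^sup>2 / Q"
definition w where "w = 1 / Q - 1"

lemma v_J: "v \<in> J 2"
  unfolding v_def using J_power[OF Q_J, of 2] Q_U by auto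

lemma w_J: "w \<in> J 1"
proof -
  have "w = (1 - Q) / Q" by (simp add: w_def diff_divide_distrib)
  thus ?thesis using Q_J Q_U by auto
qed

lemma v_R [simp, intro]: "v \<in> R" and w_R [simp, intro]: "w \<in> R"
  using J_R[OF v_J] J_R[OF w_J] by auto

text \<open>The \<open>r\<close>'s are the coefficients of 1, \<open>V\<close>, \<open>W\<close>,
  \<open>VW\<close>, and \<open>k\<close> is the power of \<open>f\<close> dividing all of them.
  Only the four values on the grid enter, so functions may be exchanged freely if they agree
  there.\<close>

definition nice :: "nat \<Rightarrow> ('a \<Rightarrow> 'a \<Rightarrow> 'a) \<Rightarrow> bool" where
  "nice k F \<longleftrightarrow> (\<exists>r0\<in>J k. \<exists>r1\<in>J k. \<exists>r2\<in>J k. \<exists>r3\<in>J k. F 1 1 = r0 \<and> F Q 1 = r0 + r1 * v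
     \<and> F 1 (1 / Q) = r0 + r2 * w \<and> F Q (1 / Q) = r0 + r1 * v + r2 * w + r3 * v * w)"

lemma niceI:
  assumes "r0 \<in> J k" "r1 \<in> J k" "r2 \<in> J k" "r3 \<in> J k" "F 1 1 = r0" "F Q 1 = r0 + r1 * v"
    "F 1 (1 / Q) = r0 + r2 * w" "F Q (1 / Q) = r0 + r1 * v + r2 * w + r3 * v * w"
  shows "nice k F"
  using assms unfolding nice_def by blast

lemma niceE:
  assumes "nice k F"
  obtains r0 r1 r2 r3 where "r0 \<in> J k" "r1 \<in> J k" "r2 \<in> J k" "r3 \<in> J k" "F 1 1 = r0" "F Q 1 = r0 + r1 * v"
    "F 1 (1 / Q) = r0 + r2 * w" "F Q (1 / Q) = r0 + r1 * v + r2 * w + r3 * v * w"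
  using assms unfolding nice_def by blast

lemma nice_const: "x \<in> J k \<Longrightarrow> nice k (\<lambda>a b. x)"
  by (rule niceI[of x _ 0 0 0]) auto

lemma nice_b: "nice 0 (\<lambda>a b. b)"
  by (rule niceI[of 1 _ 0 1 0]) (auto simp: w_def)

text \<open>\<open>(1 - a * x) * (1 - x / a)\<close> equals \<open>(1 - x)^2 - x * V\<close>: the
  pairing of \<open>a\<close> with \<open>1 / a\<close> leaves only the second-order quantity
  \<open>V\<close>.\<close>

lemma nice_pair: "x \<in> R \<Longrightarrow> nice 0 (\<lambda>a b. (1 - a * x) * (1 - x / a))"
  by (rule niceI[of "(1 - x)\<^sup>2" _ "- x" 0 0])
    (auto simp: v_def field_simps power2_eq_square)

lemma nice_add:
  assumes "nice k F" "nice k G"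
  shows "nice k (\<lambda>a b. F a b + G a b)"
proof -
  from assms(1) obtain r0 r1 r2 r3 where *: "r0 \<in> J k" "r1 \<in> J k" "r2 \<in> J k" "r3 \<in> J k" "F 1 1 = r0"
    "F Q 1 = r0 + r1 * v"
    "F 1 (1 / Q) = r0 + r2 * w" "F Q (1 / Q) = r0 + r1 * v + r2 * w + r3 * v * w" by (rule niceE)
  from assms(2) obtain r0' r1' r2' r3' where **: "r0' \<in> J k" "r1' \<in> J k" "r2' \<in> J k" "r3' \<in> J k" "G 1 1 = r0'"
    "G Q 1 = r0' + r1' * v"
    "G 1 (1 / Q) = r0' + r2' * w" "G Q (1 / Q) = r0' + r1' * v + r2' * w + r3' * v * w" by (rule niceE)
  show ?thesis
    by (rule niceI[of "r0 + r0'" _ "r1 + r1'" "r2 + r2'" "r3 + r3'"]) (use * ** in \<open>auto simp: algebra_simps\<close>)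
qed

lemma nice_mult:
  assumes "nice i F" "nice j G"
  shows "nice (i + j) (\<lambda>a b. F a b * G a b)"
proof -
  from assms(1) obtain r0 r1 r2 r3 where *: "r0 \<in> J i" "r1 \<in> J i" "r2 \<in> J i" "r3 \<in> J i" "F 1 1 = r0"
    "F Q 1 = r0 + r1 * v"
    "F 1 (1 / Q) = r0 + r2 * w" "F Q (1 / Q) = r0 + r1 * v + r2 * w + r3 * v * w" by (rule niceE)
  from assms(2) obtain r0' r1' r2' r3' where **: "r0' \<in> J j" "r1' \<in> J j" "r2' \<in> J j" "r3' \<in> J j" "G 1 1 = r0'"
    "G Q 1 = r0' + r1' * v"
    "G 1 (1 / Q) = r0' + r2' * w" "G Q (1 / Q) = r0' + r1' * v + r2' * w + r3' * v * w" by (rule niceE)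
  note mem = *(1-4) **(1-4)
  \<comment> \<open>The coefficient of \<open>VW\<close> in the product, reduced by
    \<open>V^2 = v V\<close> and \<open>W^2 = w W\<close>.\<close>
  define r3'' where "r3'' = r0 * r3' + r3 * r0' + r1 * r2' + r2 * r1' + (r1 * r3' + r3 * r1') * v
    + (r2 * r3' + r3 * r2') * w + r3 * r3' * v * w"
  have "r0 * r0' \<in> J (i + j)" by (intro J_mult mem)
  moreover have "r0 * r1' + r1 * r0' + r1 * r1' * v \<in> J (i + j)" by (intro J_add J_multR[OF _ v_R] J_mult mem)
  moreover have "r0 * r2' + r2 * r0' + r2 * r2' * w \<in> J (i + j)" by (intro J_add J_multR[OF _ w_R] J_mult mem)
  moreover have "r3'' \<in> J (i + j)"
    unfolding r3''_def by (intro J_add J_multR[OF _ v_R] J_multR[OF _ w_R] J_mult mem)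
  ultimately show ?thesis
    by (rule niceI) (simp_all add: *(5-8) **(5-8) r3''_def algebra_simps)
qed

lemma nice_mult0: "nice 0 F \<Longrightarrow> nice 0 G \<Longrightarrow> nice 0 (\<lambda>a b. F a b * G a b)"
  using nice_mult[of 0 F 0 G] by simp

lemma nice_cmult: "x \<in> R \<Longrightarrow> nice k F \<Longrightarrow> nice k (\<lambda>a b. x * F a b)"
  using nice_mult[OF nice_const[of x 0]] by simp

lemma nice_diff:
  assumes "nice k F" "nice k G"
  shows "nice k (\<lambda>a b. F a b - G a b)"
  using nice_add[OF assms(1) nice_cmult[OF R_uminus[OF R1] assms(2)]] by simp

lemma nice_sum: "(\<And>i. i \<in> A \<Longrightarrow> nice k (F i)) \<Longrightarrow> nice k (\<lambda>a b. \<Sum>i\<in>A. F i a b)"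
  by (induction A rule: infinite_finite_induct) (auto intro: nice_add nice_const)

definition niceU :: "('a \<Rightarrow> 'a \<Rightarrow> 'a) \<Rightarrow> bool" where
  "niceU F \<longleftrightarrow> nice 0 F \<and> F 1 1 \<in> U"

lemma niceU_const: "x \<in> U \<Longrightarrow> niceU (\<lambda>a b. x)"
  unfolding niceU_def using nice_const[of x 0] U_R by simp

lemma niceU_mult: "niceU F \<Longrightarrow> niceU G \<Longrightarrow> niceU (\<lambda>a b. F a b * G a b)"
  unfolding niceU_def using nice_mult[of 0 F 0 G] by auto

lemma niceU_values:
  assumes "niceU F"
  shows "F 1 1 \<in> U" "F Q 1 \<in> U" "F 1 (1 / Q) \<in> U" "F Q (1 / Q) \<in> U"
proof -
  from assms have n: "nice 0 F" and u: "F 1 1 \<in> U" by (auto simp: niceU_def)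
  have v1: "v \<in> J 1" using J_mono[OF v_J] by simp
  from n obtain r0 r1 r2 r3 where *: "r0 \<in> J 0" "r1 \<in> J 0" "r2 \<in> J 0" "r3 \<in> J 0" "F 1 1 = r0"
    "F Q 1 = r0 + r1 * v"
    "F 1 (1 / Q) = r0 + r2 * w" "F Q (1 / Q) = r0 + r1 * v + r2 * w + r3 * v * w" by (rule niceE)
  show "F 1 1 \<in> U" by fact
  show "F Q 1 \<in> U" "F 1 (1 / Q) \<in> U" using U_add_J[OF u] * v1 w_J by auto
  show "F Q (1 / Q) \<in> U"
    using U_add_J[OF u, of "r1 * v + r2 * w + r3 * v * w"] * v1 w_J by (auto simp: add.assoc)
qed

lemma niceU_inverse:
  assumes "niceU F"
  shows "niceU (\<lambda>a b. inverse (F a b))"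
proof -
  note U = niceU_values[OF assms]
  from assms have n: "nice 0 F" by (auto simp: niceU_def)
  from n obtain r0 r1 r2 r3 where *: "r0 \<in> J 0" "r1 \<in> J 0" "r2 \<in> J 0" "r3 \<in> J 0" "F 1 1 = r0"
    "F Q 1 = r0 + r1 * v"
    "F 1 (1 / Q) = r0 + r2 * w" "F Q (1 / Q) = r0 + r1 * v + r2 * w + r3 * v * w" by (rule niceE)
  define x y z t where "x = F 1 1" and "y = F Q 1" and "z = F 1 (1 / Q)" and "t = F Q (1 / Q)"
  have nz: "x \<noteq> 0" "y \<noteq> 0" "z \<noteq> 0" "t \<noteq> 0" using U U_nz by (auto simp: x_def y_def z_def t_def)
  have inv: "inverse x \<in> R" "inverse y \<in> R" "inverse z \<in> R" "inverse t \<in> R"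
    using U U_inverse_R by (auto simp: x_def y_def z_def t_def)
  have in_R: "x \<in> R" "y \<in> R" "z \<in> R" "t \<in> R" using U U_R by (auto simp: x_def y_def z_def t_def)
  \<comment> \<open>Divided differences of the reciprocals: \<open>r3'\<close> is
    \<open>(1/x - 1/y - 1/z + 1/t) / (v * w)\<close> with the division carried out beforehand, so
    that it remains valid if \<open>v\<close> or \<open>w\<close> is 0.\<close>
  define r1' where "r1' = - r1 * (inverse x * inverse y)"
  define r2' where "r2' = - r2 * (inverse x * inverse z)"
  define r3' where "r3' = (r1 * (t * r2 + x * (r2 + r3 * v)) - r3 * y * x)
    * (inverse x * inverse y * (inverse z * inverse t))"
  have y: "y = x + r1 * v" and z: "z = x + r2 * w" and t: "t = x + r1 * v + r2 * w + r3 * v * w"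
    using * by (auto simp: x_def y_def z_def t_def)
  have 1: "inverse y = inverse x + r1' * v"
    using nz unfolding r1'_def by (simp add: field_simps) (simp add: y algebra_simps)
  have 2: "inverse z = inverse x + r2' * w"
    using nz unfolding r2'_def by (simp add: field_simps) (simp add: z algebra_simps)
  have "x * y * z * t * (inverse x + r1' * v + r2' * w + r3' * v * w)
     = y * z * t - r1 * v * (z * t) - r2 * w * (y * t) + (r1 * (t * r2 + x * (r2 + r3 * v)) - r3 * y * x) * v
     * w"
    using nz unfolding r1'_def r2'_def r3'_def by (simp add: field_simps)
  also have "\<dots> = x * y * z"
    unfolding y z t by (simp add: algebra_simps)
  also have "\<dots> = x * y * z * t * inverse t" using nz by simp
  finally have 3: "inverse t = inverse x + r1' * v + r2' * w + r3' * v * w"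
    using nz by (metis mult_left_cancel mult_eq_0_iff)
  have "r1' \<in> R" "r2' \<in> R" "r3' \<in> R"
    using *(1-4) inv in_R unfolding r1'_def r2'_def r3'_def J_0
    by (simp_all only: R_mult R_diff R_add R_uminus v_R)
  hence "nice 0 (\<lambda>a b. inverse (F a b))"
    using inv(1) 1 2 3 unfolding x_def y_def z_def t_def by (intro niceI[of _ _ r1' r2' r3']) auto
  with U(1) show ?thesis by (auto simp: niceU_def)
qed

lemma niceU_divide: "niceU F \<Longrightarrow> niceU G \<Longrightarrow> niceU (\<lambda>a b. F a b / G a b)"
  unfolding divide_inverse by (intro niceU_mult niceU_inverse)

lemma nice_divide: "nice k F \<Longrightarrow> niceU G \<Longrightarrow> nice k (\<lambda>a b. F a b / G a b)"
  unfolding divide_inverse using nice_mult[of k F 0] niceU_inverse[of G] by (auto simp: niceU_def)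

lemma niceU_prod: "(\<And>i. i \<in> A \<Longrightarrow> niceU (F i)) \<Longrightarrow> niceU (\<lambda>a b. \<Prod>i\<in>A. F i a b)"
  by (induction A rule: infinite_finite_induct) (auto intro: niceU_mult niceU_const)

lemma nice_prod: "(\<And>i. i \<in> A \<Longrightarrow> nice 0 (F i)) \<Longrightarrow> nice 0 (\<lambda>a b. \<Prod>i\<in>A. F i a b)"
  by (induction A rule: infinite_finite_induct) (auto intro: nice_mult0 nice_const)

text \<open>More than congruence of the four values: the coefficients of \<open>V\<close>,
  \<open>W\<close> and \<open>VW\<close> must be divisible by \<open>f\<close> too, which is what
  \<open>nice_interpolation\<close> consumes.\<close>

definition ncong :: "('a \<Rightarrow> 'a \<Rightarrow> 'a) \<Rightarrow> ('a \<Rightarrow> 'a \<Rightarrow> 'a) \<Rightarrow> bool" where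
  "ncong F G \<longleftrightarrow> nice 1 (\<lambda>a b. F a b - G a b)"

lemma ncong_const: "x \<approx> y \<Longrightarrow> ncong (\<lambda>a b. x) (\<lambda>a b. y)"
  unfolding ncong_def cong_def by (rule nice_const)

lemma ncong_refl [simp]: "ncong F F"
  unfolding ncong_def using nice_const[of 0 1] by simp

lemma ncong_sym: "ncong F G \<Longrightarrow> ncong G F"
  unfolding ncong_def using nice_diff[OF nice_const[of 0 1]] by fastforce

lemma ncong_trans [trans]: "ncong F G \<Longrightarrow> ncong G H \<Longrightarrow> ncong F H"
  unfolding ncong_def by (drule (1) nice_add) simp

lemma ncong_nice:
  assumes "ncong F G" "nice 0 G"
  shows "nice 0 F"
proof -
  have "nice 0 (\<lambda>a b. F a b - G a b)"
    using assms(1) unfolding ncong_def nice_def using J_R by (metis J_0)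
  from nice_add[OF this assms(2)] show ?thesis by simp
qed

lemma ncong_mult:
  assumes "ncong F G" "ncong F' G'" "nice 0 G" "nice 0 G'"
  shows "ncong (\<lambda>a b. F a b * F' a b) (\<lambda>a b. G a b * G' a b)"
proof -
  have "nice 1 (\<lambda>a b. (F a b - G a b) * F' a b + (F' a b - G' a b) * G a b)"
    using nice_mult[of 1 "\<lambda>a b. F a b - G a b" 0 F'] nice_mult[of 1 "\<lambda>a b. F' a b - G' a b" 0 G]
      assms ncong_nice[OF assms(2,4)] unfolding ncong_def by (intro nice_add) simp_all
  thus ?thesis unfolding ncong_def by (simp add: algebra_simps)
qed

lemma ncong_prod:
  "(\<And>i. i \<in> A \<Longrightarrow> ncong (F i) (G i) \<and> nice 0 (G i)) \<Longrightarrow> ncong (\<lambda>a b. \<Prod>i\<in>A. F i a b) (\<lambda>a b. \<Prod>i\<in>A. G i a b)"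
proof (induction A rule: infinite_finite_induct)
  case (insert x A)
  thus ?case by (simp, intro ncong_mult nice_prod) auto
qed auto

lemma ncong_b:
  assumes "x \<approx> y" "y \<in> R"
  shows "ncong (\<lambda>a b. 1 - b * x) (\<lambda>a b. 1 - b * y)"
proof -
  have "nice 1 (\<lambda>a b. (y - x) * b)"
    using nice_mult[OF nice_const nice_b, of "y - x" 1] cong_sym[OF assms(1)] by (simp add: cong_def)
  thus ?thesis by (simp add: ncong_def algebra_simps)
qed

lemma ncong_pair:
  assumes "x \<approx> y" "y \<in> R"
  shows "ncong (\<lambda>a b. (1 - a * x) * (1 - x / a)) (\<lambda>a b. (1 - a * y) * (1 - y / a))"
proof -
  have x: "x \<in> R" using assms by (rule cong_R)
  have "(1 - x)\<^sup>2 - (1 - y)\<^sup>2 = (x - y) * (x + y - 2)"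
    by (simp add: algebra_simps power2_eq_square)
  hence *: "(1 - x)\<^sup>2 - (1 - y)\<^sup>2 \<in> J 1" using assms x unfolding cong_def by auto
  have "y - x \<in> J 1" using cong_sym[OF assms(1)] by (simp add: cong_def)
  thus ?thesis unfolding ncong_def using *
    by (intro niceI[of "(1 - x)\<^sup>2 - (1 - y)\<^sup>2" _ "y - x" 0 0])
      (auto simp: v_def field_simps power2_eq_square)
qed

lemma nice_interpolation:
  assumes "nice 1 F"
  shows "F 1 1 - (F Q 1 + F 1 (1 / Q) - F Q (1 / Q)) \<in> J 4"
proof -
  from assms obtain r0 r1 r2 r3 where *: "r0 \<in> J 1" "r1 \<in> J 1" "r2 \<in> J 1" "r3 \<in> J 1" "F 1 1 = r0"
    "F Q 1 = r0 + r1 * v"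
    "F 1 (1 / Q) = r0 + r2 * w" "F Q (1 / Q) = r0 + r1 * v + r2 * w + r3 * v * w" by (rule niceE)
  have "r3 * v * w \<in> J 4" using J_mult[OF J_mult[OF *(4) v_J] w_J] by (simp add: eval_nat_numeral)
  thus ?thesis using * by simp
qed

end

section \<open>The truncated series at a cyclotomic place\<close>

text \<open>Modulo \<open>f\<close>, \<open>q\<close> behaves like a primitive \<open>m\<close>-th
  root of unity. Here \<open>m\<close> stands for any divisor of \<open>n\<close> other than 1,
  including \<open>n\<close> itself; \<open>c_m\<close> and \<open>d_m\<close> keep the factors
  containing \<open>c\<close> or \<open>d\<close> in the denominators invertible.\<close>

locale cyclotomic_place = wp_series q c d + radical_subring R f
  for q c d :: "'a::field" and R :: "'a set" and f :: 'a +
  fixes m :: nat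
  assumes m_odd: "odd m" and m1: "1 < m"
    and q_U: "q \<in> U" and q_m: "1 - q ^ m \<in> J 1" and U_q: "\<And>i. \<not> m dvd i \<Longrightarrow> 1 - q ^ i \<in> U"
    and c_U: "c \<in> U" and d_U: "d \<in> U" and c_m: "1 - c ^ m \<in> U" and d_m: "1 - d ^ m \<in> U"
begin

sublocale deformation R f "q ^ m"
  by unfold_locales (rule q_m)

abbreviation Q :: 'a where "Q \<equiv> q ^ m"

definition N :: nat where "N = (m + 1) div 2"

lemma N2: "2 * N = m + 1"
  using m_odd by (simp add: N_def)

lemma N_ge: "2 \<le> N"
  using m1 N2 m_odd by presburger

lemma qN: "(q^2) ^ N = q * Q"
  by (simp add: power_mult[symmetric] N2)

lemma q_R [simp, intro]: "q \<in> R" using U_R[OF q_U] .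

lemma U_one_minus_qx:
  assumes "x \<in> U" "1 - x ^ m \<in> U"
  shows "1 - q ^ i * x \<in> U"
proof (rule U_one_minus[of _ m])
  show "q ^ i * x \<in> R" using assms U_R by auto
  have "(q ^ i * x) ^ m = Q ^ i * x ^ m"
    by (simp add: power_mult_distrib power_mult[symmetric] mult.commute)
  moreover have "Q ^ i * x ^ m \<approx> 1 ^ i * x ^ m"
    using U_R[OF assms(1)] by (intro cong_mult cong_power Q_cong) auto
  ultimately have "1 - (q ^ i * x) ^ m \<approx> 1 - x ^ m" by (auto intro!: cong_diff)
  thus "1 - (q ^ i * x) ^ m \<in> U" using assms(2) by (rule cong_U)
qed

lemma U_one_minus_q_div:
  assumes "x \<in> U" "1 - x ^ m \<in> U"
  shows "1 - q ^ i / x \<in> U"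
proof -
  have "1 - (1 / x) ^ m = - ((1 - x ^ m) / x ^ m)"
    using U_nz[OF assms(1)] by (simp add: field_simps)
  hence "1 - (1 / x) ^ m \<in> U" using assms by auto
  from U_one_minus_qx[OF _ this, of i] assms(1) show ?thesis by auto
qed

lemma U_c: "1 - q ^ i / c \<in> U" and U_d: "1 - q ^ i / d \<in> U"
  using U_one_minus_q_div[OF c_U c_m] U_one_minus_q_div[OF d_U d_m] by auto

lemma m_dvd_even: "m dvd 2 * i \<longleftrightarrow> m dvd i"
  using m_odd by (simp add: coprime_dvd_mult_right_iff)

section \<open>Reversal symmetry of the truncated series\<close>

definition ypow :: "nat \<Rightarrow> 'a" where "ypow i = q ^ (2 * i) / q"
definition xpow :: "nat \<Rightarrow> 'a" where "xpow i = q ^ (2 * i + 2)"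

lemma xpow_U: "xpow i \<in> U" and ypow_U: "ypow i \<in> U"
  using q_U by (auto simp: xpow_def ypow_def simp del: power_Suc add_2_eq_Suc')

definition g :: "'a \<Rightarrow> 'a \<Rightarrow> 'a \<Rightarrow> 'a" where
  "g u a b = (1 - u) * ((1 - a * u) * (1 - u / a)) * (1 - b * u) * (1 - c * u) * (1 - d * u)"

definition h :: "nat \<Rightarrow> 'a \<Rightarrow> 'a \<Rightarrow> 'a" where
  "h i a b = (1 - xpow i) * ((1 - a * xpow i) * (1 - xpow i / a)) * (1 - xpow i / b) * (1 - xpow i / c)
  * (1 - xpow i / d)"

lemma nice_cong_values:
  assumes "nice k F" "F 1 1 = G 1 1" "F Q 1 = G Q 1" "F 1 (1 / Q) = G 1 (1 / Q)" "F Q (1 / Q) = G Q (1 / Q)"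
  shows "nice k G"
  using assms unfolding nice_def by simp

lemma nice_cong_nz:
  assumes "nice k F" "\<And>a b. a \<noteq> 0 \<Longrightarrow> b \<noteq> 0 \<Longrightarrow> F a b = G a b"
  shows "nice k G"
  using assms(1) by (rule nice_cong_values) (rule assms(2); simp add: q0)+

lemma niceU_b: "niceU (\<lambda>a b. b)"
  using nice_b by (auto simp: niceU_def)

lemma nice_one_minus_b: "u \<in> R \<Longrightarrow> nice 0 (\<lambda>a b. 1 - b * u)"
  using nice_diff[OF nice_const[of 1] nice_mult[OF nice_b nice_const[of u 0]]] by simp

lemma nice_g: "u \<in> R \<Longrightarrow> nice 0 (g u)"
  unfolding g_def using U_R[OF c_U] U_R[OF d_U]
  by (intro nice_mult0 nice_pair nice_one_minus_b nice_const) auto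

lemma niceU_h:
  assumes "\<not> m dvd 2 * i + 2"
  shows "niceU (h i)"
proof -
  have xU: "1 - xpow i \<in> U" using U_q[OF assms] by (simp only: xpow_def)
  have xR: "xpow i \<in> R" using U_R[OF xpow_U] .
  have "niceU (\<lambda>a b. (1 - a * xpow i) * (1 - xpow i / a))"
    using nice_pair[OF xR] xU by (auto simp: niceU_def)
  moreover have "nice 0 (\<lambda>a b. 1 - xpow i / b)"
    using nice_diff[OF nice_const[of 1 0] nice_divide[OF nice_const[of "xpow i" 0] niceU_b]] xR by simp
  hence "niceU (\<lambda>a b. 1 - xpow i / b)" using xU by (simp add: niceU_def)
  ultimately show ?thesis
    unfolding h_def using xU U_c[of "2 * i + 2", folded xpow_def] U_d[of "2 * i + 2", folded xpow_def]
    by (intro niceU_mult[OF niceU_mult[OF niceU_mult[OF niceU_mult]]] niceU_const)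
qed

lemma not_dvd_x: "i < N \<Longrightarrow> \<not> m dvd 2 * i + 2"
proof
  assume "i < N" "m dvd 2 * i + 2"
  hence "m dvd i + 1" using m_dvd_even[of "i + 1"] by simp
  moreover have "i + 1 < m" using \<open>i < N\<close> N2 m1 m_odd by presburger
  ultimately show False by (auto dest: dvd_imp_le)
qed

lemma ratio_eq: "a \<noteq> 0 \<Longrightarrow> ratio a (1 / a) b i = q ^ 7 / (b * c * d) * (g (ypow i) a b / h i a b)"
  unfolding ratio_def factor_def xpow_def[symmetric] ypow_def[symmetric] g_def h_def by (simp add: mult_ac)

text \<open>The source of the symmetry: the numerator of quotient \<open>N - 1 - j\<close> is
  evaluated at \<open>Q / xpow j\<close>, which modulo \<open>f\<close> is the reciprocal of the
  argument in the denominator of quotient \<open>j\<close>.\<close>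

lemma y_reverse: "j < N \<Longrightarrow> ypow (N - 1 - j) = Q * (1 / xpow j)"
proof -
  assume j: "j < N"
  have "q ^ (2 * (N - 1 - j)) * xpow j = q * Q"
    unfolding xpow_def power_add[symmetric] power_Suc[symmetric] using j N2
    by (intro arg_cong[where f = "power q"]) auto
  thus ?thesis using q0 U_nz[OF xpow_U[of j]] by (simp add: ypow_def field_simps)
qed

lemma ncong_g: "u \<approx> u' \<Longrightarrow> u' \<in> R \<Longrightarrow> ncong (g u) (g u')"
  unfolding g_def using U_R[OF c_U] U_R[OF d_U]
  by (intro ncong_mult ncong_pair ncong_b ncong_const cong_diff cong_mult
      nice_mult0 nice_pair nice_one_minus_b nice_const) auto

text \<open>Each factor satisfies \<open>1 - e / X = - (e / X) * (1 - X / e)\<close>. There are six,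
  so the signs cancel, and the parameters \<open>a\<close> and \<open>1 / a\<close> drop out of the
  product of the \<open>e\<close>.\<close>

lemma g_inverse_x: "a \<noteq> 0 \<Longrightarrow> b \<noteq> 0 \<Longrightarrow> g (1 / xpow j) a b = b * c * d / xpow j ^ 6 * h j a b"
proof -
  assume ab: "a \<noteq> 0" "b \<noteq> 0"
  define X where "X = xpow j"
  have X0: "X \<noteq> 0" using U_nz[OF xpow_U] by (simp add: X_def)
  have e: "1 - 1 / X = - (1 / X) * (1 - X)" "1 - a * (1 / X) = - (a / X) * (1 - X / a)"
    "1 - 1 / X / a = - (1 / (X * a)) * (1 - a * X)"
    "1 - b * (1 / X) = - (b / X) * (1 - X / b)" "1 - c * (1 / X) = - (c / X) * (1 - X / c)"
    "1 - d * (1 / X) = - (d / X) * (1 - X / d)"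
    using X0 ab c0 d0 by (simp_all add: field_simps)
  show ?thesis
    unfolding g_def h_def X_def[symmetric] e using X0 ab by (simp add: numeral_eq_Suc mult_ac)
qed

lemma ncong_gamma:
  assumes "j < N"
  shows "ncong (\<lambda>a b. g (ypow (N - 1 - j)) a b / h j a b) (\<lambda>a b. b * c * d / xpow j ^ 6)"
proof -
  have hU: "niceU (h j)" by (intro niceU_h not_dvd_x assms)
  have xR: "1 / xpow j \<in> R" using xpow_U by auto
  have "Q * (1 / xpow j) \<approx> 1 * (1 / xpow j)" by (intro cong_mult Q_cong) (use xR in auto)
  hence "ncong (g (ypow (N - 1 - j))) (g (1 / xpow j))"
    unfolding y_reverse[OF assms] using xR by (intro ncong_g) auto
  from this[unfolded ncong_def] hU have "nice 1 (\<lambda>a b. (g (ypow (N - 1 - j)) a b - g (1 / xpow j) a b)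
    / h j a b)"
    by (rule nice_divide)
  thus ?thesis unfolding ncong_def
    by (rule nice_cong_values) (use niceU_values[OF hU, THEN U_nz] q0 in \<open>simp_all add: diff_divide_distrib
    g_inverse_x\<close>)
qed

definition p :: "nat \<Rightarrow> 'a \<Rightarrow> 'a \<Rightarrow> 'a" where
  "p k a b = (\<Prod>j<k. ratio a (1 / a) b j)"

lemma niceU_z: "niceU (\<lambda>a b. q ^ 7 / (b * c * d))"
  using q_U c_U d_U by (intro niceU_divide niceU_mult niceU_b niceU_const) auto

lemma niceU_bcd: "u \<in> U \<Longrightarrow> niceU (\<lambda>a b. b * c * d / u)"
  using q_U c_U d_U by (intro niceU_divide niceU_mult niceU_b niceU_const) auto

lemma nice_ratio: "j < N \<Longrightarrow> nice 0 (\<lambda>a b. ratio a (1 / a) b j)"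
proof -
  assume "j < N"
  hence "nice 0 (\<lambda>a b. q ^ 7 / (b * c * d) * (g (ypow j) a b / h j a b))"
    using niceU_z U_R[OF ypow_U]
    by (intro nice_mult0 nice_divide[of 0 "g _"] nice_g niceU_h not_dvd_x) (auto simp: niceU_def)
  thus ?thesis by (rule nice_cong_nz) (simp add: ratio_eq)
qed

lemma nice_p: "k \<le> N \<Longrightarrow> nice 0 (p k)"
  unfolding p_def by (intro nice_prod nice_ratio) auto

lemma ncong_cong_nz:
  assumes "ncong F G" "\<And>a b. a \<noteq> 0 \<Longrightarrow> b \<noteq> 0 \<Longrightarrow> F a b = F' a b" "\<And>a b. a \<noteq> 0 \<Longrightarrow> b \<noteq> 0 \<Longrightarrow> G a b = G' a b"
  shows "ncong F' G'"
  using assms(1) unfolding ncong_def by (rule nice_cong_nz) (simp add: assms)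

text \<open>By \<open>ncong_gamma\<close> the numerator of either quotient cancels the denominator
  of the other. There remains \<open>q ^ 14 / (xpow j * xpow (N - 1 - j)) ^ 6\<close>, where
  \<open>a\<close> and \<open>b\<close> no longer occur and the two powers multiply to
  \<open>q ^ 3 * Q\<close>.\<close>

lemma ncong_ratio_reverse:
  assumes "j < N"
  shows "ncong (\<lambda>a b. ratio a (1 / a) b j * ratio a (1 / a) b (N - 1 - j)) (\<lambda>a b. 1 / q ^ 4)"
proof -
  define z where "z = (\<lambda>(a::'a) b. q ^ 7 / (b * c * d))"
  have z: "nice 0 z" using niceU_z by (simp add: z_def niceU_def)
  have j': "N - 1 - j < N" "N - 1 - (N - 1 - j) = j" using assms by auto
  have xx: "xpow j * xpow (N - 1 - j) = q ^ 3 * Q"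
    unfolding xpow_def power_add[symmetric] using assms N2 by (intro arg_cong[where f = "power q"]) auto
  have n: "nice 0 (\<lambda>a b. b * c * d / xpow i ^ 6)" for i
    using niceU_bcd[OF U_power[OF xpow_U]] by (auto simp: niceU_def)
  have "ncong (\<lambda>a b. (z a b * z a b) * ((g (ypow (N - 1 - j)) a b / h j a b)
    * (g (ypow j) a b / h (N - 1 - j) a b)))
    (\<lambda>a b. (z a b * z a b) * ((b * c * d / xpow j ^ 6) * (b * c * d / xpow (N - 1 - j) ^ 6)))"
    using ncong_gamma[OF assms] ncong_gamma[OF j'(1)] n z unfolding j'(2)
    by (intro ncong_mult nice_mult0) auto
  hence 1: "ncong (\<lambda>a b. ratio a (1 / a) b j * ratio a (1 / a) b (N - 1 - j)) (\<lambda>a b. q ^ 14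
    / (q ^ 3 * Q) ^ 6)"
  proof (rule ncong_cong_nz)
    fix a b :: 'a assume "a \<noteq> 0" "b \<noteq> 0"
    have "z a b * (b * c * d) = q ^ 7" using \<open>b \<noteq> 0\<close> c0 d0 by (simp add: z_def)
    moreover have "(z a b * z a b) * ((b * c * d / xpow j ^ 6) * (b * c * d / xpow (N - 1 - j) ^ 6))
      = (z a b * (b * c * d))\<^sup>2 / (xpow j * xpow (N - 1 - j)) ^ 6"
      by (simp add: power2_eq_square power_mult_distrib mult_ac)
    ultimately show "(z a b * z a b) * ((b * c * d / xpow j ^ 6) * (b * c * d / xpow (N - 1 - j) ^ 6))
      = q ^ 14 / (q ^ 3 * Q) ^ 6"
      unfolding xx by (simp add: power_mult[symmetric])
    show "(z a b * z a b) * ((g (ypow (N - 1 - j)) a b / h j a b) * (g (ypow j) a b / h (N - 1 - j) a b))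
      = ratio a (1 / a) b j * ratio a (1 / a) b (N - 1 - j)"
      using \<open>a \<noteq> 0\<close> by (simp add: ratio_eq z_def mult_ac)
  qed
  have "q ^ 14 / (q ^ 3 * Q) ^ 6 \<approx> q ^ 14 / (q ^ 3 * 1) ^ 6"
    using q_U Q_cong by (intro cong_divide cong_power cong_mult) auto
  moreover have "q ^ 14 / (q ^ 3 * 1) ^ 6 = 1 / q ^ 4"
    using q0 by (simp add: power_mult[symmetric] power_diff[symmetric] divide_simps power_add[symmetric])
  ultimately have "q ^ 14 / (q ^ 3 * Q) ^ 6 \<approx> 1 / q ^ 4" by simp
  hence "ncong (\<lambda>a b. q ^ 14 / (q ^ 3 * Q) ^ 6) (\<lambda>a b. 1 / q ^ 4)" by (rule ncong_const)
  with 1 show ?thesis by (rule ncong_trans)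
qed

lemma prod_x: "(\<Prod>j<k. xpow j) = q ^ (k * (k + 1))"
proof (induction k)
  case (Suc k)
  have "(\<Prod>j<Suc k. xpow j) = q ^ (k * (k + 1) + (2 * k + 2))"
    unfolding prod.lessThan_Suc Suc by (simp only: xpow_def power_add)
  also have "k * (k + 1) + (2 * k + 2) = Suc k * (Suc k + 1)" by simp
  finally show ?case .
qed simp

lemma ncong_p_N: "ncong (p N) (\<lambda>a b. 1 / q)"
proof -
  have "ncong (\<lambda>a b. \<Prod>j<N. q ^ 7 / (b * c * d) * (g (ypow (N - 1 - j)) a b / h j a b))
     (\<lambda>a b. \<Prod>j<N. q ^ 7 / (b * c * d) * (b * c * d / xpow j ^ 6))"
    using niceU_z niceU_bcd[OF U_power[OF xpow_U]]
    by (intro ncong_prod conjI ncong_mult ncong_refl nice_mult0 ncong_gamma) (auto simp: niceU_def)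
  hence "ncong (p N) (\<lambda>a b. q ^ (7 * N) / (q ^ (N * (N + 1))) ^ 6)"
  proof (rule ncong_cong_nz)
    fix a b :: 'a assume ab: "a \<noteq> 0" "b \<noteq> 0"
    have "(\<Prod>j<N. g (ypow (N - 1 - j)) a b) = (\<Prod>j<N. g (ypow j) a b)"
      using prod.nat_diff_reindex[of "\<lambda>j. g (ypow j) a b" N] by simp
    thus "(\<Prod>j<N. q ^ 7 / (b * c * d) * (g (ypow (N - 1 - j)) a b / h j a b)) = p N a b"
      unfolding p_def ratio_eq[OF ab(1)] prod.distrib prod_dividef by simp
    have "(\<Prod>j<N. q ^ 7 / (b * c * d) * (b * c * d / xpow j ^ 6)) = (\<Prod>j<N. q ^ 7 / xpow j ^ 6)"
      using ab c0 d0 by (intro prod.cong) auto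
    also have "\<dots> = q ^ (7 * N) / (q ^ (N * (N + 1))) ^ 6"
      unfolding prod_dividef prod_power_distrib[symmetric] prod_x
      by (simp add: power_mult[symmetric] mult.commute)
    finally show "(\<Prod>j<N. q ^ 7 / (b * c * d) * (b * c * d / xpow j ^ 6))
      = q ^ (7 * N) / (q ^ (N * (N + 1))) ^ 6" .
  qed
  \<comment> \<open>Modulo \<open>f\<close> the only relation at hand is
    \<open>q ^ (2 * N) = q * Q \<approx> q\<close>. Both exponents are expressed by
    \<open>2 * N\<close> up to a remainder \<open>3 * N\<close> that cancels.\<close>
  also have "(q ^ (N * (N + 1))) ^ 6 = ((q^2) ^ N) ^ (3 * N + 3)"
    by (simp add: power_mult[symmetric] algebra_simps)
  also have "\<dots> = (q * Q) ^ (3 * N + 3)" by (simp only: qN)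
  also have "q ^ (7 * N) = q ^ (3 * N) * (q * Q)\<^sup>2"
    unfolding qN[symmetric] by (simp add: power_mult[symmetric] power_add[symmetric] mult.commute)
  also have "q ^ (3 * N) * (q * Q)\<^sup>2 / (q * Q) ^ (3 * N + 3) \<approx> q ^ (3 * N) * (q * 1)\<^sup>2
    / (q * 1) ^ (3 * N + 3)"
    using q_U Q_cong by (intro cong_divide cong_power cong_mult) auto
  hence "q ^ (3 * N) * (q * Q)\<^sup>2 / (q * Q) ^ (3 * N + 3) \<approx> 1 / q"
    using q0 by (simp add: power_add field_simps power2_eq_square power3_eq_cube)
  hence "ncong (\<lambda>a b. q ^ (3 * N) * (q * Q)\<^sup>2 / (q * Q) ^ (3 * N + 3)) (\<lambda>a b. 1 / q)" by (rule ncong_const)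
  finally show ?thesis .
qed

lemma p_split: "k \<le> N \<Longrightarrow> p (N - k) a b * (\<Prod>j<k. ratio a (1 / a) b (N - 1 - j)) = p N a b"
proof (induction k)
  case (Suc k)
  have "p (N - k) a b = p (N - Suc k) a b * ratio a (1 / a) b (N - 1 - k)"
    using Suc.prems unfolding p_def by (subst Suc_diff_Suc[symmetric]) auto
  with Suc show ?case by (simp add: mult_ac)
qed simp

text \<open>Multiplied by the first \<open>k\<close> quotients, the last \<open>k\<close> quotients
  in \<open>p N\<close> form pairs congruent to \<open>1 / q ^ 4\<close>; thus
  \<open>p (N - k) / q ^ (4 * k)\<close> is congruent to \<open>p N * p k\<close>, and no quotient
  has to be inverted.\<close>

lemma ncong_p_reverse:
  assumes "k \<le> N"
  shows "ncong (p (N - k)) (\<lambda>a b. q ^ (4 * k) / q * p k a b)"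
proof -
  have q4: "1 / q ^ 4 \<in> R" "1 / q \<in> R" using q_U by (auto intro: U_R)
  have "ncong (\<lambda>a b. p (N - k) a b * (\<Prod>j<k. ratio a (1 / a) b j * ratio a (1 / a) b (N - 1 - j))) (\<lambda>a b. p (N
    - k) a b * (\<Prod>j<k. 1 / q ^ 4))"
    using assms q4 nice_p[of "N - k"] by (intro ncong_mult ncong_refl ncong_prod conjI ncong_ratio_reverse
    nice_const nice_prod) auto
  hence "ncong (\<lambda>a b. p (N - k) a b * (\<Prod>j<k. 1 / q ^ 4)) (\<lambda>a b. p (N - k) a b
    * (\<Prod>j<k. ratio a (1 / a) b j * ratio a (1 / a) b (N - 1 - j)))"
    by (rule ncong_sym)
  also have "(\<lambda>a b. p (N - k) a b * (\<Prod>j<k. ratio a (1 / a) b j * ratio a (1 / a) b (N - 1 - j)))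
    = (\<lambda>a b. p N a b * p k a b)"
    unfolding prod.distrib p_split[OF assms, symmetric] by (simp add: p_def mult_ac)
  also have "ncong (\<lambda>a b. p N a b * p k a b) (\<lambda>a b. 1 / q * p k a b)"
    using nice_p[OF assms] q4 by (intro ncong_mult ncong_p_N ncong_refl nice_const) auto
  finally have "ncong (\<lambda>a b. q ^ (4 * k) * (p (N - k) a b * (\<Prod>j<k. 1 / q ^ 4))) (\<lambda>a b. q ^ (4 * k)
    * (1 / q * p k a b))"
    using nice_p[OF assms] q4
    by (intro ncong_mult[OF ncong_refl[of "\<lambda>a b. q ^ (4 * k)"]] nice_mult0 nice_const) auto
  thus ?thesis
    by (rule ncong_cong_nz) (use q0 in \<open>simp_all add: power_mult power_divide\<close>)
qed

lemma one_minus_q_U: "1 - q \<in> U"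
  using U_q[of 1] m1 by simp

lemma qnum_R: "qnum k \<in> R"
proof -
  have "q ^ (4 * k) / q \<in> R" using q_U by auto
  thus ?thesis unfolding qnum_def using one_minus_q_U by auto
qed

text \<open>Modulo \<open>f\<close>, \<open>qnum (N - k)\<close> is
  \<open>- q^(1-4k) * qnum k\<close>, which compensates the factor \<open>q^(4k-1)\<close> of
  \<open>ncong_p_reverse\<close>. Adding the reversed sum treats a possible middle term like the
  others; the factor 2 is a unit.\<close>

lemma nice_S: "nice 1 (\<lambda>a b. S a (1 / a) b N)"
proof -
  have pair: "nice 1 (\<lambda>a b. qnum (N - k) * p (N - k) a b + qnum k * p k a b)" if "k \<le> N" for k
  proof -
    have "q ^ (4 * (N - k)) * q ^ (4 * k) = (q * Q)\<^sup>2"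
      unfolding qN[symmetric] power_mult[symmetric] power_add[symmetric] using that
      by (intro arg_cong[where f = "power q"]) auto
    hence e: "q ^ (4 * (N - k)) / q = q / q ^ (4 * k) * Q\<^sup>2"
      using q0 by (simp add: field_simps power2_eq_square)
    have qk: "q / q ^ (4 * k) \<in> R" "q ^ (4 * k) / q \<in> R" using q_U by (auto intro: U_R)
    have "qnum (N - k) \<approx> (1 - q / q ^ (4 * k) * 1\<^sup>2) / (1 - q)"
      unfolding qnum_def e using qk one_minus_q_U
      by (intro cong_divide[OF cong_diff[OF cong_refl cong_mult[OF cong_refl cong_power[OF Q_cong]]]
      cong_refl]) auto
    moreover have "(1 - q / q ^ (4 * k)) / (1 - q) \<in> R"
      by (intro R_divide R_diff R1 qk one_minus_q_U)
    ultimately have c: "ncong (\<lambda>a b. qnum (N - k) * p (N - k) a b) (\<lambda>a b. (1 - q / q ^ (4 * k)) / (1 - q)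
      * (q ^ (4 * k) / q * p k a b))"
      using nice_p[OF that] qk that
      by (intro ncong_mult ncong_p_reverse ncong_const nice_mult0 nice_const) auto
    have eq: "(1 - q / q ^ (4 * k)) / (1 - q) * (q ^ (4 * k) / q * t) = - (qnum k * t)" for t
    proof -
      have "(1 - q / q ^ (4 * k)) * (q ^ (4 * k) / q) = - (1 - q ^ (4 * k) / q)"
        using q0 by (simp add: field_simps)
      moreover have "(1 - q / q ^ (4 * k)) / (1 - q) * (q ^ (4 * k) / q * t)
          = (1 - q / q ^ (4 * k)) * (q ^ (4 * k) / q) * (t / (1 - q))"
        by (simp add: mult_ac)
      ultimately have "(1 - q / q ^ (4 * k)) / (1 - q) * (q ^ (4 * k) / q * t)
        = - (1 - q ^ (4 * k) / q) * (t / (1 - q))"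
        by (simp only:)
      thus ?thesis unfolding qnum_def by (simp only: mult_minus_left times_divide_eq_left
        times_divide_eq_right minus_divide_left)
    qed
    show ?thesis using c[unfolded eq] by (simp add: ncong_def)
  qed
  have "nice 1 (\<lambda>a b. \<Sum>k\<le>N. qnum (N - k) * p (N - k) a b + qnum k * p k a b)"
    using pair by (intro nice_sum) auto
  moreover have "(\<Sum>k\<le>N. qnum (N - k) * p (N - k) a b + qnum k * p k a b) = 2 * S a (1 / a) b N" for a b
  proof -
    have "(\<Sum>k\<le>N. qnum (N - k) * p (N - k) a b) = (\<Sum>k\<le>N. qnum k * p k a b)"
      by (rule sum.reindex_bij_witness[of _ "\<lambda>k. N - k" "\<lambda>k. N - k"]) auto
    thus ?thesis by (simp add: sum.distrib S_def p_def)
  qed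
  ultimately have "nice 1 (\<lambda>a b. 2 * S a (1 / a) b N)" by simp
  hence "nice 1 (\<lambda>a b. 1 / 2 * (2 * S a (1 / a) b N))"
    by (rule nice_cmult[rotated]) (auto intro: U_R)
  moreover have "(2::'a) \<noteq> 0" using U_nz[OF U_numeral[of "num.Bit0 num.One"]] .
  ultimately show ?thesis by simp
qed

section \<open>Sums over roots of unity modulo f\<close>

lemma q_pow_dvd_cong: "m dvd s \<Longrightarrow> q ^ s \<approx> 1"
  using cong_power[OF Q_cong R1] by (auto elim!: dvdE simp: power_mult)

lemma sum_q_powers:
  assumes "\<not> m dvd s"
  shows "(\<Sum>i<m. q ^ (i * s)) \<in> J 1"
proof -
  have "(1 - q ^ s) * (\<Sum>i<m. (q ^ s) ^ i) = 1 - (q ^ s) ^ m" by (simp add: one_diff_power_eq)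
  also have "(q ^ s) ^ m = q ^ (m * s)" by (simp add: power_mult[symmetric] mult.commute)
  finally have "(\<Sum>i<m. q ^ (i * s)) = (1 - q ^ (m * s)) / (1 - q ^ s)"
    using U_nz[OF U_q[OF assms]] by (simp add: power_mult[symmetric] field_simps)
  moreover have "1 - q ^ (m * s) \<in> J 1"
    using J_uminus[OF q_pow_dvd_cong[of "m * s", unfolded cong_def]] by simp
  ultimately show ?thesis using U_q[OF assms] by auto
qed

lemma sum_index_power:
  fixes u :: 'a
  shows "(1 - u) * (\<Sum>j<k. of_nat j * u ^ j) = u * (\<Sum>j<k. u ^ j) - of_nat k * u ^ k"
proof (induction k)
  case (Suc k)
  show ?case by (simp only: sum.lessThan_Suc distrib_left Suc) (simp add: algebra_simps)
qed simp

text \<open>The finite Fourier expansion of \<open>1 / (1 - \<zeta>)\<close> for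
  \<open>\<zeta>^m = 1\<close>, \<open>\<zeta> \<noteq> 1\<close>: in \<open>sum_index_power\<close>
  the geometric sum vanishes modulo \<open>f\<close>.\<close>

lemma inverse_one_minus_cong:
  assumes "\<not> m dvd s"
  shows "1 / (1 - q ^ s) \<approx> - (1 / of_nat m) * (\<Sum>j<m. of_nat j * q ^ (s * j))"
proof -
  have mU: "of_nat m \<in> U" using m1 by (intro U_of_nat) simp
  define W where "W = (\<Sum>j<m. of_nat j * q ^ (s * j))"
  have "(1 - q ^ s) * W = q ^ s * (\<Sum>j<m. q ^ (j * s)) - of_nat m * q ^ (s * m)"
    using sum_index_power[of "q ^ s" m] by (simp add: W_def power_mult[symmetric] mult.commute)
  also have "\<dots> \<approx> q ^ s * 0 - of_nat m * 1"
    using sum_q_powers[OF assms] q_pow_dvd_cong[of "s * m"]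
    by (intro cong_diff cong_mult) (auto simp: cong_0_iff)
  finally have "(1 - q ^ s) * W / ((1 - q ^ s) * - of_nat m) \<approx> (q ^ s * 0 - of_nat m * 1)
    / ((1 - q ^ s) * - of_nat m)"
    using mU U_q[OF assms] by (intro cong_divide cong_refl) auto
  moreover have "(1 - q ^ s) * W / ((1 - q ^ s) * - of_nat m) = - (1 / of_nat m) * W"
    using U_nz[OF U_q[OF assms]] by simp
  moreover have "(q ^ s * 0 - of_nat m * 1) / ((1 - q ^ s) * - of_nat m) = 1 / (1 - q ^ s)"
    using U_nz[OF mU] by simp
  ultimately show ?thesis unfolding W_def by (simp add: cong_sym)
qed

definition F :: "nat \<Rightarrow> 'a" where "F s = q ^ s / (1 - q ^ s)\<^sup>2"

text \<open>Since \<open>q ^ t\<close> is congruent to \<open>1 / q ^ s\<close>, \<open>F\<close>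
  splits into two reciprocals to which the Fourier expansion applies; the right side is also
  symmetric in \<open>s\<close> and \<open>t\<close>.\<close>

lemma F_reflect:
  assumes "\<not> m dvd s" "m dvd s + t"
  shows "F s \<approx> - (1 / (1 - q ^ s) * (1 / (1 - q ^ t)))"
proof -
  have "q ^ t = q ^ (s + t) / q ^ s" using q0 by (simp add: power_add)
  also have "\<dots> \<approx> 1 / q ^ s" using q_pow_dvd_cong[OF assms(2)] q_U by (intro cong_divide) auto
  finally have qt: "q ^ t \<approx> 1 / q ^ s" .
  have "1 - 1 / q ^ s = - (1 - q ^ s) / q ^ s" using q0 by (simp add: field_simps)
  moreover have "- (1 - q ^ s) / q ^ s \<in> U" using U_q[OF assms(1)] q_U by (intro U_divide U_uminus) auto
  ultimately have 1: "1 - 1 / q ^ s \<in> U" by simp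
  have "1 / (1 - q ^ s) * (1 / (1 - q ^ t)) \<approx> 1 / (1 - q ^ s) * (1 / (1 - 1 / q ^ s))"
    using qt 1 U_q[OF assms(1)] by (intro cong_mult cong_divide[OF cong_refl] cong_diff) (auto intro: U_R)
  moreover have "1 / (1 - q ^ s) * (1 / (1 - 1 / q ^ s)) = - F s"
  proof -
    have "1 - 1 / q ^ s = - ((1 - q ^ s) / q ^ s)" using q0 by (simp add: field_simps)
    thus ?thesis by (simp add: F_def power2_eq_square)
  qed
  ultimately have "1 / (1 - q ^ s) * (1 / (1 - q ^ t)) \<approx> - F s" by simp
  hence "0 - - F s \<approx> 0 - (1 / (1 - q ^ s) * (1 / (1 - q ^ t)))"
    by (intro cong_diff cong_refl cong_sym[of _ "- F s"])
  thus ?thesis by simp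
qed

lemma F_R: "\<not> m dvd s \<Longrightarrow> F s \<in> R"
  unfolding F_def using U_q[of s] by auto

lemma F_sym:
  assumes "\<not> m dvd s" "m dvd s + t"
  shows "F t \<approx> F s"
proof -
  have t: "\<not> m dvd t" using assms dvd_add_left_iff by blast
  have "F t \<approx> - (1 / (1 - q ^ t) * (1 / (1 - q ^ s)))"
    using F_reflect[OF t, of s] assms(2) by (simp add: add.commute)
  also have "\<dots> \<approx> F s" using cong_sym[OF F_reflect[OF assms]] by (simp add: mult.commute)
  finally show ?thesis .
qed

lemma sum_of_nat_lessThan: "2 * (\<Sum>j<k. of_nat j :: 'a) = of_nat k * (of_nat k - 1)"
  by (induction k) (auto simp: algebra_simps)

lemma sum_squares_lessThan: "6 * (\<Sum>j<k. of_nat j * of_nat j :: 'a)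
  = of_nat k * (of_nat k - 1) * (2 * of_nat k - 1)"
  by (induction k) (auto simp: algebra_simps)

text \<open>Both reciprocals are expanded and the sum over \<open>s\<close> is evaluated by
  orthogonality. There remains \<open>M * B - A * A\<close> with \<open>A\<close> the sum of the
  \<open>j < m\<close> and \<open>B\<close> the sum of their squares.\<close>

lemma sum_F: "12 * (\<Sum>s=1..<m. F s) \<approx> 1 - (of_nat m)\<^sup>2"
proof -
  define M where "M = (of_nat m :: 'a)"
  have MU: "M \<in> U" unfolding M_def using m1 by (intro U_of_nat) simp
  define W where "W s = (\<Sum>j<m. of_nat j * q ^ (s * j))" for s
  have F1: "F s \<approx> - (1 / M\<^sup>2) * (W s * W (s * (m - 1)))" if "s \<in> {1..<m}" for s
  proof -
    have s: "\<not> m dvd s" using that by (auto dest: dvd_imp_le)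
    have e: "s + s * (m - 1) = s * m" using m1 by (cases m) auto
    have t: "\<not> m dvd s * (m - 1)" using s e by (metis dvd_add_left_iff dvd_triv_right)
    have "F s \<approx> - (1 / (1 - q ^ s) * (1 / (1 - q ^ (s * (m - 1)))))"
      by (rule F_reflect) (use s e in auto)
    also have "0 - 1 / (1 - q ^ s) * (1 / (1 - q ^ (s * (m - 1)))) \<approx> 0 - (- (1 / M) * W s)
      * (- (1 / M) * W (s * (m - 1)))"
      unfolding M_def W_def
      by (intro cong_diff cong_refl cong_mult inverse_one_minus_cong s t R_mult R_uminus R_divide U_of_nat
      R_sum) (use m1 in auto)
    hence "- (1 / (1 - q ^ s) * (1 / (1 - q ^ (s * (m - 1))))) \<approx> - (1 / M\<^sup>2) * (W s * W (s * (m - 1)))"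
      by (simp add: power2_eq_square)
    finally show ?thesis .
  qed
  \<comment> \<open>The factor \<open>m - 1\<close> represents -1 modulo \<open>m\<close>. The sum
    over all residues \<open>s\<close> is \<open>M\<close> or 0; the term \<open>- 1\<close> removes
    \<open>s = 0\<close>.\<close>
  have orth: "(\<Sum>s=1..<m. q ^ (s * (j + (m - 1) * l))) \<approx> (if j = l then M else 0) - 1" if "j < m" "l < m"
    for j l
  proof -
    define r where "r = j + (m - 1) * l"
    have split: "(\<Sum>s<m. q ^ (s * r)) = 1 + (\<Sum>s=1..<m. q ^ (s * r))"
      using m1 by (simp add: lessThan_atLeast0 sum.atLeast_Suc_lessThan)
    have "(\<Sum>s<m. q ^ (s * r)) \<approx> (if j = l then M else 0)"
    proof (cases "j = l")
      case True
      hence "r = m * l" using m1 unfolding r_def by (cases m) auto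
      hence "m dvd r" by simp
      hence "(\<Sum>s<m. q ^ (s * r)) \<approx> (\<Sum>s<m. 1)" by (intro cong_sum q_pow_dvd_cong) auto
      thus ?thesis using True by (simp add: M_def)
    next
      case False
      have "\<not> m dvd r"
      proof
        assume "m dvd r"
        have e: "int (m - 1) = int m - 1" using m1 by simp
        from \<open>m dvd r\<close> have "int m dvd int r" by simp
        moreover have "int r = int j - int l + int m * int l"
          unfolding r_def of_nat_add of_nat_mult e by (simp add: algebra_simps)
        ultimately have "int m dvd int j - int l" by (metis dvd_add_left_iff dvd_triv_left)
        moreover have "\<bar>int j - int l\<bar> < int m" "int j - int l \<noteq> 0" using that False by auto
        ultimately show False using dvd_imp_le_int[of "int j - int l" "int m"] by simp
      qed
      thus ?thesis using False sum_q_powers by (simp add: cong_0_iff)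
    qed
    from cong_diff[OF this cong_refl[of 1]] show ?thesis unfolding split r_def[symmetric] by simp
  qed
  define A where "A = (\<Sum>j<m. of_nat j :: 'a)"
  define B where "B = (\<Sum>j<m. of_nat j * of_nat j :: 'a)"
  have "(\<Sum>s=1..<m. W s * W (s * (m - 1))) = (\<Sum>s=1..<m. \<Sum>j<m. \<Sum>l<m. of_nat j * of_nat l
    * q ^ (s * (j + (m - 1) * l)))"
    unfolding W_def sum_product
    by (intro sum.cong refl) (simp add: power_add[symmetric] algebra_simps)
  also have "\<dots> = (\<Sum>j<m. \<Sum>l<m. of_nat j * of_nat l * (\<Sum>s=1..<m. q ^ (s * (j + (m - 1) * l))))"
  proof -
    have "(\<Sum>s=1..<m. \<Sum>j<m. \<Sum>l<m. t s j l) = (\<Sum>j<m. \<Sum>l<m. \<Sum>s=1..<m. t s j l)" for t :: "nat \<Rightarrow> nat \<Rightarrow> nat \<Rightarrow> 'a"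
    proof -
      have "(\<Sum>s=1..<m. \<Sum>j<m. \<Sum>l<m. t s j l) = (\<Sum>j<m. \<Sum>s=1..<m. \<Sum>l<m. t s j l)" by (rule sum.swap)
      also have "\<dots> = (\<Sum>j<m. \<Sum>l<m. \<Sum>s=1..<m. t s j l)" by (intro sum.cong refl sum.swap)
      finally show ?thesis .
    qed
    thus ?thesis by (simp only: sum_distrib_left)
  qed
  also have "\<dots> \<approx> (\<Sum>j<m. \<Sum>l<m. of_nat j * of_nat l * ((if j = l then M else 0) - 1))"
    by (intro cong_sum cong_mult cong_refl orth) (auto simp: M_def)
  also have "\<dots> = M * B - A * A"
  proof -
    have "(\<Sum>l<m. of_nat j * of_nat l * ((if j = l then M else 0) - 1))
      = of_nat j * of_nat j * M - of_nat j * A" if "j < m" for j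
    proof -
      have "of_nat j * of_nat l * ((if j = l then M else 0) - 1)
          = (if j = l then of_nat j * of_nat l * M else 0) - of_nat j * of_nat l" for l
        by (simp add: right_diff_distrib)
      thus ?thesis using that by (simp add: sum_subtractf A_def sum_distrib_left)
    qed
    hence "(\<Sum>j<m. \<Sum>l<m. of_nat j * of_nat l * ((if j = l then M else 0) - 1))
        = (\<Sum>j<m. of_nat j * of_nat j * M - of_nat j * A)" by (intro sum.cong) auto
    also have "\<dots> = B * M - A * A" by (simp only: sum_subtractf sum_distrib_right B_def A_def)
    finally show ?thesis by (simp only: mult.commute)
  qed
  finally have WW: "(\<Sum>s=1..<m. W s * W (s * (m - 1))) \<approx> M * B - A * A" .
  have AB: "A \<in> R" "B \<in> R" unfolding A_def B_def by (intro R_sum R_mult R_of_nat)+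
  have "(\<Sum>s=1..<m. F s) \<approx> (\<Sum>s=1..<m. - (1 / M\<^sup>2) * (W s * W (s * (m - 1))))"
    using F1 by (intro cong_sum)
  also have "\<dots> = - (1 / M\<^sup>2) * (\<Sum>s=1..<m. W s * W (s * (m - 1)))" by (simp only: sum_distrib_left)
  also have "\<dots> \<approx> - (1 / M\<^sup>2) * (M * B - A * A)"
    by (intro cong_mult cong_refl WW R_uminus R_divide R1 U_power MU R_diff R_mult AB U_R[OF MU])
  finally have "12 * (\<Sum>s=1..<m. F s) \<approx> 12 * (- (1 / M\<^sup>2) * (M * B - A * A))"
    by (intro cong_mult cong_refl R_uminus R_divide R1 U_power MU R_diff R_mult AB U_R[OF MU] R_numeral)
  also have "12 * (- (1 / M\<^sup>2) * (M * B - A * A)) = - (1 / M\<^sup>2) * (M\<^sup>2 * (M\<^sup>2 - 1))"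
  proof -
    have a: "2 * A = M * (M - 1)" "6 * B = M * (M - 1) * (2 * M - 1)"
      unfolding A_def B_def M_def by (rule sum_of_nat_lessThan sum_squares_lessThan)+
    have "12 * (M * B - A * A) = 2 * M * (6 * B) - 3 * ((2 * A) * (2 * A))" by (simp add: algebra_simps)
    also have "\<dots> = M\<^sup>2 * (M\<^sup>2 - 1)" unfolding a by (simp add: algebra_simps power2_eq_square)
    finally show ?thesis by (simp only: mult.left_commute[of 12])
  qed
  also have "\<dots> = 1 - M\<^sup>2" using U_nz[OF MU] by simp
  finally show ?thesis unfolding M_def .
qed

lemma sum_even_odd: "(\<Sum>i<2 * (k::nat). G i) = (\<Sum>j<k. G (2 * j) + G (2 * j + 1) :: 'a)"
  by (induction k) (auto simp: add.assoc)

definition K :: 'a where "K = (of_nat m)\<^sup>2 * (1 - q)\<^sup>2 - (1 + 22 * q + q^2)"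

lemma K_R: "K \<in> R"
  unfolding K_def by (auto intro!: R_diff R_add R_mult R_power)

text \<open>The even indices up to \<open>m - 1\<close> meet each pair \<open>s\<close>,
  \<open>m - s\<close> once and give half of \<open>sum_F\<close>. The last index is
  \<open>m + 1\<close> and contributes \<open>q / (1 - q)^2\<close>; its \<open>24 * q\<close> turns
  \<open>(1 - q)^2\<close> into \<open>1 + 22 * q + q^2\<close>.\<close>

lemma sum_x: "24 * (1 - q)\<^sup>2 * (\<Sum>j<N. F (2 * j + 2)) \<approx> - K"
proof -
  define k where "k = N - 1"
  have k: "m = 2 * k + 1" "N = Suc k" using N2 N_ge by (auto simp: k_def)
  have nd: "\<not> m dvd 2 * j + 2" if "j < k" for j using not_dvd_x[of j] that k by simp
  have "(\<Sum>s=1..<m. F s) = (\<Sum>i<2 * k. F (Suc i))"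
    using sum.shift_bounds_Suc_ivl[of F 0 "2 * k"] by (simp add: k lessThan_atLeast0)
  also have "\<dots> = (\<Sum>j<k. F (2 * j + 1)) + (\<Sum>j<k. F (2 * j + 2))"
    unfolding sum_even_odd by (simp add: sum.distrib)
  also have "(\<Sum>j<k. F (2 * j + 1)) = (\<Sum>j<k. F (2 * (k - Suc j) + 1))"
    by (rule sum.nat_diff_reindex[symmetric])
  also have "(\<Sum>j<k. F (2 * (k - Suc j) + 1)) + (\<Sum>j<k. F (2 * j + 2)) \<approx> (\<Sum>j<k. F (2 * j + 2))
    + (\<Sum>j<k. F (2 * j + 2))"
  proof (intro cong_add cong_sum cong_refl F_sym nd)
    fix j assume "j \<in> {..<k}"
    hence "2 * j + 2 + (2 * (k - Suc j) + 1) = m" using k by auto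
    thus "m dvd 2 * j + 2 + (2 * (k - Suc j) + 1)" by simp
  qed auto
  finally have "2 * (\<Sum>j<k. F (2 * j + 2)) \<approx> (\<Sum>s=1..<m. F s)"
    unfolding mult_2 by (rule cong_sym)
  hence "12 * (2 * (\<Sum>j<k. F (2 * j + 2))) \<approx> 12 * (\<Sum>s=1..<m. F s)"
    by (intro cong_mult cong_refl R_sum F_R) (auto dest: dvd_imp_le)
  also note sum_F
  finally have 1: "(1 - q)\<^sup>2 * (12 * (2 * (\<Sum>j<k. F (2 * j + 2)))) \<approx> (1 - q)\<^sup>2 * (1 - (of_nat m)\<^sup>2)"
    by (intro cong_mult cong_refl) auto
  have "q ^ (2 * k + 2) = q * Q" using k by simp
  hence "F (2 * k + 2) = q * Q / (1 - q * Q)\<^sup>2" by (simp only: F_def)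
  also have "\<dots> \<approx> q * 1 / (1 - q * 1)\<^sup>2"
    using one_minus_q_U by (intro cong_divide cong_power cong_diff cong_mult cong_refl Q_cong) auto
  finally have "24 * (1 - q)\<^sup>2 * F (2 * k + 2) \<approx> 24 * (1 - q)\<^sup>2 * (q * 1 / (1 - q * 1)\<^sup>2)"
    using one_minus_q_U by (intro cong_mult cong_refl) (auto intro: U_R)
  hence 2: "24 * (1 - q)\<^sup>2 * F (2 * k + 2) \<approx> 24 * q" using U_nz[OF one_minus_q_U] by simp
  have "24 * (1 - q)\<^sup>2 * (\<Sum>j<N. F (2 * j + 2))
    = (1 - q)\<^sup>2 * (12 * (2 * (\<Sum>j<k. F (2 * j + 2)))) + 24 * (1 - q)\<^sup>2 * F (2 * k + 2)"
    unfolding k(2) sum.lessThan_Suc by (simp add: algebra_simps)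
  also have "\<dots> \<approx> (1 - q)\<^sup>2 * (1 - (of_nat m)\<^sup>2) + 24 * q" by (rule cong_add[OF 1 2])
  also have "\<dots> = - K" by (simp add: K_def algebra_simps power2_eq_square)
  finally show ?thesis .
qed

section \<open>Integrality of the balanced series on the grid\<close>

lemma xpow_eq: "q^2 * (q^2) ^ i = xpow i"
  unfolding xpow_def power_add power_mult by (rule mult.commute)

lemma qfact_q2: "qf (q^2 * e) k = (\<Prod>i<k. 1 - e * xpow i)"
proof -
  have "q^2 * e * (q^2) ^ i = e * xpow i" for i unfolding xpow_eq[symmetric] by (simp only: mult_ac)
  thus ?thesis by (simp only: qfact_def)
qed

lemma xpow_R: "xpow i \<in> R" using xpow_U U_R by blast
lemma ypow_R: "ypow i \<in> R" using ypow_U U_R by blast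

lemma U_one_minus_xpow: "i < N \<Longrightarrow> 1 - xpow i \<in> U"
  unfolding xpow_def using U_q[OF not_dvd_x] by blast

lemma U_qfact_q2:
  assumes "e \<approx> 1" "k \<le> N"
  shows "qf (q^2 * e) k \<in> U"
  unfolding qfact_q2
proof (intro U_prod)
  fix i assume "i \<in> {..<k}"
  have "1 - e * xpow i \<approx> 1 - 1 * xpow i"
    using assms(1) xpow_R by (intro cong_diff cong_mult) auto
  thus "1 - e * xpow i \<in> U"
    by (rule cong_U) (use U_one_minus_xpow[of i] \<open>i \<in> {..<k}\<close> assms(2) in simp)
qed

lemma qfact_cong:
  assumes "e \<approx> e'" "e' \<in> R"
  shows "qf e k \<approx> qf e' k"
  unfolding qfact_def using assms by (intro cong_prod conjI cong_diff cong_mult R_diff R_mult) auto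

lemma qfact_R: "e \<in> R \<Longrightarrow> qf e k \<in> R"
  unfolding qfact_def by (intro R_prod R_diff R_mult) auto

lemma qfact_J:
  assumes "e \<in> R" "i < k" "e * (q^2) ^ i = Q"
  shows "qf e k \<in> J 1"
proof -
  have eq: "qf e k = (1 - e * (q^2) ^ i) * (\<Prod>j\<in>{..<k} - {i}. 1 - e * (q^2) ^ j)"
    unfolding qfact_def using assms by (intro prod.remove) auto
  show ?thesis unfolding eq assms(3) by (intro J_multR[OF q_m] R_prod R_diff R1 R_mult assms(1) R_power q_R)
qed

lemma nice_T: "nice 0 (T N)"
  unfolding T_def
proof (intro nice_sum)
  fix i assume "i \<in> {..N - 2}"
  hence i: "i + 2 \<le> N" "i \<le> N" using N_ge by auto
  have "Y (i + 2) \<in> R"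
  proof -
    have "qf (q^2) (i + 2) \<in> U" using U_qfact_q2[OF cong_refl i(1)] by simp
    moreover have "qf (q^2 / c) k \<in> U" for k
    proof -
      have e: "q^2 / c * (q^2) ^ j = q ^ (2 + 2 * j) / c" for j
        by (simp only: power_add power_mult times_divide_eq_left)
      show ?thesis unfolding qfact_def e by (intro U_prod U_c)
    qed
    moreover have "qf (q^2 / d) k \<in> U" for k
    proof -
      have e: "q^2 / d * (q^2) ^ j = q ^ (2 + 2 * j) / d" for j
        by (simp only: power_add power_mult times_divide_eq_left)
      show ?thesis unfolding qfact_def e by (intro U_prod U_d)
    qed
    moreover have "q ^ 3 / (c * d) \<in> R" using c_U d_U by auto
    ultimately show ?thesis
      unfolding Y_def by (intro R_mult R_divide qfact_R U_mult R_power q_R c_U d_U)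
  qed
  moreover have "nice 0 (\<lambda>a b. qf (a / q) k * qf (1 / a / q) k)" for k
  proof -
    have e: "a / q * (q^2) ^ i = a * ypow i" "1 / a / q * (q^2) ^ i = ypow i / a" for a i
      by (simp_all add: ypow_def power_mult)
    show ?thesis
      unfolding qfact_def prod.distrib[symmetric] e(2) unfolding e(1) by (intro nice_prod nice_pair ypow_R)
  qed
  moreover have "nice 0 (\<lambda>a b. qf (b / q) k)" for k
  proof -
    have e: "b / q * (q^2) ^ i = b * ypow i" for b i
      by (simp add: ypow_def power_mult)
    show ?thesis unfolding qfact_def e by (intro nice_prod nice_one_minus_b ypow_R)
  qed
  moreover have "niceU (\<lambda>a b. qf (q^2 * b) i)"
    unfolding qfact_q2
  proof (intro niceU_prod)
    fix j assume "j \<in> {..<i}"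
    thus "niceU (\<lambda>a b. 1 - b * xpow j)"
      using nice_one_minus_b[OF xpow_R] U_one_minus_xpow[of j] i by (auto simp: niceU_def)
  qed
  ultimately show "nice 0 (\<lambda>a b. Y (i + 2) * (qf (a / q) (i + 2) * qf (1 / a / q) (i + 2)
     * qf (b / q) (i + 2) / qf (q^2 * b) i))"
    by (intro nice_cmult nice_divide nice_mult0[where G = "\<lambda>a b. qf (b / q) (i + 2)"])
qed

section \<open>The three terminating corners\<close>

definition B :: 'a where "B = - (1 / q) * qf q N"
text \<open>\<open>D0\<close>, \<open>D1\<close>, \<open>D2\<close> are the products
  \<open>qf (q^2 / e) N\<close> for \<open>e = 1\<close>, \<open>Q\<close>, \<open>1 / Q\<close>;
  \<open>G3\<close> and \<open>G3'\<close> are \<open>qf X (N - 2)\<close> for the two occurring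
  values \<open>q ^ 3\<close> and \<open>q ^ 3 / Q\<close> of \<open>X\<close>.\<close>

definition D0 :: 'a where "D0 = qf (q^2) N"
definition D1 :: 'a where "D1 = qf (q^2 * (1 / Q)) N"
definition D2 :: 'a where "D2 = qf (q^2 * Q) N"
definition G3 :: 'a where "G3 = qf (q ^ 3) (N - 2)"
definition G3' :: 'a where "G3' = qf (q ^ 3 / Q) (N - 2)"

lemma invQ_cong: "1 / Q \<approx> 1"
  using cong_divide[OF cong_refl Q_cong, of 1] by simp

lemma D_U: "D0 \<in> U" "D1 \<in> U" "D2 \<in> U"
  unfolding D0_def D1_def D2_def
  using U_qfact_q2[OF cong_refl order_refl] U_qfact_q2[OF Q_cong order_refl]
  U_qfact_q2[OF invQ_cong order_refl] by simp_all

lemma B_J: "B \<in> J 1"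
proof -
  have "q * (q^2) ^ (N - 1) = Q"
    using N2 N_ge unfolding power_mult[symmetric] power_Suc[symmetric]
    by (intro arg_cong[where f = "power q"]) auto
  hence "qf q N \<in> J 1" using N_ge by (intro qfact_J[of _ "N - 1"]) auto
  moreover have "- (1 / q) \<in> R" using q_U by auto
  ultimately show ?thesis unfolding B_def by (intro J_Rmult)
qed

lemma q3_top: "q ^ 3 * (q^2) ^ (N - 2) = Q"
  using N2 N_ge unfolding power_mult[symmetric] power_add[symmetric]
  by (intro arg_cong[where f = "power q"]) auto

lemma E1_R: "E1 N \<in> R"
proof -
  have "1 - q^2 \<in> U" using U_one_minus_xpow[of 0] N_ge by (simp add: xpow_def power2_eq_square)
  moreover have "1 - q^2 / c \<in> U" "1 - q^2 / d \<in> U" using U_c[of 2] U_d[of 2] by auto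
  moreover have "1 - q ^ 3 / (c * d) \<in> R" using c_U d_U by auto
  ultimately show ?thesis unfolding E1_def by (intro R_mult R_divide U_mult R_diff R1 R_power q_R c_U d_U)
qed

text \<open>Here \<open>X = q ^ 3 / Q\<close>, and the products of lengths \<open>N\<close> and
  \<open>N - 1\<close> contain the factor \<open>1 - X * (q^2) ^ (N - 2) = 0\<close>: the terms 0
  and 1 drop out.\<close>

lemma S_Q_1: "S Q (1 / Q) 1 N = B * (q^2 * G3') / (D1 * D0) * T N Q 1"
proof -
  have nz: "qf (q^2 / Q) N = D1" "qf (q^2 / 1) N = D0" by (simp_all add: D1_def D0_def)
  have "S Q 1 (1 / Q) N = - (1 / q) * qf q N / (qf (q^2 / Q) N * qf (q^2 / 1) N)
     * (qf (q ^ 3 / (Q * 1)) N + E1 N * ((1 - Q / q) * (1 - 1 / q)) *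
     (qf (q ^ 3 / (Q * 1)) (N - 1) * (q ^ 3 / (Q * 1)))
        + q^2 * (Q / (Q * 1))\<^sup>2 * qf (q ^ 3 / (Q * 1)) (N - 2)
          * (\<Sum>i\<le>N - 2. Y (i + 2) * (qf (Q / q) (i + 2) * qf (1 / q) (i + 2)
               * qf (1 / Q / q) (i + 2) / qf (q^2 * (Q * 1) / Q) i)))"
    by (rule terminating_shifted[OF qN])
      (use D_U U_nz N_ge nz q0 in \<open>auto simp: qfact_square_nz\<close>)
  moreover have "qf (q ^ 3 / (Q * 1)) N = 0" "qf (q ^ 3 / (Q * 1)) (N - 1) = 0"
    unfolding qfact_eq_0_iff using q3_top N_ge q0
    by (intro exI[of _ "N - 2"], simp)+
  moreover have "S Q 1 (1 / Q) N = S Q (1 / Q) 1 N"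
    unfolding S_def ratio_def by (simp only: mult_ac)
  moreover have "(\<Sum>i\<le>N - 2. Y (i + 2) * (qf (Q / q) (i + 2) * qf (1 / q) (i + 2)
               * qf (1 / Q / q) (i + 2) / qf (q^2 * (Q * 1) / Q) i)) = T N Q 1"
    unfolding T_def using q0 by (intro sum.cong refl) (simp add: mult_ac)
  ultimately show ?thesis
    unfolding B_def G3'_def nz using q0 by simp
qed

text \<open>The corners with \<open>b = 1 / Q\<close>. Now \<open>X = q ^ 3\<close>, so the terms 0
  and 1 stay, each with a factor \<open>1 - Q\<close>.\<close>

lemma S_bottom:
  assumes e: "e1 \<noteq> 0" "e2 \<noteq> 0" "e1 * e2 = 1" and nz: "qf (q^2 / e1) N \<in> U" "qf (q^2 / e2) N \<in> U"
    and e2: "e2 = 1 / e1"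
  shows "S e1 e2 (1 / Q) N = B / (qf (q^2 / e1) N * qf (q^2 / e2) N)
     * (qf (q ^ 3) N + E1 N * ((1 - e1 / q) * (1 - e2 / q)) * (qf (q ^ 3) (N - 1) * q ^ 3)
        + q^2 * Q\<^sup>2 * G3 * T N e1 (1 / Q))"
proof -
  have u: "i \<le> N - 2 \<Longrightarrow> qf (q^2 * (e1 * e2) / Q) i \<noteq> 0" for i
    using U_nz[OF U_qfact_q2[OF invQ_cong, of i]] by (simp add: e)
  have "S e1 e2 (1 / Q) N = - (1 / q) * qf q N / (qf (q^2 / e1) N * qf (q^2 / e2) N)
     * (qf (q ^ 3 / (e1 * e2)) N + E1 N * ((1 - e1 / q) * (1 - e2 / q)) *
     (qf (q ^ 3 / (e1 * e2)) (N - 1) * (q ^ 3 / (e1 * e2)))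
        + q^2 * (Q / (e1 * e2))\<^sup>2 * qf (q ^ 3 / (e1 * e2)) (N - 2)
          * (\<Sum>i\<le>N - 2. Y (i + 2) * (qf (e1 / q) (i + 2) * qf (e2 / q) (i + 2)
               * qf (1 / Q / q) (i + 2) / qf (q^2 * (e1 * e2) / Q) i)))"
    by (rule terminating_shifted[OF qN e(1,2) N_ge U_nz[OF nz(1)] U_nz[OF nz(2)] u])
  moreover have "(\<Sum>i\<le>N - 2. Y (i + 2) * (qf (e1 / q) (i + 2) * qf (e2 / q) (i + 2)
               * qf (1 / Q / q) (i + 2) / qf (q^2 * (e1 * e2) / Q) i)) = T N e1 (1 / Q)"
    unfolding T_def e(3) unfolding e2 by (intro sum.cong refl) simp
  ultimately show ?thesis
    unfolding e(3) B_def G3_def by simp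
qed

lemma S_1_invQ: "S 1 1 (1 / Q) N = B / (D0 * D0)
     * (qf (q ^ 3) N + E1 N * ((1 - 1 / q) * (1 - 1 / q)) * (qf (q ^ 3) (N - 1) * q ^ 3)
        + q^2 * Q\<^sup>2 * G3 * T N 1 (1 / Q))"
  using S_bottom[of 1 1] D_U by (simp add: D0_def)

lemma S_Q_invQ: "S Q (1 / Q) (1 / Q) N = B / (D1 * D2)
     * (qf (q ^ 3) N + E1 N * ((1 - Q / q) * (1 - 1 / Q / q)) * (qf (q ^ 3) (N - 1) * q ^ 3)
        + q^2 * Q\<^sup>2 * G3 * T N Q (1 / Q))"
  using S_bottom[of Q "1 / Q"] D_U q0 by (simp add: D1_def D2_def)

lemma v_pair: "(1 - Q * u) * (1 - u / Q) = (1 - u)\<^sup>2 - u * v"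
  using q0 by (simp add: v_def field_simps power2_eq_square)

lemma D12: "D1 * D2 = (\<Prod>i<N. (1 - xpow i)\<^sup>2 - xpow i * v)"
  unfolding D1_def D2_def qfact_q2 prod.distrib[symmetric]
  by (intro prod.cong refl) (simp add: v_pair[symmetric] mult.commute)

lemma F_xpow: "F (2 * j + 2) = xpow j / (1 - xpow j)\<^sup>2"
  by (simp only: F_def xpow_def)

text \<open>Expansion to first order in \<open>v\<close>: factoring out
  \<open>(1 - xpow i)^2\<close> leaves \<open>1 - v * F (2 * i + 2)\<close>. This is how the sum
  over roots of unity enters the constant.\<close>

lemma prod_expand:
  "k \<le> N \<Longrightarrow> \<exists>r\<in>R. (\<Prod>i<k. (1 - xpow i)\<^sup>2 - xpow i * v)
      = (\<Prod>i<k. (1 - xpow i)\<^sup>2) * (1 - v * (\<Sum>j<k. F (2 * j + 2)) + v\<^sup>2 * r)"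
proof (induction k)
  case (Suc k)
  then obtain r where r: "r \<in> R" "(\<Prod>i<k. (1 - xpow i)\<^sup>2 - xpow i * v)
      = (\<Prod>i<k. (1 - xpow i)\<^sup>2) * (1 - v * (\<Sum>j<k. F (2 * j + 2)) + v\<^sup>2 * r)" by auto
  define Z where "Z = (\<Sum>j<k. F (2 * j + 2))"
  have FR: "F (2 * j + 2) \<in> R" if "j \<le> k" for j using F_R not_dvd_x[of j] that Suc.prems by auto
  have u: "1 - xpow k \<noteq> 0" using U_nz[OF U_one_minus_xpow[of k]] Suc.prems by simp
  have "(1 - xpow k)\<^sup>2 - xpow k * v = (1 - xpow k)\<^sup>2 * (1 - v * F (2 * k + 2))"
    unfolding F_xpow using u by (simp add: field_simps)
  hence "(\<Prod>i<Suc k. (1 - xpow i)\<^sup>2 - xpow i * v)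
     = (\<Prod>i<Suc k. (1 - xpow i)\<^sup>2) * ((1 - v * Z + v\<^sup>2 * r) * (1 - v * F (2 * k + 2)))"
    unfolding prod.lessThan_Suc r Z_def by (simp only: mult_ac)
  also have "(1 - v * Z + v\<^sup>2 * r) * (1 - v * F (2 * k + 2))
    = 1 - v * (\<Sum>j<Suc k. F (2 * j + 2)) + v\<^sup>2 * (r + Z * F (2 * k + 2) - v * r * F (2 * k + 2))"
    unfolding sum.lessThan_Suc Z_def[symmetric] by (simp add: algebra_simps power2_eq_square)
  moreover have "r + Z * F (2 * k + 2) - v * r * F (2 * k + 2) \<in> R"
    unfolding Z_def by (intro R_diff R_add R_mult r v_R FR R_sum) auto
  ultimately show ?case by auto
qed (auto intro!: bexI[of _ 0])

definition Z :: 'a where "Z = (\<Sum>j<N. F (2 * j + 2))"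

lemma Z_R: "Z \<in> R"
  unfolding Z_def using F_R not_dvd_x by auto

text \<open>The difference comes from \<open>v\<close> alone, through \<open>prod_expand\<close>;
  the second form isolates its leading term \<open>- v * Z / (D0 * D0)\<close>.\<close>

lemma invD: "1 / (D0 * D0) - 1 / (D1 * D2) \<in> J 2" "1 / (D0 * D0) - 1 / (D1 * D2) + v * Z / (D0 * D0) \<in> J 3"
proof -
  have d0: "D0 = (\<Prod>i<N. 1 - xpow i)" using qfact_q2[of 1 N] by (simp add: D0_def)
  have p0: "(\<Prod>i<N. (1 - xpow i)\<^sup>2) = D0 * D0"
    unfolding d0 power2_eq_square by (rule prod.distrib)
  obtain r where r: "r \<in> R" "D1 * D2 = D0 * D0 * (1 - v * Z + v\<^sup>2 * r)"
    using prod_expand[OF order_refl] unfolding D12 p0 Z_def by auto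
  define w' where "w' = 1 - v * Z + v\<^sup>2 * r"
  have v1: "v \<in> J 1" using J_mono[OF v_J] by simp
  have w'U: "w' \<in> U"
  proof -
    have "w' = 1 + (v * (v * r - Z))" by (simp add: w'_def algebra_simps power2_eq_square)
    moreover have "v * (v * r - Z) \<in> J 1" using v1 r Z_R by auto
    ultimately show ?thesis using U_add_J[OF U1] by simp
  qed
  have nz: "D0 \<noteq> 0" "w' \<noteq> 0" using U_nz D_U w'U by auto
  have dU: "D0 * D0 * w' \<in> U" using D_U w'U by auto
  have "1 / (D0 * D0) - 1 / (D1 * D2) = (w' - 1) / (D0 * D0 * w')"
    unfolding r w'_def[symmetric] using nz by (simp add: field_simps)
  also have "w' - 1 = v * (v * r - Z)" by (simp add: w'_def algebra_simps power2_eq_square)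
  finally have e: "1 / (D0 * D0) - 1 / (D1 * D2) = v * (v * r - Z) / (D0 * D0 * w')" .
  show "1 / (D0 * D0) - 1 / (D1 * D2) \<in> J 2"
    unfolding e using v_J r Z_R dU by (intro J_divide J_multR) auto
  have "1 / (D0 * D0) - 1 / (D1 * D2) + v * Z / (D0 * D0) = (v * (v * r - Z) + v * Z * w') / (D0 * D0 * w')"
    unfolding e using nz by (simp add: field_simps)
  also have "v * (v * r - Z) + v * Z * w' = v * (v * (r - Z * Z + v * Z * r))"
    by (simp add: w'_def algebra_simps power2_eq_square)
  finally have e2: "1 / (D0 * D0) - 1 / (D1 * D2) + v * Z / (D0 * D0)
    = v * (v * (r - Z * Z + v * Z * r)) / (D0 * D0 * w')" .
  have "v * (v * (r - Z * Z + v * Z * r)) \<in> J (2 + 1)"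
    using v_J v1 r Z_R by (intro J_mult J_multR) auto
  thus "1 / (D0 * D0) - 1 / (D1 * D2) + v * Z / (D0 * D0) \<in> J 3"
    unfolding e2 using dU by (intro J_divide) (auto simp: eval_nat_numeral)
qed

text \<open>The coefficients of \<open>T\<close> at the corners \<open>(Q, 1)\<close>,
  \<open>(1, 1 / Q)\<close> and \<open>(Q, 1 / Q)\<close>.\<close>

definition P1 :: 'a where "P1 = B * (q^2 * G3') / (D1 * D0)"
definition P2 :: 'a where "P2 = B * (q^2 * Q\<^sup>2 * G3) / (D0 * D0)"
definition P3 :: 'a where "P3 = B * (q^2 * Q\<^sup>2 * G3) / (D1 * D2)"

lemma q3Q_R: "q ^ 3 / Q \<in> R" using Q_U by auto

lemma G3_R: "G3 \<in> R" "G3' \<in> R"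
  unfolding G3_def G3'_def by (intro qfact_R R_power q_R q3Q_R)+

lemma G3_cong: "G3' \<approx> G3"
  unfolding G3_def G3'_def using cong_divide[OF cong_refl[of "q ^ 3"] Q_cong] by (intro qfact_cong) auto

lemma P13: "P1 - P3 \<in> J 2"
proof -
  have D1: "D1 \<approx> D0" "D2 \<approx> D0"
    unfolding D0_def D1_def D2_def
    using qfact_cong[of "q^2 * (1 / Q)" "q^2 * 1"] qfact_cong[of "q^2 * Q"
    "q^2 * 1"] cong_mult[OF cong_refl invQ_cong, of "q^2"]
      cong_mult[OF cong_refl Q_cong, of "q^2"] by auto
  have "q^2 * G3' / (D1 * D0) \<approx> q^2 * G3 / (D0 * D0)"
    using D1 D_U G3_R G3_cong U_R by (intro cong_divide cong_mult) auto
  moreover have "q^2 * Q\<^sup>2 * G3 / (D1 * D2) \<approx> q^2 * 1\<^sup>2 * G3 / (D0 * D0)"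
    using D1 D_U G3_R U_R Q_cong by (intro cong_divide cong_mult cong_power) auto
  ultimately have "q^2 * G3' / (D1 * D0) - q^2 * Q\<^sup>2 * G3 / (D1 * D2) \<approx> q^2 * G3 / (D0 * D0) - q^2 * 1\<^sup>2 * G3
    / (D0 * D0)"
    by (rule cong_diff)
  hence "q^2 * G3' / (D1 * D0) - q^2 * Q\<^sup>2 * G3 / (D1 * D2) \<in> J 1" by (simp add: cong_0_iff)
  from J_mult[OF B_J this] show ?thesis
    by (simp add: P1_def P3_def right_diff_distrib eval_nat_numeral)
qed

lemma P23_eq: "P2 - P3 = B * (q^2 * Q\<^sup>2 * G3) * (1 / (D0 * D0) - 1 / (D1 * D2))"
  by (simp add: P2_def P3_def right_diff_distrib)

lemma P23: "P2 - P3 \<in> J 3"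
proof -
  have "B * (q^2 * Q\<^sup>2 * G3) \<in> J 1"
    by (intro J_multR B_J R_mult R_power q_R Q_R G3_R)
  from J_mult[OF this invD(1)] show ?thesis unfolding P23_eq by (simp add: eval_nat_numeral)
qed

lemma P3_J: "P3 \<in> J 1"
  unfolding P3_def using B_J G3_R D_U by (intro J_divide J_multR) auto

text \<open>Replacing the three values of \<open>T\<close> by \<open>T N 1 1\<close> costs multiples
  of \<open>(P1 - P3) * v\<close>, \<open>(P2 - P3) * w\<close> and \<open>P3 * v * w\<close>, of
  orders 2+2, 3+1 and 1+2+1 in \<open>f\<close>.\<close>

lemma S_reduced: "S 1 1 1 N - (P1 + P2 - P3) * T N 1 1 \<in> J 4"
proof -
  obtain r0 r1 r2 r3 where *: "r0 \<in> J 0" "r1 \<in> J 0" "r2 \<in> J 0" "r3 \<in> J 0" "T N 1 1 = r0"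
    "T N Q 1 = r0 + r1 * v"
    "T N 1 (1 / Q) = r0 + r2 * w" "T N Q (1 / Q) = r0 + r1 * v + r2 * w + r3 * v * w"
    using nice_T by (rule niceE)
  define I where "I = 1 / (D0 * D0) - 1 / (D1 * D2)"
  define XN where "XN = qf (q ^ 3) N"
  define XN' where "XN' = qf (q ^ 3) (N - 1) * q ^ 3"
  have X: "XN \<in> J 1" "XN' \<in> J 1"
    unfolding XN_def XN'_def using N_ge by (intro qfact_J[OF _ _ q3_top] J_multR R_power q_R; simp)+
  have pr: "(1 - Q / q) * (1 - 1 / Q / q) = (1 - 1 / q)\<^sup>2 - v / q"
    using v_pair[of "1 / q"] by (simp add: mult.commute)
  have s1: "S Q (1 / Q) 1 N = P1 * (r0 + r1 * v)"
    unfolding S_Q_1 *(6) P1_def by simp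
  have s2: "S 1 1 (1 / Q) N = B / (D0 * D0) * (XN + E1 N * (1 - 1 / q)\<^sup>2 * XN') + P2 * (r0 + r2 * w)"
    unfolding S_1_invQ XN_def[symmetric] XN'_def[symmetric] *(7) P2_def
    by (simp add: power2_eq_square algebra_simps add_divide_distrib)
  have s3: "S Q (1 / Q) (1 / Q) N = B / (D1 * D2) * (XN + E1 N * ((1 - 1 / q)\<^sup>2 - v / q) * XN') + P3
    * (r0 + r1 * v + r2 * w + r3 * v * w)"
    unfolding S_Q_invQ XN_def[symmetric] XN'_def[symmetric] *(8) P3_def pr
    by (simp add: algebra_simps add_divide_distrib)
  \<comment> \<open>What the terms 0 and 1 leave: \<open>B\<close>, their own factor
    \<open>1 - Q\<close>, and a difference of order 2 between the two corners.\<close>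
  define \<epsilon> where "\<epsilon> = B * (I * (XN + E1 N * (1 - 1 / q)\<^sup>2 * XN')) + B * (E1 N * XN' * (v / (q * (D1 * D2))))"
  have "S Q (1 / Q) 1 N + S 1 1 (1 / Q) N - S Q (1 / Q) (1 / Q) N
      = (P1 + P2 - P3) * r0 + (P1 - P3) * (v * r1) + (P2 - P3) * (w * r2) - P3 * (v * w * r3) + \<epsilon>"
  proof -
    define i0 i1 where "i0 = 1 / (D0 * D0)" and "i1 = 1 / (D1 * D2)"
    have a: "B / (D0 * D0) = B * i0" "B / (D1 * D2) = B * i1" "I = i0 - i1" "v / (q * (D1 * D2)) = v / q * i1"
      by (simp_all add: i0_def i1_def I_def)
    define vq where "vq = v / q"
    show ?thesis unfolding s1 s2 s3 \<epsilon>_def a vq_def[symmetric] by (simp add: algebra_simps)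
  qed
  moreover have "S 1 1 1 N - (S Q (1 / Q) 1 N + S 1 1 (1 / Q) N - S Q (1 / Q) (1 / Q) N) \<in> J 4"
    using nice_interpolation[OF nice_S] by simp
  ultimately have main: "S 1 1 1 N - ((P1 + P2 - P3) * r0 + (P1 - P3) * (v * r1) + (P2 - P3) * (w * r2) - P3
    * (v * w * r3) + \<epsilon>) \<in> J 4"
    by simp
  have "(P1 - P3) * (v * r1) \<in> J (2 + 2)" "(P2 - P3) * (w * r2) \<in> J (3 + 1)"
    "P3 * (v * w * r3) \<in> J (1 + (2 + 1))"
    using *(1-4) by (intro J_mult P13 P23 P3_J J_multR v_J w_J; simp)+
  moreover have "\<epsilon> \<in> J (1 + (2 + 1))"
  proof -
    have iq: "1 / q \<in> R" using q_U by auto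
    have "v / (q * (D1 * D2)) \<in> J 2" using v_J q_U D_U by auto
    hence "E1 N * XN' * (v / (q * (D1 * D2))) \<in> J (1 + 2)" using E1_R X by (intro J_mult J_Rmult)
    hence "E1 N * XN' * (v / (q * (D1 * D2))) \<in> J (2 + 1)" by (simp only: add.commute)
    moreover have "I * (XN + E1 N * (1 - 1 / q)\<^sup>2 * XN') \<in> J (2 + 1)"
      unfolding I_def using X E1_R iq by (intro J_mult invD J_add J_Rmult R_mult R_power R_diff R1)
    ultimately show ?thesis unfolding \<epsilon>_def by (intro J_add J_mult[OF B_J])
  qed
  ultimately have "(P1 - P3) * (v * r1) + (P2 - P3) * (w * r2) - P3 * (v * w * r3) + \<epsilon> \<in> J 4"
    by (intro J_add J_diff) (simp_all add: eval_nat_numeral)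
  from J_add[OF main this] show ?thesis unfolding *(5) by (simp add: algebra_simps)
qed

section \<open>Evaluation of the coefficients\<close>

lemma prod_minus_inverse: "(\<And>i. i < k \<Longrightarrow> u i \<noteq> (0::'a)) \<Longrightarrow> (\<Prod>i<k. 1 - 1 / u i)
  = (- 1) ^ k / (\<Prod>i<k. u i) * (\<Prod>i<k. 1 - u i)"
proof (induction k)
  case (Suc k)
  have "1 - 1 / u k = - 1 / u k * (1 - u k)" using Suc.prems[of k] by (simp add: field_simps)
  thus ?case using Suc by (simp add: mult_ac)
qed simp

lemma prod_y: "(\<Prod>j<k. ypow j) * q ^ k = q ^ (k * (k - 1))"
proof (induction k)
  case (Suc k)
  have "(\<Prod>j<Suc k. ypow j) * q ^ Suc k = (\<Prod>j<k. ypow j) * q ^ k * q ^ (2 * k)"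
    using q0 by (simp add: ypow_def)
  also have "\<dots> = q ^ (k * (k - 1) + 2 * k)" by (simp only: Suc power_add)
  also have "k * (k - 1) + 2 * k = Suc k * (Suc k - 1)" by (cases k) auto
  finally show ?case .
qed simp

text \<open>Reversing the product replaces \<open>xpow / Q\<close> by \<open>1 / ypow\<close>, which
  leads to odd powers of \<open>q\<close>: the result cancels against \<open>qf q N\<close> in
  \<open>P1\<close>.\<close>

lemma D1_eq: "D1 = (- 1) ^ N * q ^ N / q ^ (N * (N - 1)) * ((1 - 1 / q) * qf q (N - 1))"
proof -
  have xr: "1 / Q * xpow (N - Suc i) = 1 / ypow i" if "i < N" for i
  proof -
    have "xpow (N - Suc i) * q ^ (2 * i) = q * Q"
      unfolding xpow_def power_add[symmetric] power_Suc[symmetric] using that N2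
      by (intro arg_cong[where f = "power q"]) auto
    thus ?thesis using q0 by (simp add: ypow_def field_simps)
  qed
  have "D1 = (\<Prod>i<N. 1 - 1 / Q * xpow (N - Suc i))"
    unfolding D1_def qfact_q2 by (rule prod.nat_diff_reindex[symmetric])
  also have "\<dots> = (\<Prod>i<N. 1 - 1 / ypow i)" using xr by (intro prod.cong) auto
  also have "\<dots> = (- 1) ^ N / (\<Prod>i<N. ypow i) * (\<Prod>i<N. 1 - ypow i)"
    using U_nz[OF ypow_U] by (intro prod_minus_inverse)
  also have "(\<Prod>i<N. 1 - ypow i) = (1 - 1 / q) * qf q (N - 1)"
  proof -
    have "ypow (Suc i) = q * (q^2) ^ i" for i
      using q0 by (simp add: ypow_def power_mult[symmetric])
    moreover have "(\<Prod>i<Suc (N - 1). 1 - ypow i) = (1 - ypow 0) * (\<Prod>i<N - 1. 1 - ypow (Suc i))"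
      by (rule prod.lessThan_Suc_shift)
    ultimately show ?thesis using N_ge by (simp add: qfact_def ypow_def)
  qed
  also have "(- 1) ^ N / (\<Prod>i<N. ypow i) = (- 1) ^ N * q ^ N / q ^ (N * (N - 1))"
    unfolding prod_y[symmetric] using q0 by simp
  finally show ?thesis .
qed

lemma G3'_eq: "G3' = (- 1) ^ N / q ^ ((N - 2) * (N - 1)) * qf (q^2) (N - 2)"
proof -
  have xr: "q ^ 3 / Q * (q^2) ^ (N - 2 - Suc i) = 1 / xpow i" if "i < N - 2" for i
  proof -
    have "q ^ 3 * (q^2) ^ (N - 2 - Suc i) * xpow i = Q"
      unfolding xpow_def power_mult[symmetric] power_add[symmetric] using that N2
      by (intro arg_cong[where f = "power q"]) auto
    thus ?thesis using q0 U_nz[OF xpow_U] by (simp add: field_simps)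
  qed
  have "G3' = (\<Prod>i<N - 2. 1 - q ^ 3 / Q * (q^2) ^ (N - 2 - Suc i))"
    unfolding G3'_def qfact_def by (rule prod.nat_diff_reindex[symmetric])
  also have "\<dots> = (\<Prod>i<N - 2. 1 - 1 / xpow i)" using xr by (intro prod.cong) auto
  also have "\<dots> = (- 1) ^ (N - 2) / (\<Prod>i<N - 2. xpow i) * (\<Prod>i<N - 2. 1 - xpow i)"
    using U_nz[OF xpow_U] by (intro prod_minus_inverse)
  also have "(\<Prod>i<N - 2. 1 - xpow i) = qf (q^2) (N - 2)" using qfact_q2[of 1 "N - 2"] by simp
  also have "(- 1 :: 'a) ^ (N - 2) = (- 1) ^ N" using N_ge by (simp add: minus_one_power_iff)
  also have "(\<Prod>i<N - 2. xpow i) = q ^ ((N - 2) * (N - 1))" unfolding prod_x using N_ge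
    by (simp add: Suc_diff_Suc numeral_2_eq_2)
  finally show ?thesis .
qed

lemma D0_eq: "D0 = qf (q^2) (N - 2) * ((1 - Q / q) * (1 - q * Q))"
proof -
  have "xpow (N - 2) * q = Q" "xpow (N - 1) = q * Q"
    unfolding xpow_def power_Suc2[symmetric] power_Suc[symmetric] using N2 N_ge
    by (intro arg_cong[where f = "power q"]; simp)+
  hence x: "xpow (N - 2) = Q / q" "xpow (N - 1) = q * Q" using q0 by (auto simp: field_simps)
  have "D0 = (\<Prod>i<Suc (Suc (N - 2)). 1 - xpow i)"
    using qfact_q2[of 1 N] N_ge by (simp add: D0_def numeral_2_eq_2 Suc_diff_Suc)
  also have "\<dots> = (\<Prod>i<N - 2. 1 - xpow i) * ((1 - Q / q) * (1 - q * Q))"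
    unfolding prod.lessThan_Suc using N_ge x by (simp add: numeral_2_eq_2 Suc_diff_Suc)
  finally show ?thesis using qfact_q2[of 1 "N - 2"] by simp
qed

lemma qfact_q_N: "qf q N = qf q (N - 1) * (1 - Q)" "qf q (N - 1) = (1 - q) * G3"
proof -
  have "q * (q^2) ^ (N - 1) = Q"
    using N2 N_ge unfolding power_mult[symmetric] power_Suc[symmetric]
    by (intro arg_cong[where f = "power q"]) auto
  thus "qf q N = qf q (N - 1) * (1 - Q)"
    using qfact_Suc[of q "q^2" "N - 1"] N_ge by simp
  have "qf q (1 + (N - 2)) = qf q 1 * qf (q * (q^2) ^ 1) (N - 2)" by (rule qfact_add)
  moreover have "1 + (N - 2) = N - 1" using N_ge by simp
  moreover have "q * (q^2) ^ 1 = q ^ 3" by (simp add: eval_nat_numeral)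
  moreover have "qf q 1 = 1 - q" by (simp add: qfact_def)
  ultimately show "qf q (N - 1) = (1 - q) * G3" by (simp only: G3_def)
qed

text \<open>An exact identity: after the reversals the products over odd and over even exponents
  cancel separately. Multiplied by suitable powers of \<open>[m]\<close> this is the term
  \<open>1/(q[m]^2[m-1][m+1])\<close> of the constant.\<close>

lemma P1_eq: "P1 = (1 - Q) / (1 - q) * q ^ N / ((1 - Q / q) * (1 - q * Q))"
proof -
  define a where "a = qf q (N - 1)"
  define b where "b = qf (q^2) (N - 2)"
  have nz: "a \<noteq> 0" "b \<noteq> 0" "1 - q \<noteq> 0" using one_minus_q_nz by (auto simp: a_def b_def)
  have pw: "q ^ (N * (N - 1)) = q ^ ((N - 2) * (N - 1)) * (q ^ N * q ^ N / q^2)"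
  proof -
    have "q ^ (N * (N - 1)) * q^2 = q ^ ((N - 2) * (N - 1)) * (q ^ N * q ^ N)"
      unfolding power_add[symmetric] using N_ge
      by (intro arg_cong[where f = "power q"]) (auto simp: le_iff_add algebra_simps)
    thus ?thesis using q0 by (simp add: field_simps)
  qed
  define r where "r = q ^ ((N - 2) * (N - 1))"
  define s where "s = (- 1 :: 'a) ^ N"
  have s: "s * s = 1" by (simp add: s_def power_mult_distrib[symmetric])
  have rs: "r \<noteq> 0" "s \<noteq> 0" using q0 by (auto simp: r_def s_def)
  have e: "1 - 1 / q = - ((1 - q) / q)" using q0 by (simp add: field_simps)
  define z where "z = (1 - Q / q) * (1 - q * Q)"
  have "P1 = - (1 / q) * (a * (1 - Q)) * (q^2 * (s / r * b))
    / (s * q ^ N / (r * (q ^ N * q ^ N / q^2)) * (- ((1 - q) / q) * a) * (b * z))"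
    unfolding P1_def B_def qfact_q_N(1) D1_eq G3'_eq D0_eq pw e a_def[symmetric] b_def[symmetric]
    r_def[symmetric] s_def[symmetric] z_def[symmetric] ..
  also have "\<dots> = (1 - Q) / (1 - q) * q ^ N / z"
    using nz rs q0 by (simp add: power2_eq_square)
  finally show ?thesis unfolding z_def .
qed

lemma qN_cong: "q ^ (2 * N) \<approx> q"
  using cong_mult[OF cong_refl Q_cong, of q] N2 by simp

text \<open>\<open>G3\<close> is congruent to \<open>G3'\<close>, whose reversed form shares the
  product \<open>qf (q^2) (N - 2)\<close> with \<open>D0\<close>; squaring removes the sign.\<close>

lemma G3_D0_cong: "G3\<^sup>2 / D0\<^sup>2 \<approx> q ^ N / (1 - q) ^ 4"
proof -
  define b where "b = qf (q^2) (N - 2)"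
  have bU: "b \<in> U" using U_qfact_q2[OF cong_refl, of "N - 2"] by (simp add: b_def)
  define e where "e = (N - 2) * (N - 1)"
  have "G3\<^sup>2 / D0\<^sup>2 \<approx> G3'\<^sup>2 / D0\<^sup>2"
    using G3_R D_U cong_sym[OF G3_cong] by (intro cong_divide cong_power) (auto intro: U_R)
  also have "G3'\<^sup>2 / D0\<^sup>2 = 1 / (q ^ e)\<^sup>2 / ((1 - Q * (1 / q)) * (1 - q * Q))\<^sup>2"
  proof -
    have "((- 1 :: 'a) ^ N)\<^sup>2 = 1" by (simp add: power_mult[symmetric])
    thus ?thesis unfolding G3'_eq D0_eq b_def[symmetric] e_def[symmetric] using U_nz[OF bU]
      by (simp add: power_mult_distrib power_divide)
  qed
  also have "\<dots> \<approx> 1 / (q ^ e)\<^sup>2 / ((1 - 1 * (1 / q)) * (1 - q * 1))\<^sup>2"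
  proof -
    have "1 - 1 / q = - ((1 - q) / q)" using q0 by (simp add: field_simps)
    hence "1 - 1 / q \<in> U" using one_minus_q_U q_U by auto
    thus ?thesis using one_minus_q_U q_U
      by (intro cong_divide[OF cong_refl] cong_power cong_mult cong_diff cong_refl Q_cong) (auto intro: U_R)
  qed
  also have "\<dots> = q^2 / (q ^ e)\<^sup>2 / (1 - q) ^ 4"
  proof -
    have "1 - 1 / q = - ((1 - q) / q)" using q0 by (simp add: field_simps)
    hence "((1 - 1 * (1 / q)) * (1 - q * 1))\<^sup>2 = (1 - q) ^ 4 / q^2"
      by (simp add: power_divide eval_nat_numeral)
    thus ?thesis by simp
  qed
  also have "q^2 / (q ^ e)\<^sup>2 / (1 - q) ^ 4 \<approx> q ^ N / (1 - q) ^ 4"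
  proof -
    \<comment> \<open>The factor \<open>q ^ (5 * N)\<close> makes the exponent
      \<open>4 + 2 * N * N\<close>, so that \<open>q ^ (2 * N) \<approx> q\<close> applies on both
      sides without negative powers.\<close>
    have "(q ^ e)\<^sup>2 * q ^ N * q ^ (5 * N) = q ^ 4 * (q ^ (2 * N)) ^ N"
    proof -
      have "(q ^ e)\<^sup>2 * q ^ N * q ^ (5 * N) = q ^ (e * 2 + N + 5 * N)" by (simp only: power_add power_mult)
      also have "e * 2 + N + 5 * N = 4 + 2 * N * N"
        using N_ge unfolding e_def by (auto simp: le_iff_add algebra_simps)
      finally show ?thesis by (simp only: power_add power_mult)
    qed
    also have "\<dots> \<approx> q ^ 4 * q ^ N" by (intro cong_mult cong_refl cong_power qN_cong) auto
    also have "q ^ 4 * q ^ N = q^2 * (q^2 * q ^ N)" by (simp add: eval_nat_numeral)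
    also have "q^2 * (q^2 * q ^ N) \<approx> q^2 * ((q ^ (2 * N))\<^sup>2 * q ^ N)"
      by (intro cong_sym[OF cong_mult[OF cong_refl cong_mult[OF cong_power[OF qN_cong] cong_refl]]]) auto
    also have "q^2 * ((q ^ (2 * N))\<^sup>2 * q ^ N) = q^2 * q ^ (5 * N)"
      by (simp add: power_mult[symmetric] power_add[symmetric])
    finally have "(q ^ e)\<^sup>2 * q ^ N * q ^ (5 * N) / ((q ^ e)\<^sup>2 * q ^ (5 * N)) / (1 - q) ^ 4 \<approx> q^2
      * q ^ (5 * N) / ((q ^ e)\<^sup>2 * q ^ (5 * N)) / (1 - q) ^ 4"
      using q_U one_minus_q_U by (intro cong_divide cong_refl) auto
    hence "q ^ N / (1 - q) ^ 4 \<approx> q^2 / (q ^ e)\<^sup>2 / (1 - q) ^ 4" using q0 by simp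
    thus ?thesis by (rule cong_sym)
  qed
  finally show ?thesis .
qed

text \<open>In the leading term of \<open>P2 - P3\<close>, \<open>B\<close> contributes one factor
  \<open>1 - Q\<close> and \<open>v\<close> two. The cofactor is therefore needed only modulo
  \<open>f\<close>, where \<open>G3_D0_cong\<close> and \<open>sum_x\<close> determine it.\<close>

lemma P23_cong: "P2 - P3 + ((1 - Q) / (1 - q)) ^ 3 * K * q ^ (N + 1) / (24 * (1 - q)\<^sup>2) \<in> J 4"
proof -
  define I where "I = 1 / (D0 * D0) - 1 / (D1 * D2)"
  define W where "W = q * (1 - q) * Q * (G3\<^sup>2 / D0\<^sup>2) * Z + K * q ^ (N + 1) / (24 * (1 - q) ^ 5)"
  have gd: "q ^ N / (1 - q) ^ 4 \<in> R" using one_minus_q_U by auto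
  have u24: "24 * (1 - q)\<^sup>2 \<in> U" using one_minus_q_U by auto
  have Zc: "Z \<approx> - K / (24 * (1 - q)\<^sup>2)"
  proof -
    have "24 * (1 - q)\<^sup>2 * Z / (24 * (1 - q)\<^sup>2) \<approx> - K / (24 * (1 - q)\<^sup>2)"
      using sum_x[folded Z_def] u24 K_R by (intro cong_divide cong_refl) auto
    thus ?thesis using U_nz[OF u24] by simp
  qed
  have "q * (1 - q) * Q * (G3\<^sup>2 / D0\<^sup>2) * Z \<approx> q * (1 - q) * 1 * (q ^ N / (1 - q) ^ 4)
    * (- K / (24 * (1 - q)\<^sup>2))"
    by (intro cong_mult cong_refl Q_cong G3_D0_cong Zc R_mult gd R_divide u24 R_uminus K_R R_diff) auto
  also have "\<dots> = - (K * q ^ (N + 1) / (24 * (1 - q) ^ 5))"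
    using U_nz[OF one_minus_q_U] by (simp add: eval_nat_numeral mult_ac)
  finally have WJ: "W \<in> J 1" unfolding W_def cong_def by simp
  have Q3: "(1 - Q) ^ 3 \<in> J 3" using J_power[OF q_m, of 3] by simp
  have "(1 - Q) ^ 3 * W \<in> J (3 + 1)" by (rule J_mult[OF Q3 WJ])
  moreover have "B * (q^2 * Q\<^sup>2 * G3) * (I + v * Z / (D0 * D0)) \<in> J (1 + 3)"
    unfolding I_def by (intro J_mult J_multR B_J invD R_mult R_power q_R Q_R G3_R)
  ultimately have "B * (q^2 * Q\<^sup>2 * G3) * (I + v * Z / (D0 * D0)) + (1 - Q) ^ 3 * W \<in> J 4"
    by (intro J_add) simp_all
  moreover have "B * (q^2 * Q\<^sup>2 * G3) * (v * Z / (D0 * D0))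
    = - ((1 - Q) ^ 3 * (q * (1 - q) * Q * (G3\<^sup>2 / D0\<^sup>2) * Z))"
    unfolding B_def qfact_q_N v_def using q0 by (simp add: eval_nat_numeral mult_ac)
  moreover have "(1 - Q) ^ 3 * (K * q ^ (N + 1) / (24 * (1 - q) ^ 5))
    = ((1 - Q) / (1 - q)) ^ 3 * K * q ^ (N + 1) / (24 * (1 - q)\<^sup>2)"
    by (simp add: power_divide eval_nat_numeral mult_ac)
  ultimately show ?thesis
    unfolding P23_eq I_def[symmetric] W_def by (simp add: distrib_left)
qed

text \<open>Both sides are multiples of \<open>T N 1 1\<close>. Up to normalization
  \<open>omega\<close> splits into the exact \<open>P1\<close> and the value of
  \<open>P2 - P3\<close> modulo \<open>f^4\<close>.\<close>

theorem S_congruence: "S 1 1 1 N - rhs m \<in> J 4"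
proof -
  define L where "L = (1 - Q) / (1 - q)"
  have L0: "L \<noteq> 0" using q_pow[of m] m1 one_minus_q_nz by (simp add: L_def)
  have e: "(m + 5) div 2 = N + 2" "(m - 3) div 2 = N - 2" using N2 by auto
  have Qq: "q ^ (m - 1) = Q / q" "q ^ (m + 1) = q * Q"
    using m1 q0 by (cases m; simp)+
  have "(1 + q^2) / (q * (1 - q)\<^sup>2) * omega m
    = L ^ 3 * (K / 24 - 1 / (q * L\<^sup>2 * ((1 - Q / q) / (1 - q)) * ((1 - q * Q) / (1 - q)))) * q ^ (N + 1) /
    (1 - q)\<^sup>2"
    unfolding omega_def e Qq L_def[symmetric] K_def[symmetric] using one_plus_q_nz q0 by simp
  also have "\<dots> = L ^ 3 * K * q ^ (N + 1) / (24 * (1 - q)\<^sup>2) - P1"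
  proof -
    define z where "z = (1 - Q / q) * (1 - q * Q)"
    have "1 / (q * L\<^sup>2 * ((1 - Q / q) / (1 - q)) * ((1 - q * Q) / (1 - q))) = (1 - q)\<^sup>2 / (q * L\<^sup>2 * z)"
      by (simp add: z_def power2_eq_square mult_ac)
    moreover have "L ^ 3 * ((1 - q)\<^sup>2 / (q * L\<^sup>2 * z)) * q ^ (N + 1) / (1 - q)\<^sup>2 = P1"
      unfolding P1_eq L_def[symmetric] z_def[symmetric] using L0 one_minus_q_nz q0
      by (simp add: eval_nat_numeral)
    ultimately show ?thesis by (simp add: right_diff_distrib left_diff_distrib diff_divide_distrib mult_ac)
  qed
  finally have om: "(1 + q^2) / (q * (1 - q)\<^sup>2) * omega m = L ^ 3 * K * q ^ (N + 1) / (24 * (1 - q)\<^sup>2) - P1" .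
  have "rhs m = omega m * ((1 - q)\<^sup>2 * qf (q ^ 3 / (c * d)) 2
     / ((1 + q)\<^sup>2 * qf (q^2 / c) 2 * qf (q^2 / d) 2) * (\<Sum>k\<le>N - 2. tail k))"
    unfolding rhs_def e by (simp add: mult_ac)
  also have "\<dots> = - ((1 + q^2) / (q * (1 - q)\<^sup>2) * omega m) * T N 1 1" unfolding T_1_1 by simp
  also have "\<dots> = (P1 - L ^ 3 * K * q ^ (N + 1) / (24 * (1 - q)\<^sup>2)) * T N 1 1" unfolding om by simp
  finally have eq: "S 1 1 1 N - rhs m = (S 1 1 1 N - (P1 + P2 - P3) * T N 1 1)
    + (P2 - P3 + L ^ 3 * K * q ^ (N + 1) / (24 * (1 - q)\<^sup>2)) * T N 1 1"
    by (simp add: algebra_simps)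
  have "T N 1 1 \<in> R" using nice_T by (auto simp: nice_def)
  thus ?thesis
    unfolding eq by (intro J_add J_multR S_reduced P23_cong[folded L_def])
qed

section \<open>Terms beyond N, and blocks of length m\<close>

lemma ratio_1: "ratio 1 1 1 i = q ^ 7 / (c * d)
  * ((1 - ypow i) ^ 4 * ((1 - c * ypow i) * (1 - d * ypow i)) / h i 1 1)"
  using ratio_eq[of 1 1 i] by (simp add: g_def eval_nat_numeral mult_ac)

lemma h_U: "\<not> m dvd 2 * i + 2 \<Longrightarrow> h i 1 1 \<in> U"
  using niceU_values(1)[OF niceU_h] .

lemma z_U: "q ^ 7 / (c * d) \<in> U" using q_U c_U d_U by auto

lemma cd_ypow_R: "(1 - c * ypow i) * (1 - d * ypow i) \<in> R"
  using c_U d_U ypow_R U_R by (intro R_mult R_diff) auto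

lemma ratio_R: "\<not> m dvd 2 * i + 2 \<Longrightarrow> ratio 1 1 1 i \<in> R"
  unfolding ratio_1
  by (intro R_mult[OF U_R[OF z_U]] R_divide R_mult[OF _ cd_ypow_R] R_power R_diff R1 ypow_R h_U)

lemma ratio_J:
  assumes "\<not> m dvd 2 * i + 2" "1 - ypow i \<in> J 1"
  shows "ratio 1 1 1 i \<in> J 4"
proof -
  have "(1 - ypow i) ^ 4 \<in> J 4" using J_power[OF assms(2), of 4] by simp
  hence "(1 - ypow i) ^ 4 * ((1 - c * ypow i) * (1 - d * ypow i)) / h i 1 1 \<in> J 4"
    using h_U[OF assms(1)] cd_ypow_R by (intro J_divide J_multR)
  thus ?thesis unfolding ratio_1 using U_R[OF z_U] by (intro J_Rmult)
qed

lemma ypow_block: "ypow (j * m + i) = Q ^ (2 * j) * ypow i"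
  by (simp add: ypow_def power_add power_mult[symmetric] algebra_simps)

lemma xpow_block: "xpow (j * m + i) = Q ^ (2 * j) * xpow i"
  by (simp add: xpow_def power_add power_mult[symmetric] algebra_simps)

lemma Q_pow_cong: "Q ^ j \<approx> 1"
  using cong_power[OF Q_cong R1, of j] by simp

lemma ypow_N: "ypow N = Q"
  using q0 N2 by (simp add: ypow_def)

lemma not_dvd_block: "i < m - 1 \<Longrightarrow> \<not> m dvd 2 * (j * m + i) + 2"
proof
  assume i: "i < m - 1" and "m dvd 2 * (j * m + i) + 2"
  hence "m dvd 2 * (i + 1 + j * m)" by (simp add: algebra_simps)
  hence "m dvd i + 1 + j * m" unfolding m_dvd_even .
  hence "m dvd i + 1" using dvd_add_left_iff[of m "j * m" "i + 1"] by simp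
  with i show False by (auto dest: dvd_imp_le)
qed

lemma ratio_block_cong:
  assumes "i < N"
  shows "ratio 1 1 1 (j * m + i) \<approx> ratio 1 1 1 i"
proof -
  have y: "ypow (j * m + i) \<approx> ypow i"
    unfolding ypow_block using cong_mult[OF Q_pow_cong cong_refl R1 ypow_R] by simp
  have x: "xpow (j * m + i) \<approx> xpow i"
    unfolding xpow_block using cong_mult[OF Q_pow_cong cong_refl R1 xpow_R] by simp
  have cd: "c \<in> R" "d \<in> R" using c_U d_U U_R by auto
  have h: "h (j * m + i) 1 1 \<approx> h i 1 1"
    unfolding h_def using x c_U d_U xpow_R
    by (intro cong_mult cong_diff cong_refl cong_divide R_mult R_diff R_divide R1 U1) auto
  show ?thesis
    unfolding ratio_1
    by (intro cong_mult[OF cong_refl] cong_divide[OF _ h] cong_mult cong_power cong_diff cong_refl y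
        R_mult R_diff R_power R1 cd ypow_R U_R[OF z_U] R_divide[of _ "h i 1 1"] h_U not_dvd_x assms)
qed

lemma ratio_block_top: "N < m - 1 \<Longrightarrow> ratio 1 1 1 (j * m + N) \<in> J 4"
proof (intro ratio_J not_dvd_block)
  have "ypow (j * m + N) \<approx> 1"
    unfolding ypow_block ypow_N using Q_pow_cong[of "2 * j + 1"] by (simp add: mult.commute)
  thus "1 - ypow (j * m + N) \<in> J 1" using J_uminus[of "ypow (j * m + N) - 1" 1] by (simp add: cong_def)
qed

lemma prod_ratio_J:
  assumes "N < r" "r < m"
  shows "(\<Prod>i<r. ratio 1 1 1 (j * m + i)) \<in> J 4"
proof -
  have "(\<Prod>i<r. ratio 1 1 1 (j * m + i)) = ratio 1 1 1 (j * m + N)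
    * (\<Prod>i\<in>{..<r} - {N}. ratio 1 1 1 (j * m + i))"
    using assms by (intro prod.remove) auto
  moreover have "(\<Prod>i\<in>{..<r} - {N}. ratio 1 1 1 (j * m + i)) \<in> R"
    using assms by (intro R_prod ratio_R not_dvd_block) auto
  moreover have "ratio 1 1 1 (j * m + N) \<in> J 4" using assms by (intro ratio_block_top) simp
  ultimately show ?thesis by auto
qed

text \<open>Every term beyond \<open>N\<close> contains quotient number \<open>N\<close>, whose
  numerator has the factor \<open>(1 - Q) ^ 4\<close>; so both choices of the upper limit give the
  same residue.\<close>

lemma S_extend:
  assumes "N \<le> M" "M < m"
  shows "S 1 1 1 M - S 1 1 1 N \<in> J 4"
proof -
  have "S 1 1 1 M = S 1 1 1 N + (\<Sum>k\<in>{N<..M}. qnum k * (\<Prod>i<k. ratio 1 1 1 i))"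
    unfolding S_def using assms by (subst sum.union_disjoint[symmetric]) (auto intro!: sum.cong)
  moreover have "(\<Sum>k\<in>{N<..M}. qnum k * (\<Prod>i<k. ratio 1 1 1 i)) \<in> J 4"
    using prod_ratio_J[of _ 0] assms by (intro J_sum J_Rmult qnum_R) auto
  ultimately show ?thesis by simp
qed

lemma S_N_J: "S 1 1 1 N \<in> J 1"
  using nice_S by (auto simp: nice_def)

lemma qnum_block: "qnum (j * m + r) \<approx> qnum r"
proof -
  have "q ^ (4 * (j * m + r)) / q = Q ^ (4 * j) * (q ^ (4 * r) / q)"
    by (simp add: power_add power_mult[symmetric] algebra_simps)
  also have "\<dots> \<approx> 1 * (q ^ (4 * r) / q)" using q_U by (intro cong_mult Q_pow_cong cong_refl) (auto intro: U_R)
  finally show ?thesis unfolding qnum_def using q_U one_minus_q_U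
    by (intro cong_divide[OF cong_diff[OF cong_refl]] cong_refl) (auto intro: U_R)
qed

text \<open>A quotient of products is regular if every factor of the denominator is compensated by the
  factor of the numerator \<open>s\<close> places earlier.\<close>

lemma prod_quotient_R:
  fixes k s :: nat
  assumes "\<And>i. A i \<in> R" "\<And>i. i < s \<Longrightarrow> 1 / D i \<in> R" "\<And>i. s \<le> i \<Longrightarrow> A (i - s) / D i \<in> R"
  shows "(\<Prod>i<k. A i) / (\<Prod>i<k. D i) \<in> R"
proof -
  have "(\<Prod>i<k - s. A i) / (\<Prod>i<k. D i) \<in> R"
  proof (induction k)
    case (Suc k)
    show ?case
    proof (cases "k < s")
      case True
      hence eq: "(\<Prod>i<Suc k - s. A i) / (\<Prod>i<Suc k. D i) = (\<Prod>i<k - s. A i) / (\<Prod>i<k. D i) * (1 / D k)" by simp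
      show ?thesis unfolding eq by (intro R_mult Suc assms(2)[OF True])
    next
      case False
      hence "Suc k - s = Suc (k - s)" by simp
      hence eq: "(\<Prod>i<Suc k - s. A i) / (\<Prod>i<Suc k. D i) = (\<Prod>i<k - s. A i) / (\<Prod>i<k. D i) * (A (k - s) / D k)"
        by simp
      show ?thesis unfolding eq using False by (intro R_mult Suc assms(3)) simp
    qed
  qed simp
  moreover have "(\<Prod>i<k. A i) = (\<Prod>i<k - s. A i) * (\<Prod>i\<in>{k - s..<k}. A i)"
    by (subst prod.union_disjoint[symmetric]) (auto intro!: prod.cong)
  ultimately show ?thesis using R_prod[of "{k - s..<k}" A, OF assms(1)]
    by (metis R_mult times_divide_eq_left)
qed

text \<open>After \<open>1 - Q\<close> is cancelled the denominator is a geometric sum congruent to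
  \<open>l\<close>, hence a unit.\<close>

lemma Q_quotient_R:
  assumes "0 < l"
  shows "(1 - Q ^ k) / (1 - Q ^ l) \<in> R"
proof -
  have nz: "1 - Q \<noteq> 0" using q_pow[of m] m1 by simp
  have "(\<Sum>i<l. Q ^ i) \<approx> (\<Sum>i<l. 1)" by (intro cong_sum Q_pow_cong)
  hence "(\<Sum>i<l. Q ^ i) \<in> U" using U_of_nat[OF assms] by (auto intro: cong_U)
  hence "(\<Sum>i<k. Q ^ i) / (\<Sum>i<l. Q ^ i) \<in> R" by auto
  thus ?thesis unfolding one_diff_power_eq using nz by simp
qed

lemma q_quotient_R:
  assumes "m dvd i \<Longrightarrow> 0 < i \<and> m dvd k"
  shows "(1 - q ^ k) / (1 - q ^ i) \<in> R"
proof (cases "m dvd i")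
  case True
  then obtain l l' where "i = m * l" "k = m * l'" using assms by (auto elim!: dvdE)
  thus ?thesis using Q_quotient_R[of l l'] assms True m1 by (auto simp: power_mult)
next
  case False
  thus ?thesis using U_q[OF False] by auto
qed

text \<open>The shift \<open>N - 2\<close> lowers the exponent of \<open>q\<close> by exactly
  \<open>m\<close>: \<open>2 * (i - (N - 2)) - 1 = 2 * i + 2 - m\<close>. A denominator divisible by
  \<open>f\<close> thus meets a numerator divisible by \<open>f\<close>.\<close>

lemma prod_ypow_xpow_R: "(\<Prod>i<k. 1 - ypow i) / (\<Prod>i<k. 1 - xpow i) \<in> R"
proof (rule prod_quotient_R[where s = "N - 2"])
  show "1 - ypow i \<in> R" for i using ypow_R by auto
  show "1 / (1 - xpow i) \<in> R" if "i < N - 2" for i using U_one_minus_xpow[of i] that by auto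
  show "(1 - ypow (i - (N - 2))) / (1 - xpow i) \<in> R" if i: "N - 2 \<le> i" for i
  proof (cases "m dvd 2 * i + 2")
    case True
    hence "m \<le> i + 1" using m_dvd_even[of "i + 1"] by (auto dest: dvd_imp_le)
    hence e: "2 * (i - (N - 2)) = Suc (2 * i + 2 - m)" using N2 N_ge i by auto
    have "ypow (i - (N - 2)) = q ^ (2 * i + 2 - m)" unfolding ypow_def e using q0 by simp
    thus ?thesis unfolding xpow_def using True by (simp only:) (intro q_quotient_R, auto intro: dvd_diff_nat)
  next
    case False
    thus ?thesis unfolding xpow_def using U_q[OF False] ypow_R by (intro R_divide R_diff) auto
  qed
qed

text \<open>A single quotient may have \<open>f\<close> in its denominator when \<open>m\<close>
  divides \<open>2 * i + 2\<close>; only products started at 0 are known to be regular.\<close>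

lemma prod_ratio_R: "(\<Prod>i<k. ratio 1 1 1 i) \<in> R"
proof -
  have h1: "h i 1 1 = (1 - xpow i) ^ 4 * ((1 - xpow i / c) * (1 - xpow i / d))" for i
    by (simp add: h_def eval_nat_numeral mult_ac)
  have cd: "(1 - xpow i / c) * (1 - xpow i / d) \<in> U" for i unfolding xpow_def by (intro U_mult U_c U_d)
  have "(\<Prod>i<k. ratio 1 1 1 i) = ((\<Prod>i<k. 1 - ypow i) / (\<Prod>i<k. 1 - xpow i)) ^ 4 *
      (\<Prod>i<k. q ^ 7 / (c * d) * ((1 - c * ypow i) * (1 - d * ypow i) / ((1 - xpow i / c) * (1 - xpow i / d))))"
    unfolding prod_dividef[symmetric] prod_power_distrib prod.distrib[symmetric] ratio_1 h1
    by (intro prod.cong refl) (simp add: power_divide mult_ac)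
  moreover have "(\<Prod>i<k. q ^ 7 / (c * d) * ((1 - c * ypow i) * (1 - d * ypow i)
    / ((1 - xpow i / c) * (1 - xpow i / d)))) \<in> R"
    using cd cd_ypow_R U_R[OF z_U] by (intro R_prod R_mult[of "q ^ 7 / (c * d)"] R_divide[of
    "(1 - c * _) * _"])
  ultimately show ?thesis using prod_ypow_xpow_R by (simp only:) (intro R_mult R_power)
qed

text \<open>Up to \<open>N\<close> the quotients of a block agree modulo \<open>f\<close> with those
  of block 0, so the block is congruent to the preceding product times \<open>S 1 1 1 N\<close>,
  which vanishes modulo \<open>f\<close>; beyond \<open>N\<close> its terms vanish as well.\<close>

lemma block_sum:
  assumes "r = N \<or> r = m - 1"
  shows "(\<Sum>i\<le>r. qnum (j * m + i) * (\<Prod>l<j * m + i. ratio 1 1 1 l)) \<in> J 1"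
proof -
  define blk where "blk i = (\<Prod>l<i. ratio 1 1 1 (j * m + l))" for i
  have split: "(\<Prod>l<j * m + i. ratio 1 1 1 l) = (\<Prod>l<j * m. ratio 1 1 1 l) * blk i" for i
    unfolding blk_def by (induction i) (auto simp: mult_ac)
  have eq: "(\<Sum>i\<le>r. qnum (j * m + i) * (\<Prod>l<j * m + i. ratio 1 1 1 l)) =
      (\<Prod>l<j * m. ratio 1 1 1 l) * (\<Sum>i\<le>r. qnum (j * m + i) * blk i)"
    unfolding split sum_distrib_left by (intro sum.cong refl) (simp only: mult_ac)
  have "(\<Sum>i\<le>N. qnum (j * m + i) * blk i) \<approx> S 1 1 1 N"
    unfolding S_def blk_def
    by (intro cong_sum cong_mult qnum_block cong_prod conjI ratio_block_cong qnum_R R_prod ratio_R not_dvd_x)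
    auto
  hence N: "(\<Sum>i\<le>N. qnum (j * m + i) * blk i) \<in> J 1"
    using S_N_J unfolding cong_def using J_add by fastforce
  have "(\<Sum>i\<le>r. qnum (j * m + i) * blk i) \<in> J 1"
  proof (cases "r = N")
    case False
    hence r: "r = m - 1" "N \<le> r" using assms N2 m1 N_ge by auto
    have "(\<Sum>i\<le>r. qnum (j * m + i) * blk i) =
      (\<Sum>i\<le>N. qnum (j * m + i) * blk i) + (\<Sum>i\<in>{N<..r}. qnum (j * m + i) * blk i)"
      using r by (subst sum.union_disjoint[symmetric]) (auto intro!: sum.cong)
    moreover have "(\<Sum>i\<in>{N<..r}. qnum (j * m + i) * blk i) \<in> J 1"
      unfolding blk_def using r m1 by (intro J_sum J_Rmult qnum_R J_mono[OF prod_ratio_J]) auto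
    ultimately show ?thesis using N by auto
  qed (use N in simp)
  thus ?thesis unfolding eq using prod_ratio_R by (intro J_Rmult)
qed

lemma S_blocks: "(\<Sum>k<t * m. qnum k * (\<Prod>l<k. ratio 1 1 1 l)) \<in> J 1"
proof (induction t)
  case (Suc t)
  have "(\<Sum>k<Suc t * m. qnum k * (\<Prod>l<k. ratio 1 1 1 l)) = (\<Sum>k<t * m. qnum k * (\<Prod>l<k. ratio 1 1 1 l))
     + (\<Sum>i<m. qnum (t * m + i) * (\<Prod>l<t * m + i. ratio 1 1 1 l))"
    using sum.nat_group[of "\<lambda>k. qnum k * (\<Prod>l<k. ratio 1 1 1 l)" m "Suc t"]
      sum.nat_group[of "\<lambda>k. qnum k * (\<Prod>l<k. ratio 1 1 1 l)" m t]
    by (simp add: sum.atLeastLessThan_shift_0[of _ "t * m"] lessThan_atLeast0 add.commute)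
  moreover have "{..<m} = {..m - 1}" using m1 by auto
  ultimately show ?case using Suc block_sum[of "m - 1" t] by auto
qed simp

text \<open>With \<open>n = t * m\<close> and \<open>t = 2 * s + 1\<close>, the limit
  \<open>n - 1\<close> completes \<open>t\<close> blocks, and
  \<open>(n + 1) div 2 = s * m + N\<close> stops exactly at index \<open>N\<close> of block
  \<open>s\<close>.\<close>

lemma S_dvd_J:
  assumes "m dvd n" "odd n" "M = (n + 1) div 2 \<or> M = n - 1"
  shows "S 1 1 1 M \<in> J 1"
proof -
  obtain t where n: "n = t * m" using assms(1) by (metis dvdE mult.commute)
  have t: "odd t" using assms(2) n by auto
  show ?thesis
  proof (cases "M = n - 1")
    case True
    have "0 < t * m" using t m1 by (simp add: odd_pos)
    hence "Suc M = t * m" using True n by simp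
    hence "{..M} = {..<t * m}" by (metis lessThan_Suc_atMost)
    thus ?thesis unfolding S_def using S_blocks[of t] by simp
  next
    case False
    obtain s where s: "t = 2 * s + 1" using t by (elim oddE)
    have M: "M = s * m + N"
    proof -
      have "2 * M = n + 1" using assms False by auto
      also have "\<dots> = 2 * (s * m + N)" using N2 by (simp add: n s algebra_simps)
      finally show ?thesis by simp
    qed
    have "S 1 1 1 M = (\<Sum>k<s * m. qnum k * (\<Prod>l<k. ratio 1 1 1 l))
      + (\<Sum>i\<le>N. qnum (s * m + i) * (\<Prod>l<s * m + i. ratio 1 1 1 l))"
    proof -
      have "{..s * m + N} = {..<s * m} \<union> (\<lambda>i. s * m + i) ` {..N}"
        by (auto simp: image_iff) (metis atMost_iff le_add_diff_inverse linorder_not_less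
        nat_add_left_cancel_le)
      moreover have "(\<Sum>k\<in>{..<s * m} \<union> (\<lambda>i. s * m + i) ` {..N}. qnum k * (\<Prod>l<k. ratio 1 1 1 l))
          = (\<Sum>k<s * m. qnum k * (\<Prod>l<k. ratio 1 1 1 l)) +
          (\<Sum>k\<in>(\<lambda>i. s * m + i) ` {..N}. qnum k * (\<Prod>l<k. ratio 1 1 1 l))"
        by (intro sum.union_disjoint) auto
      ultimately show ?thesis unfolding S_def M by (simp add: sum.reindex)
    qed
    thus ?thesis using S_blocks[of s] block_sum[of N s] by auto
  qed
qed

text \<open>For proper divisors \<open>m\<close> the sum on the right may run past the first zeros
  of the denominators. The shifts \<open>N\<close> and \<open>N - 2\<close> are those for which the
  exponents of numerator and denominator differ by \<open>m\<close>.\<close>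

lemma qfact_odd_even_R: "qf (q ^ 3) k / qf (q^2) k \<in> R"
  and qfact_odd_six_R: "qf (q ^ 3) k / qf (q ^ 6) k \<in> R"
proof -
  have e: "q ^ a * (q^2) ^ i = q ^ (a + 2 * i)" for a i by (simp only: power_add power_mult)
  have aR: "1 - q ^ a \<in> R" for a by auto
  show "qf (q ^ 3) k / qf (q^2) k \<in> R"
    unfolding qfact_def e
  proof (rule prod_quotient_R[where s = N, OF aR])
    show "1 / (1 - q ^ (2 + 2 * i)) \<in> R" if "i < N" for i
      using U_q[OF not_dvd_x[OF that]] by (intro R_divide) (auto simp: add.commute)
    show "(1 - q ^ (3 + 2 * (i - N))) / (1 - q ^ (2 + 2 * i)) \<in> R" if i: "N \<le> i" for i
    proof (rule q_quotient_R)
      assume dv: "m dvd 2 + 2 * i"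
      have e: "3 + 2 * (i - N) = 2 + 2 * i - m" using N2 i by auto
      show "0 < 2 + 2 * i \<and> m dvd 3 + 2 * (i - N)" unfolding e using dv by (auto intro: dvd_diff_nat)
    qed
  qed
  show "qf (q ^ 3) k / qf (q ^ 6) k \<in> R"
    unfolding qfact_def e
  proof (rule prod_quotient_R[where s = "N - 2", OF aR])
    show "1 / (1 - q ^ (6 + 2 * i)) \<in> R" if "i < N - 2" for i
    proof -
      have e: "6 + 2 * i = 2 * (i + 2) + 2" by simp
      show ?thesis unfolding e using that by (intro R_divide R1 U_q not_dvd_x) simp
    qed
    show "(1 - q ^ (3 + 2 * (i - (N - 2)))) / (1 - q ^ (6 + 2 * i)) \<in> R" if i: "N - 2 \<le> i" for i
    proof (rule q_quotient_R)
      assume dv: "m dvd 6 + 2 * i"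
      have e: "3 + 2 * (i - (N - 2)) = 6 + 2 * i - m" using N2 N_ge i by auto
      show "0 < 6 + 2 * i \<and> m dvd 3 + 2 * (i - (N - 2))" unfolding e using dv by (auto intro: dvd_diff_nat)
    qed
  qed
qed

lemma qfact_cd_U: "qf (q ^ a / c) k \<in> U" "qf (q ^ a / d) k \<in> U"
proof -
  have e: "q ^ a / x * (q^2) ^ i = q ^ (a + 2 * i) / x" for i x
    by (simp only: power_add power_mult times_divide_eq_left)
  show "qf (q ^ a / c) k \<in> U" "qf (q ^ a / d) k \<in> U"
    unfolding qfact_def e by (intro U_prod U_c U_d)+
qed

lemma tail_R: "tail k \<in> R"
proof -
  have "tail k = (qf (q ^ 3) k / qf (q^2) k) * (qf (q ^ 3) k / qf (q ^ 6) k)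
    * (qf (q ^ 3) k * qf (q ^ 7 / (c * d)) k / (qf (q ^ 6 / c) k * qf (q ^ 6 / d) k)) * q ^ (2 * k)"
    unfolding tail_def by (simp add: power3_eq_cube mult_ac)
  moreover have "q ^ 7 / (c * d) \<in> R" using U_R[OF z_U] .
  ultimately show ?thesis using qfact_odd_even_R qfact_odd_six_R qfact_cd_U
    by (simp only:) (intro R_mult R_divide[of "qf (q ^ 3) k * _"] U_mult qfact_R R_power q_R)
qed

lemma rhs_J:
  assumes "m dvd n" "0 < n"
  shows "rhs n \<in> J 1"
proof -
  have nd: "\<not> m dvd n - 1" "\<not> m dvd n + 1"
  proof -
    have "\<not> m dvd 1" using m1 by simp
    thus "\<not> m dvd n + 1" using assms(1) dvd_add_right_iff by blast
    show "\<not> m dvd n - 1" using \<open>\<not> m dvd 1\<close> assms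
      by (metis Suc_diff_1 dvd_add_right_iff plus_1_eq_Suc add.commute)
  qed
  define L where "L = (1 - q ^ n) / (1 - q)"
  have L0: "L \<noteq> 0" using q_pow[of n] assms(2) one_minus_q_nz by (simp add: L_def)
  have "1 - q ^ n \<in> J 1" using J_uminus[OF q_pow_dvd_cong[OF assms(1), unfolded cong_def]] by simp
  hence LJ: "L \<in> J 1" unfolding L_def using one_minus_q_U by (intro J_divide)
  define w1 where "w1 = ((of_nat n)\<^sup>2 * (1 - q)\<^sup>2 - (1 + 22 * q + q^2)) / 24"
  define w2 where "w2 = 1 / (q * ((1 - q ^ (n - 1)) / (1 - q)) * ((1 - q ^ (n + 1)) / (1 - q)))"
  have w1: "w1 \<in> R" unfolding w1_def by (intro R_divide R_diff R_add R_mult R_power R1 q_R R_of_nat R_numeral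
    U_numeral)
  have w2: "w2 \<in> R" unfolding w2_def using U_q[OF nd(1)] U_q[OF nd(2)] one_minus_q_U q_U
    by (intro R_divide[OF R1] U_mult U_divide)
  have m2: "\<not> m dvd 2" "\<not> m dvd 4"
    using m_dvd_even[of 1] m_dvd_even[of 2] m1 by auto
  have "(1 + q) * (1 - q) = 1 - q ^ 2" "(1 + q^2) * (1 - q ^ 2) = 1 - q ^ 4"
    by (simp_all add: algebra_simps eval_nat_numeral)
  hence U2: "1 + q \<in> U" "1 + q^2 \<in> U"
    using U_factor[of "1 + q" "1 - q"] U_factor[of "1 + q^2" "1 - q ^ 2"] U_q[OF m2(1)] U_q[OF m2(2)] by auto
  have "omega n = L * ((L\<^sup>2 * w1 - w2) * q ^ ((n + 5) div 2) / (1 + q^2))"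
  proof -
    have "1 / (q * L\<^sup>2 * ((1 - q ^ (n - 1)) / (1 - q)) * ((1 - q ^ (n + 1)) / (1 - q))) = w2 / L\<^sup>2"
      by (simp add: w2_def mult_ac)
    hence "omega n = L ^ 3 * (w1 - w2 / L\<^sup>2) * q ^ ((n + 5) div 2) / (1 + q^2)"
      unfolding omega_def L_def[symmetric] w1_def[symmetric] by simp
    \<comment> \<open>The pole \<open>L^-2\<close> consumes two of the three factors
      \<open>L\<close>; the one that is left gives divisibility by \<open>f\<close>.\<close>
    moreover have "L ^ 3 * (w1 - w2 / L\<^sup>2) = L * (L\<^sup>2 * w1 - w2)"
      using L0 by (simp add: eval_nat_numeral field_simps)
    ultimately show ?thesis by simp
  qed
  hence "omega n \<in> J 1"
    using LJ J_R[OF LJ] w1 w2 U2 by (simp only:) (intro J_multR R_divide R_mult R_diff R_power q_R)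
  moreover have "q ^ 3 / (c * d) \<in> R" using c_U d_U by auto
  ultimately show ?thesis
    unfolding rhs_def using U2 qfact_cd_U[of 2] tail_R
    by (intro J_multR J_divide U_mult U_power R_power R_diff R1 q_R qfact_R R_sum)
qed

end

section \<open>Cyclotomic polynomials\<close>

abbreviation of_int_poly :: "int poly \<Rightarrow> 'a::comm_ring_1 poly" where
  "of_int_poly \<equiv> map_poly of_int"

lemma of_int_poly_mult: "(of_int_poly (p * q) :: 'a::comm_ring_1 poly) = of_int_poly p * of_int_poly q"
  by (intro poly_eqI) (simp add: coeff_map_poly coeff_mult)

lemma of_int_poly_add: "(of_int_poly (p + q) :: 'a::comm_ring_1 poly) = of_int_poly p + of_int_poly q"
  by (intro poly_eqI) (simp add: coeff_map_poly)

lemma of_int_poly_diff: "(of_int_poly (p - q) :: 'a::comm_ring_1 poly) = of_int_poly p - of_int_poly q"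
  by (intro poly_eqI) (simp add: coeff_map_poly)

lemma of_int_poly_prod: "(of_int_poly (\<Prod>i\<in>A. p i) :: 'a::comm_ring_1 poly) = (\<Prod>i\<in>A. of_int_poly (p i))"
  by (induction A rule: infinite_finite_induct) (simp_all add: of_int_poly_mult)

lemma of_int_poly_complex_inject: "(of_int_poly p :: complex poly) = of_int_poly q \<longleftrightarrow> p = q"
  by (metis coeff_map_poly of_int_0 of_int_eq_iff poly_eqI)

lemma degree_of_int_poly_complex: "degree (of_int_poly p :: complex poly) = degree p"
  by (intro degree_map_poly) auto

definition cyclotomic_complex :: "nat \<Rightarrow> complex poly" where
  "cyclotomic_complex n = (\<Prod>k\<in>{k\<in>{1..n}. coprime k n}. [:- cis (2 * pi * real k / real n), 1:])"

text \<open>Both sides are monic of degree \<open>n\<close>, so their difference has degree less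
  than \<open>n\<close>; it vanishes at \<open>n\<close> distinct points.\<close>

lemma prod_roots_of_unity:
  assumes "n > 0"
  shows "(\<Prod>k\<in>{1..n}. [:- cis (2 * pi * real k / real n), 1:]) = monom 1 n - 1"
proof (rule ccontr)
  define r where "r k = cis (2 * pi * real k / real n)" for k
  define P where "P = (\<Prod>k\<in>{1..n}. [:- r k, 1:])"
  define D where "D = P - (monom 1 n - 1)"
  assume "(\<Prod>k\<in>{1..n}. [:- cis (2 * pi * real k / real n), 1:]) \<noteq> monom 1 n - 1"
  hence D0: "D \<noteq> 0" by (simp add: D_def P_def r_def)
  have r_pow: "r k ^ n = 1" for k
  proof -
    have "r k ^ n = cis (2 * pi * real k)" using assms by (simp add: r_def DeMoivre)
    thus ?thesis by (simp add: cis_multiple_2pi)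
  qed
  have root: "poly D (r k) = 0" if "k \<in> {1..n}" for k
    using that r_pow[of k] by (auto simp: D_def P_def poly_prod poly_monom)
  have inj: "inj_on r {..<n}" using bij_betw_roots_unity[OF assms] by (simp add: bij_betw_def r_def[abs_def])
  have "r ` {..<n} \<subseteq> r ` {1..n}"
  proof safe
    fix k assume "k < n"
    show "r k \<in> r ` {1..n}"
    proof (cases "k = 0")
      case True
      have "r n = r 0" using assms by (simp add: r_def)
      with True show ?thesis using assms by (auto intro!: image_eqI[of _ _ n])
    qed (use \<open>k < n\<close> in auto)
  qed
  hence "r ` {..<n} \<subseteq> {z. poly D z = 0}" using root by auto
  hence "card (r ` {..<n}) \<le> card {z. poly D z = 0}" by (rule card_mono[OF poly_roots_finite[OF D0]])
  hence "n \<le> card {z. poly D z = 0}" by (simp add: card_image[OF inj])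
  also have "\<dots> \<le> degree D" by (rule card_poly_roots_bound[OF D0])
  finally have ge: "n \<le> degree D" .
  have deg: "degree P = n" unfolding P_def by (subst degree_prod_eq_sum_degree) auto
  have "lead_coeff P = 1" unfolding P_def lead_coeff_prod by simp
  hence "coeff D n = 0" using deg assms by (simp add: D_def)
  moreover have "degree D \<le> n" unfolding D_def
    using deg by (intro degree_diff_le) (auto simp: degree_monom_le)
  ultimately have "degree D < n \<or> D = 0" using ge D0 by (metis antisym leading_coeff_0_iff)
  with ge D0 show False by simp
qed

text \<open>The exponents \<open>k\<close> are grouped by \<open>gcd k n = e\<close>; cancelling
  \<open>e\<close> turns the group into the primitive roots of order \<open>n div e\<close>.\<close>

lemma prod_cyclotomic_complex:
  assumes "n > 0"
  shows "(\<Prod>d | d dvd n. cyclotomic_complex d) = monom 1 n - 1"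
proof -
  define f where "f x = [:- cis (2 * pi * x), 1:]" for x
  have fin: "finite {d. d dvd n}" using assms by simp
  have "(\<Prod>k\<in>{1..n}. f (real k / real n)) = (\<Prod>e | e dvd n. \<Prod>k\<in>{k\<in>{1..n}. gcd k n = e}. f (real k / real n))"
    by (rule prod.group[symmetric]) (use fin in auto)
  also have "\<dots> = (\<Prod>e | e dvd n. cyclotomic_complex (n div e))"
  proof (intro prod.cong refl)
    fix e assume "e \<in> {e. e dvd n}"
    hence e: "e dvd n" "e > 0" using assms by (auto intro: dvd_pos_nat)
    have "(\<Prod>k\<in>{k\<in>{1..n}. gcd k n = e}. f (real k / real n))
      = (\<Prod>k\<in>totatives (n div e). f (real (k * e) / real n))"
    proof -
      have "{k\<in>{1..n}. gcd k n = e} = {k\<in>{0<..n}. gcd k n = e}" by auto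
      thus ?thesis
        using prod.reindex_bij_betw[OF bij_betw_totatives_gcd_eq[OF e(1) assms], of "\<lambda>k. f (real k / real n)"]
        by simp
    qed
    also have "\<dots> = cyclotomic_complex (n div e)"
      unfolding cyclotomic_complex_def f_def
    proof (intro prod.cong)
      show "totatives (n div e) = {k \<in> {1..n div e}. coprime k (n div e)}" by (auto simp: totatives_def)
      fix k
      have "real (k * e) / real n = real k / real (n div e)"
        using e assms by (auto elim!: dvdE)
      thus "[:- cis (2 * pi * (real (k * e) / real n)), 1:] = [:- cis (2 * pi * real k / real (n div e)), 1:]"
        by simp
    qed
    finally show "(\<Prod>k\<in>{k\<in>{1..n}. gcd k n = e}. f (real k / real n)) = cyclotomic_complex (n div e)" .
  qed
  also have "\<dots> = (\<Prod>d | d dvd n. cyclotomic_complex d)"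
    using assms by (intro prod.reindex_bij_witness[of _ "\<lambda>d. n div d" "\<lambda>d. n div d"])
    (auto simp: div_div_eq_right)
  finally show ?thesis using prod_roots_of_unity[OF assms] by (simp add: f_def)
qed

text \<open>This provides the polynomial that the definite description in \<open>cyclotomic\<close>
  selects. By induction the product over proper divisors is integral and monic, so pseudo-division
  of \<open>x^n - 1\<close> is honest division; comparison of degrees over the complex numbers kills
  the remainder.\<close>

lemma cyclotomic_complex_integral:
  "n > 0 \<Longrightarrow> \<exists>p. of_int_poly p = cyclotomic_complex n \<and> lead_coeff p = 1"
proof (induction n rule: less_induct)
  case (less n)
  define A where "A = {d. d dvd n \<and> d \<noteq> n}"
  have fin: "finite A" using less.prems by (auto simp: A_def)
  have "\<exists>p. of_int_poly p = cyclotomic_complex d \<and> lead_coeff p = 1" if "d \<in> A" for d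
    using that less by (auto simp: A_def dvd_pos_nat intro!: less.IH dest: dvd_imp_le)
  then obtain P where P: "\<And>d. d \<in> A \<Longrightarrow> of_int_poly (P d) = cyclotomic_complex d \<and> lead_coeff (P d) = 1"
    by metis
  define D where "D = (\<Prod>d\<in>A. P d)"
  have lD: "lead_coeff D = 1" unfolding D_def lead_coeff_prod using P by simp
  hence D0: "D \<noteq> 0" by auto
  obtain u r where ur: "pseudo_divmod (monom 1 n - 1) D = (u, r)" by (metis surj_pair)
  have div: "monom 1 n - 1 = D * u + r" and r: "r = 0 \<or> degree r < degree D"
    using pseudo_divmod[OF D0 ur] lD by simp_all
  have DC: "of_int_poly D = (\<Prod>d\<in>A. cyclotomic_complex d)"
    unfolding D_def of_int_poly_prod using P by (intro prod.cong) auto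
  have "{d. d dvd n} = insert n A" "n \<notin> A" by (auto simp: A_def)
  hence "cyclotomic_complex n * of_int_poly D = monom 1 n - 1"
    using prod_cyclotomic_complex[OF less.prems] fin unfolding DC by simp
  also have "\<dots> = of_int_poly (monom 1 n - 1)"
    by (simp add: of_int_poly_diff map_poly_monom)
  also have "\<dots> = of_int_poly D * of_int_poly u + of_int_poly r"
    unfolding div by (simp add: of_int_poly_add of_int_poly_mult)
  finally have eq: "of_int_poly D * (cyclotomic_complex n - of_int_poly u) = of_int_poly r"
    by (simp add: algebra_simps)
  have "cyclotomic_complex n - of_int_poly u = 0"
  proof (rule ccontr)
    assume nz: "cyclotomic_complex n - of_int_poly u \<noteq> 0"
    have DC0: "(of_int_poly D :: complex poly) \<noteq> 0" using D0 of_int_poly_complex_inject[of D 0] by simp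
    hence "of_int_poly r \<noteq> (0 :: complex poly)" using eq nz by (metis mult_eq_0_iff)
    hence "r \<noteq> 0" by auto
    moreover have "degree (of_int_poly r :: complex poly) \<ge> degree (of_int_poly D :: complex poly)"
      unfolding eq[symmetric] using nz DC0 by (simp add: degree_mult_eq)
    ultimately show False using r unfolding degree_of_int_poly_complex by simp
  qed
  hence u: "of_int_poly u = cyclotomic_complex n" by simp
  moreover have "lead_coeff (cyclotomic_complex n) = 1" unfolding cyclotomic_complex_def lead_coeff_prod
    by simp
  hence "lead_coeff (of_int_poly u :: complex poly) = 1" by (simp add: u)
  hence "of_int (lead_coeff u) = (1 :: complex)"
    by (simp only: coeff_map_poly of_int_0 degree_of_int_poly_complex)
  ultimately show ?case by auto
qed

lemma of_int_poly_cyclotomic: "n > 0 \<Longrightarrow> of_int_poly (cyclotomic n) = cyclotomic_complex n"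
proof -
  assume "n > 0"
  then obtain p where p: "of_int_poly p = cyclotomic_complex n" using cyclotomic_complex_integral by blast
  show ?thesis
    unfolding cyclotomic_def cyclotomic_complex_def[symmetric]
    by (rule theI[of _ p]) (use p in \<open>auto simp: of_int_poly_complex_inject[symmetric]\<close>)
qed

lemma prod_cyclotomic: "n > 0 \<Longrightarrow> (\<Prod>d | d dvd n. cyclotomic d) = monom 1 n - 1"
proof -
  assume n: "n > 0"
  have "of_int_poly (\<Prod>d | d dvd n. cyclotomic d) = (\<Prod>d | d dvd n. cyclotomic_complex d)"
    unfolding of_int_poly_prod using n by (intro prod.cong refl of_int_poly_cyclotomic)
    (auto intro: dvd_pos_nat)
  also have "\<dots> = of_int_poly (monom 1 n - 1)"
    unfolding prod_cyclotomic_complex[OF n] by (simp add: of_int_poly_diff map_poly_monom)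
  finally show ?thesis by (simp only: of_int_poly_complex_inject)
qed

lemma lead_coeff_cyclotomic: "n > 0 \<Longrightarrow> lead_coeff (cyclotomic n) = 1"
proof -
  assume "n > 0"
  then obtain p where "of_int_poly p = cyclotomic_complex n" "lead_coeff p = 1"
    using cyclotomic_complex_integral by blast
  with of_int_poly_cyclotomic[OF \<open>n > 0\<close>] show ?thesis by (metis of_int_poly_complex_inject)
qed

lemma degree_cyclotomic_pos: "n > 0 \<Longrightarrow> degree (cyclotomic n) > 0"
proof -
  assume n: "n > 0"
  have "1 \<in> {k \<in> {1..n}. coprime k n}" using n by auto
  moreover have "finite {k \<in> {1..n}. coprime k n}" by simp
  ultimately have "card {k \<in> {1..n}. coprime k n} > 0" using card_gt_0_iff by blast
  moreover have "degree (cyclotomic_complex n) = card {k \<in> {1..n}. coprime k n}"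
    unfolding cyclotomic_complex_def by (subst degree_prod_eq_sum_degree) auto
  ultimately show ?thesis
    using of_int_poly_cyclotomic[OF n] degree_of_int_poly_complex[of "cyclotomic n"] by simp
qed

section \<open>Rational functions regular at a polynomial\<close>

text \<open>\<open>b\<close> is invertible modulo \<open>p\<close>. In this form products, powers
  and divisors are handled by explicit identities; the passage to \<open>coprime\<close> is made
  only at the end.\<close>

definition bezout :: "'a::comm_ring_1 \<Rightarrow> 'a \<Rightarrow> bool" where
  "bezout b p \<longleftrightarrow> (\<exists>u v. u * b + v * p = 1)"

lemma bezoutI: "u * b + v * p = 1 \<Longrightarrow> bezout b p"
  unfolding bezout_def by blast

lemma bezout_commute: "bezout b p \<Longrightarrow> bezout p b"
  unfolding bezout_def by (metis add.commute)

lemma bezout_mult: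
  assumes "bezout b p" "bezout b' p"
  shows "bezout (b * b') p"
proof -
  from assms obtain u v u' v' where uv: "u * b + v * p = 1" "u' * b' + v' * p = 1" by (auto simp: bezout_def)
  have "(u * u') * (b * b') + (u * b * v' + v * (u' * b' + v' * p)) * p
    = (u * b + v * p) * (u' * b' + v' * p)"
    by (simp add: algebra_simps)
  thus ?thesis using uv by (intro bezoutI[of "u * u'" _ "u * b * v' + v * (u' * b' + v' * p)"]) simp
qed

lemma bezout_1 [simp]: "bezout 1 p"
  by (rule bezoutI[of 1 _ 0]) simp

lemma bezout_power: "bezout b p \<Longrightarrow> bezout (b ^ k) p"
  by (induction k) (auto intro: bezout_mult)

lemma bezout_prod: "(\<And>i. i \<in> A \<Longrightarrow> bezout (b i) p) \<Longrightarrow> bezout (\<Prod>i\<in>A. b i) p"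
  by (induction A rule: infinite_finite_induct) (auto intro: bezout_mult)

lemma bezout_add_mult: "bezout b p \<Longrightarrow> bezout (b + p * a) p"
proof -
  assume "bezout b p"
  then obtain u v where "u * b + v * p = 1" by (auto simp: bezout_def)
  hence "u * (b + p * a) + (v - u * a) * p = 1" by (simp add: algebra_simps)
  thus ?thesis by (rule bezoutI)
qed

lemma bezout_dvd: "bezout b p \<Longrightarrow> a dvd b \<Longrightarrow> bezout a p"
proof -
  assume "bezout b p" "a dvd b"
  then obtain u v k where "u * (a * k) + v * p = 1" by (auto simp: bezout_def elim!: dvdE)
  hence "(u * k) * a + v * p = 1" by (simp add: mult_ac)
  thus ?thesis by (rule bezoutI)
qed

lemma bezout_imp_coprime:
  fixes b p :: "'a::{comm_ring_1,algebraic_semidom}"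
  shows "bezout b p \<Longrightarrow> coprime b p"
proof -
  assume "bezout b p"
  then obtain u v where uv: "u * b + v * p = 1" by (auto simp: bezout_def)
  show ?thesis
  proof (rule coprimeI)
    fix a assume "a dvd b" "a dvd p"
    hence "a dvd u * b + v * p" by (intro dvd_add dvd_mult)
    thus "a dvd 1" unfolding uv .
  qed
qed

section \<open>Polynomials inside the fraction field and localization\<close>

lemma emb_0 [simp]: "emb 0 = 0" and emb_1 [simp]: "emb 1 = 1"
  by (simp_all add: emb_def Zero_fract_def One_fract_def)

lemma emb_add: "emb (a + b) = emb a + emb b" and emb_diff: "emb (a - b) = emb a - emb b"
  and emb_mult: "emb (a * b) = emb a * emb b"
  by (simp_all add: emb_def)

lemma emb_power: "emb (a ^ k) = emb a ^ k"
  by (induction k) (simp_all add: emb_mult)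

lemma emb_eq_iff: "emb a = emb b \<longleftrightarrow> a = b"
  by (simp add: emb_def eq_fract)

lemma emb_eq_0_iff [simp]: "emb a = 0 \<longleftrightarrow> a = 0"
  using emb_eq_iff[of a 0] by simp

lemma Fract_eq_emb: "b \<noteq> 0 \<Longrightarrow> Fract a b = emb a / emb b"
  by (simp add: emb_def)

text \<open>A localization of the polynomial ring. The condition \<open>b \<noteq> 0\<close> is
  separate because 0 is invertible modulo a unit.\<close>

definition regular :: "qpol \<Rightarrow> qrat set" where
  "regular P = {emb a / emb b | a b. b \<noteq> 0 \<and> bezout b P}"

lemma regularI: "b \<noteq> 0 \<Longrightarrow> bezout b P \<Longrightarrow> emb a / emb b \<in> regular P"
  by (auto simp: regular_def)

lemma regular_emb: "emb a \<in> regular P"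
  using regularI[of 1 P a] by simp

lemma of_nat_cd_field_nz: "k > 0 \<Longrightarrow> (of_nat k :: cd_field) \<noteq> 0"
  by (simp add: of_nat_fract Zero_fract_def eq_fract)

lemma emb_const_inverse: "\<kappa> \<noteq> 0 \<Longrightarrow> inverse (emb [:\<kappa>:]) = emb [:inverse \<kappa>:]"
proof -
  assume "\<kappa> \<noteq> 0"
  hence "emb [:\<kappa>:] * emb [:inverse \<kappa>:] = 1" by (simp flip: emb_mult one_pCons)
  thus ?thesis by (metis inverse_unique)
qed

lemma of_nat_qrat: "(of_nat k :: qrat) = emb [:of_nat k:]"
  by (induction k) (simp_all add: emb_add[symmetric] one_pCons flip: emb_1)

text \<open>\<open>1 + P * (a / b)\<close> is \<open>(b + P * a) / b\<close>, and
  \<open>b + P * a\<close> is invertible modulo \<open>P\<close> like \<open>b\<close>; it is not 0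
  since \<open>P\<close> is not a unit.\<close>

lemma radical_subring_regular:
  assumes "\<not> P dvd 1"
  shows "radical_subring (regular P) (emb P)"
proof
  show "1 \<in> regular P" using regular_emb[of 1] by simp
  show "emb P \<in> regular P" by (rule regular_emb)
  fix x y assume "x \<in> regular P" "y \<in> regular P"
  then obtain a b a' b' where *: "x = emb a / emb b" "y = emb a' / emb b'" "b \<noteq> 0" "b' \<noteq> 0" "bezout b P"
  "bezout b' P"
    by (auto simp: regular_def)
  have "x - y = emb (a * b' - a' * b) / emb (b * b')" "x * y = emb (a * a') / emb (b * b')"
    using *(3,4) unfolding *(1,2) by (simp_all add: emb_diff emb_mult field_simps)
  moreover have "b * b' \<noteq> 0" "bezout (b * b') P" using * by (auto intro: bezout_mult)
  ultimately show "x - y \<in> regular P" "x * y \<in> regular P" by (auto intro: regularI)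
next
  fix x assume "x \<in> regular P"
  then obtain a b where *: "x = emb a / emb b" "b \<noteq> 0" "bezout b P" by (auto simp: regular_def)
  have bz: "bezout (b + P * a) P" using *(3) by (rule bezout_add_mult)
  have nz: "b + P * a \<noteq> 0"
  proof
    assume "b + P * a = 0"
    with bz obtain v where "v * P = 1" by (auto simp: bezout_def)
    with assms show False by (metis dvd_triv_right)
  qed
  have eq: "1 + emb P * x = emb (b + P * a) / emb b"
    using * by (simp add: emb_add emb_mult field_simps)
  show "1 + emb P * x \<noteq> 0 \<and> inverse (1 + emb P * x) \<in> regular P"
    unfolding eq using nz bz *(2) by (auto intro: regularI)
next
  fix k :: nat assume "k > 0"
  thus "(of_nat k :: qrat) \<noteq> 0 \<and> inverse (of_nat k) \<in> regular P"
    using of_nat_cd_field_nz[of k] by (simp add: of_nat_qrat emb_const_inverse regular_emb)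
qed

section \<open>Coprimality of cyclotomic polynomials\<close>

definition \<Phi> :: "nat \<Rightarrow> qpol" where
  "\<Phi> n = of_int_poly (cyclotomic n)"

abbreviation X :: qpol where "X \<equiv> [:0, 1:]"

lemma monom_eq_X: "monom 1 k = X ^ k"
  by (simp add: monom_altdef)

lemma prod_Phi: "n > 0 \<Longrightarrow> (\<Prod>d | d dvd n. \<Phi> d) = X ^ n - 1"
proof -
  assume "n > 0"
  have "(\<Prod>d | d dvd n. \<Phi> d) = of_int_poly (\<Prod>d | d dvd n. cyclotomic d)"
    by (simp add: \<Phi>_def of_int_poly_prod)
  thus ?thesis by (simp add: prod_cyclotomic[OF \<open>n > 0\<close>] of_int_poly_diff map_poly_monom monom_eq_X)
qed

lemma X_pow_diff_nz: "n > 0 \<Longrightarrow> X ^ n - 1 \<noteq> 0"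
proof
  assume n: "n > 0" and "X ^ n - 1 = 0"
  hence "X ^ n = 1" by simp
  hence "coeff (monom (1::cd_field) n) n = coeff 1 n" by (simp add: monom_eq_X)
  thus False using n by simp
qed

lemma Phi_1: "\<Phi> 1 = X - 1"
  using prod_Phi[of 1] by simp

lemma Phi_not_unit: "n > 0 \<Longrightarrow> \<not> \<Phi> n dvd 1"
proof
  assume n: "n > 0" and "\<Phi> n dvd 1"
  then obtain r where r: "1 = \<Phi> n * r" by (elim dvdE)
  hence "\<Phi> n \<noteq> 0" "r \<noteq> 0" by auto
  hence "degree (\<Phi> n) + degree r = 0" using r by (metis degree_1 degree_mult_eq)
  hence "degree (\<Phi> n) = 0" by simp
  moreover have "coeff (\<Phi> n) (degree (cyclotomic n)) = 1"
    using lead_coeff_cyclotomic[OF n] by (simp add: \<Phi>_def coeff_map_poly)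
  hence "degree (cyclotomic n) \<le> degree (\<Phi> n)" by (intro le_degree) simp
  ultimately show False using degree_cyclotomic_pos[OF n] by simp
qed

lemma Phi_dvd: "n > 0 \<Longrightarrow> d dvd n \<Longrightarrow> \<Phi> d dvd X ^ n - 1"
  using dvd_prodI[of "{d. d dvd n}" d \<Phi>] by (simp add: prod_Phi)

text \<open>The geometric sum is the quotient of \<open>X ^ (g * k) - 1\<close> by
  \<open>X ^ g - 1\<close>, hence the product of the \<Phi>_d with \<open>d\<close> dividing
  \<open>g * k\<close> but not \<open>g\<close>.\<close>

lemma Phi_dvd_geometric:
  assumes "0 < g" "1 < k"
  shows "\<Phi> (g * k) dvd (\<Sum>j<k. (X ^ g) ^ j)"
proof -
  have gk: "g * k > 0" using assms by simp
  define A where "A = {d. d dvd g * k \<and> \<not> d dvd g}"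
  have fin: "finite {d. d dvd g * k}" using gk by simp
  have "(X ^ g - 1) * (\<Sum>j<k. (X ^ g) ^ j) = X ^ (g * k) - 1"
    by (simp add: power_diff_1_eq power_mult)
  also have "\<dots> = (\<Prod>d | d dvd g * k. \<Phi> d)" by (rule prod_Phi[OF gk, symmetric])
  also have "{d. d dvd g * k} = {d. d dvd g} \<union> A" by (auto simp: A_def)
  also have "(\<Prod>d\<in>{d. d dvd g} \<union> A. \<Phi> d) = (\<Prod>d | d dvd g. \<Phi> d) * (\<Prod>d\<in>A. \<Phi> d)"
    using fin assms by (intro prod.union_disjoint) (auto simp: A_def)
  also have "(\<Prod>d | d dvd g. \<Phi> d) = X ^ g - 1" by (rule prod_Phi[OF assms(1)])
  finally have "(\<Sum>j<k. (X ^ g) ^ j) = (\<Prod>d\<in>A. \<Phi> d)" using X_pow_diff_nz[OF assms(1)] by simp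
  moreover have "g * k \<in> A" "finite A" using assms fin by (auto simp: A_def dest: dvd_imp_le)
  ultimately show ?thesis by (simp add: dvd_prodI)
qed

lemma bezout_const: "\<kappa> \<noteq> 0 \<Longrightarrow> bezout [:\<kappa>:] (P :: qpol)"
  by (rule bezoutI[of "[:inverse \<kappa>:]" _ 0]) (simp add: one_pCons)

text \<open>Modulo \<open>1 - x\<^sup>g\<close> the geometric sum divisible by \<open>\<Phi>\<^sub>g\<^sub>k\<close> is the constant \<open>k\<close>.\<close>

lemma bezout_X_pow_Phi_divisor:
  assumes "0 < g" "1 < k"
  shows "bezout (1 - X ^ g) (\<Phi> (g * k))"
proof -
  obtain r where r: "(\<Sum>j<k. (X ^ g) ^ j) = \<Phi> (g * k) * r" using Phi_dvd_geometric[OF assms] by (elim dvdE)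
  have "(1 - X ^ g) * (\<Sum>j<k. \<Sum>i<j. (X ^ g) ^ i) = (\<Sum>j<k. 1 - (X ^ g) ^ j)"
    by (simp add: sum_distrib_left one_diff_power_eq)
  also have "\<dots> = of_nat k - \<Phi> (g * k) * r" by (simp add: sum_subtractf r)
  finally have "(1 - X ^ g) * (\<Sum>j<k. \<Sum>i<j. (X ^ g) ^ i) + \<Phi> (g * k) * r = [:of_nat k:]"
    by (simp add: of_nat_poly)
  hence "[:inverse (of_nat k):] * ((1 - X ^ g) * (\<Sum>j<k. \<Sum>i<j. (X ^ g) ^ i) + \<Phi> (g * k) * r) = 1"
    using of_nat_cd_field_nz[of k] assms by (simp add: one_pCons)
  hence "([:inverse (of_nat k):] * (\<Sum>j<k. \<Sum>i<j. (X ^ g) ^ i)) * (1 - X ^ g) + ([:inverse (of_nat k):] * r)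
    * \<Phi> (g * k) = 1"
    by (simp only: distrib_left mult_ac)
  thus ?thesis by (rule bezoutI)
qed

text \<open>Since \<open>X ^ m\<close> is 1 modulo \<Phi>_m, \<open>1 - X ^ (i * a)\<close> is
  congruent to \<open>1 - X ^ g\<close> for \<open>g = gcd i m\<close> and a suitable
  \<open>a\<close>; this is the case of a proper divisor, and \<open>1 - X ^ i\<close> divides the
  left side.\<close>

lemma bezout_X_pow_Phi:
  assumes "0 < m" "\<not> m dvd i"
  shows "bezout (1 - X ^ i) (\<Phi> m)"
proof -
  define g where "g = gcd i m"
  have i0: "i \<noteq> 0" using assms(2) by (metis dvd_0_right)
  have g: "0 < g" "g dvd m" "g dvd i" using i0 by (auto simp: g_def)
  obtain k where k: "m = g * k" using g(2) by (elim dvdE)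
  have "g \<noteq> m" using assms(2) g(3) by auto
  hence k1: "1 < k" using k assms(1) by (cases k; cases "k - 1") auto
  obtain a b where ab: "i * a = m * b + g" using bezout_nat[OF i0, of m] by (auto simp: g_def)
  obtain r where r: "X ^ m - 1 = \<Phi> m * r" using Phi_dvd[OF assms(1), of m] by (auto elim!: dvdE)
  have r': "1 - X ^ m = \<Phi> m * (- r)" using r by (simp add: algebra_simps)
  define s where "s = (\<Sum>i<b. (X ^ m) ^ i)"
  have s: "1 - X ^ (m * b) = (1 - X ^ m) * s"
    unfolding s_def power_mult by (rule one_diff_power_eq)
  have "1 - X ^ g = (1 - X ^ (i * a)) - X ^ g * (1 - X ^ (m * b))"
    unfolding ab by (simp add: power_add algebra_simps)
  also have "1 - X ^ (m * b) = \<Phi> m * (- r * s)"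
    unfolding s r' by (simp only: mult.assoc)
  finally have eq: "1 - X ^ (i * a) = (1 - X ^ g) + \<Phi> m * (X ^ g * (- r * s))" by (simp add: algebra_simps)
  have "bezout (1 - X ^ (i * a)) (\<Phi> m)"
    unfolding eq by (intro bezout_add_mult) (use bezout_X_pow_Phi_divisor[OF g(1) k1] k in simp)
  moreover have "1 - X ^ i dvd 1 - X ^ (i * a)"
    unfolding power_mult one_diff_power_eq[of "X ^ i"] by simp
  ultimately show ?thesis by (rule bezout_dvd)
qed

text \<open>If \<open>e\<close> does not divide \<open>d\<close>, then \<Phi>_d divides
  \<open>X ^ d - 1\<close>, which is invertible modulo \<Phi>_e. For distinct numbers this applies
  in at least one order.\<close>

lemma bezout_Phi:
  assumes "0 < d" "0 < e" "d \<noteq> e"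
  shows "bezout (\<Phi> d) (\<Phi> e)"
proof -
  have *: "bezout (\<Phi> d) (\<Phi> e)" if "0 < d" "0 < e" "\<not> e dvd d" for d e
    using bezout_X_pow_Phi[OF that(2,3)] Phi_dvd[OF that(1), of d]
    by (auto intro: bezout_dvd simp: dvd_diff_commute)
  show ?thesis
  proof (cases "e dvd d")
    case True
    hence "\<not> d dvd e" using assms by (auto dest: dvd_antisym)
    thus ?thesis by (intro bezout_commute[OF *[OF assms(2,1)]])
  next
    case False
    thus ?thesis by (rule *[OF assms(1,2)])
  qed
qed

section \<open>The indeterminates c and d, and the place of a cyclotomic polynomial\<close>

definition const_c :: cd_field where "const_c = Fract [:[:0, 1:]:] 1"
definition const_d :: cd_field where "const_d = Fract [:0, 1:] 1"

lemma Fract_1_power: "Fract a 1 ^ k = Fract (a ^ k) (1::'a::idom)"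
  by (induction k) (simp_all add: One_fract_def)

lemma const_nz: "const_c \<noteq> 0" "const_d \<noteq> 0"
  by (simp_all add: const_c_def const_d_def Zero_fract_def eq_fract)

lemma const_pow: "k > 0 \<Longrightarrow> const_c ^ k \<noteq> 1" "k > 0 \<Longrightarrow> const_d ^ k \<noteq> 1"
proof -
  assume k: "k > 0"
  have "[:[:0, 1:]:] ^ k \<noteq> (1 :: rat poly poly)"
  proof
    assume "[:[:0, 1:]:] ^ k = (1 :: rat poly poly)"
    hence "[:[:0, 1:] ^ k:] = (1 :: rat poly poly)" by (simp add: poly_const_pow)
    hence "[:0, 1:] ^ k = (1 :: rat poly)" by (simp add: one_pCons)
    hence "degree ([:0, 1:] ^ k :: rat poly) = 0" by simp
    thus False using k by (simp add: degree_power_eq)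
  qed
  thus "const_c ^ k \<noteq> 1" by (simp add: const_c_def Fract_1_power One_fract_def eq_fract)
  have "[:0, 1:] ^ k \<noteq> (1 :: rat poly poly)"
  proof
    assume "[:0, 1:] ^ k = (1 :: rat poly poly)"
    hence "degree ([:0, 1:] ^ k :: rat poly poly) = 0" by simp
    thus False using k by (simp add: degree_power_eq)
  qed
  thus "const_d ^ k \<noteq> 1" by (simp add: const_d_def Fract_1_power One_fract_def eq_fract)
qed

lemma cc_eq: "cc = emb [:const_c:]" and dd_eq: "dd = emb [:const_d:]" and qq_eq: "qq = emb X"
  by (simp_all add: cc_def dd_def qq_def const_c_def const_d_def)

lemma qq_pow_ne_const: "\<kappa> \<noteq> 1 \<Longrightarrow> qq ^ i \<noteq> emb [:\<kappa>:]"
proof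
  assume k: "\<kappa> \<noteq> 1" and "qq ^ i = emb [:\<kappa>:]"
  hence eq: "monom 1 i = [:\<kappa>:]" by (simp add: qq_eq emb_power[symmetric] emb_eq_iff monom_eq_X)
  have "degree (monom (1::cd_field) i) = i" by (simp add: degree_monom_eq)
  hence "i = 0" using eq by simp
  with eq k show False by (simp add: monom_0)
qed

lemma wp_series_qq: "wp_series qq cc dd"
proof
  show "qq \<noteq> 0" "cc \<noteq> 0" "dd \<noteq> 0" by (simp_all add: qq_eq cc_eq dd_eq const_nz)
  show "qq ^ i \<noteq> 1" if "0 < i" for i
  proof
    assume "qq ^ i = 1"
    hence "emb (X ^ i) = emb 1" by (simp add: qq_eq emb_power)
    thus False using X_pow_diff_nz[OF that] unfolding emb_eq_iff by simp
  qed
  show "qq ^ i \<noteq> cc" "qq ^ i \<noteq> dd" for i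
    using const_pow[of 1] unfolding cc_eq dd_eq by (auto intro!: qq_pow_ne_const)
qed

lemma cyclotomic_place_Phi:
  assumes "odd m" "1 < m"
  shows "cyclotomic_place qq cc dd (regular (\<Phi> m)) (emb (\<Phi> m)) m"
proof -
  have m0: "0 < m" using assms by simp
  interpret wp_series qq cc dd by (rule wp_series_qq)
  interpret radical_subring "regular (\<Phi> m)" "emb (\<Phi> m)"
    by (rule radical_subring_regular[OF Phi_not_unit[OF m0]])
  have emb_U: "emb b \<in> U" if "b \<noteq> 0" "bezout b (\<Phi> m)" for b
    using regularI[OF that, of 1] regular_emb[of b] that by (auto simp: U_def divide_inverse)
  have const_U: "emb [:\<kappa>:] \<in> U" if "\<kappa> \<noteq> 0" for \<kappa> using that by (intro emb_U bezout_const) auto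
  obtain r where r: "X ^ m - 1 = \<Phi> m * r" using Phi_dvd[OF m0, of m] by (auto elim!: dvdE)
  show ?thesis
  proof
    show "odd m" "1 < m" by fact+
    show "qq \<in> U"
      unfolding qq_eq
    proof (rule emb_U)
      have "X ^ m = X ^ (m - 1) * X" using m0 by (metis power_minus_mult)
      hence "X ^ (m - 1) * X + (- r) * \<Phi> m = 1" using r by (simp add: algebra_simps)
      thus "bezout X (\<Phi> m)" by (rule bezoutI)
    qed simp
    show "1 - qq ^ m \<in> J 1"
    proof -
      have "1 - qq ^ m = emb (1 - X ^ m)" by (simp add: qq_eq emb_diff emb_power)
      also have "1 - X ^ m = \<Phi> m * (- r)" using r by (simp add: algebra_simps)
      also have "emb (\<Phi> m * (- r)) = emb (\<Phi> m) ^ 1 * emb (- r)" by (simp only: emb_mult power_one_right)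
      finally have eq: "1 - qq ^ m = emb (\<Phi> m) ^ 1 * emb (- r)" .
      show ?thesis unfolding eq by (rule J_I[OF regular_emb])
    qed
    show "1 - qq ^ i \<in> U" if "\<not> m dvd i" for i
    proof -
      have "i > 0" using that by (metis dvd_0_right gr0I)
      have "1 - qq ^ i = emb (1 - X ^ i)" by (simp add: qq_eq emb_diff emb_power)
      moreover have "1 - X ^ i \<noteq> 0" using X_pow_diff_nz[OF \<open>i > 0\<close>] by simp
      ultimately show ?thesis using emb_U bezout_X_pow_Phi[OF m0 that] by simp
    qed
    show "cc \<in> U" "dd \<in> U" unfolding cc_eq dd_eq using const_nz by (auto intro: const_U)
    have "1 - emb [:\<kappa>:] ^ m = emb [:1 - \<kappa> ^ m:]" for \<kappa>
      by (simp add: emb_power[symmetric] poly_const_pow emb_diff[symmetric] one_pCons flip: emb_1)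
    thus "1 - cc ^ m \<in> U" "1 - dd ^ m \<in> U"
      unfolding cc_eq dd_eq using const_pow[OF m0] by (auto intro!: const_U)
  qed
qed

definition divisible :: "qpol \<Rightarrow> qrat \<Rightarrow> bool" where
  "divisible P x \<longleftrightarrow> (\<exists>a b. b \<noteq> 0 \<and> bezout b P \<and> x = emb (P * a) / emb b)"

lemma divisible_imp_qcong: "divisible P (A - B) \<Longrightarrow> qcong A B P"
proof -
  assume "divisible P (A - B)"
  then obtain a b where "b \<noteq> 0" "bezout b P" "A - B = emb (P * a) / emb b" by (auto simp: divisible_def)
  hence "b \<noteq> 0 \<and> P dvd P * a \<and> coprime b P \<and> A - B = Fract (P * a) b"
    by (simp add: Fract_eq_emb bezout_imp_coprime)
  thus ?thesis unfolding qcong_def by blast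
qed

lemma divisible_mult:
  assumes "\<not> P dvd 1" "bezout P P'" "divisible P x" "divisible P' x"
  shows "divisible (P * P') x"
proof -
  obtain a b where ab: "b \<noteq> 0" "bezout b P" "x = emb (P * a) / emb b" using assms(3)
    by (auto simp: divisible_def)
  obtain a' b' where ab': "b' \<noteq> 0" "bezout b' P'" "x = emb (P' * a') / emb b'" using assms(4)
    by (auto simp: divisible_def)
  \<comment> \<open>Chinese remaindering of denominators: \<open>\<beta>\<close> is
    \<open>b * P'\<close> modulo \<open>P\<close> and \<open>b' * P\<close> modulo
    \<open>P'\<close>, hence invertible modulo both, and \<open>x * \<beta>\<close> is
    \<open>P * P' * (a + a')\<close>.\<close>
  define \<beta> where "\<beta> = b * P' + b' * P"
  have "bezout (b * P' + P * b') P"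
    by (intro bezout_add_mult bezout_mult ab(2) bezout_commute[OF assms(2)])
  hence 1: "bezout \<beta> P" by (simp add: \<beta>_def mult.commute)
  have "bezout (b' * P + P' * b) P'" by (intro bezout_add_mult bezout_mult ab'(2) assms(2))
  hence 2: "bezout \<beta> P'" by (simp add: \<beta>_def algebra_simps)
  have bz: "bezout \<beta> (P * P')"
    using bezout_mult[OF bezout_commute[OF 1] bezout_commute[OF 2]] by (rule bezout_commute)
  have nz: "\<beta> \<noteq> 0"
  proof
    assume "\<beta> = 0"
    with 1 obtain v where "v * P = 1" by (auto simp: bezout_def)
    with assms(1) show False by (metis dvd_triv_right)
  qed
  have e1: "x * emb b = emb (P * a)" unfolding ab(3) using ab(1) by simp
  have e2: "x * emb b' = emb (P' * a')" unfolding ab'(3) using ab'(1) by simp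
  have "x * emb \<beta> = (x * emb b) * emb P' + (x * emb b') * emb P"
    by (simp add: \<beta>_def emb_add emb_mult algebra_simps)
  also have "\<dots> = emb (P * P' * (a + a'))" unfolding e1 e2 by (simp add: emb_add emb_mult algebra_simps)
  finally have "x = emb (P * P' * (a + a')) / emb \<beta>" using nz by (simp add: field_simps)
  thus ?thesis using nz bz by (auto simp: divisible_def)
qed

lemma divisible_1: "divisible 1 x"
proof -
  obtain a b where "x = Fract a b" "b \<noteq> 0" by (cases x)
  moreover have "bezout b 1" by (rule bezoutI[of 0 _ 1]) simp
  ultimately show ?thesis by (auto simp: divisible_def Fract_eq_emb)
qed

lemma divisible_prod:
  assumes "finite A" "\<And>i. i \<in> A \<Longrightarrow> \<not> P i dvd 1" "\<And>i. i \<in> A \<Longrightarrow> divisible (P i) x"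
    "\<And>i j. i \<in> A \<Longrightarrow> j \<in> A \<Longrightarrow> i \<noteq> j \<Longrightarrow> bezout (P i) (P j)"
  shows "divisible (\<Prod>i\<in>A. P i) x"
  using assms
proof (induction A rule: finite_induct)
  case (insert i A)
  have "bezout (\<Prod>j\<in>A. P j) (P i)" using insert by (intro bezout_prod) auto
  hence "bezout (P i) (\<Prod>j\<in>A. P j)" by (rule bezout_commute)
  thus ?case using insert by (simp add: divisible_mult)
qed (simp add: divisible_1)

text \<open>\<open>[n]\<close> is the product of the \<Phi>_d over the divisors
  \<open>d \<noteq> 1\<close>, each occurring once; together with the cube this gives the exponent 4
  at \<open>d = n\<close>, and one factor can be treated at a time.\<close>

lemma modulus_eq:
  assumes "1 < n"
  shows "modulus n = (\<Prod>d\<in>{d. d dvd n \<and> d \<noteq> 1}. if d = n then \<Phi> n ^ 4 else \<Phi> d)"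
proof -
  define A where "A = {d. d dvd n \<and> d \<noteq> 1}"
  have fin: "finite {d. d dvd n}" using assms by simp
  have "{d. d dvd n} = insert 1 A" "1 \<notin> A" by (auto simp: A_def)
  hence "(X - 1) * (\<Prod>d\<in>A. \<Phi> d) = X ^ n - 1"
    using prod_Phi[of n] assms fin Phi_1 by simp
  also have "\<dots> = (X - 1) * (\<Sum>i<n. X ^ i)" by (rule power_diff_1_eq)
  finally have "(\<Sum>i<n. X ^ i) = (\<Prod>d\<in>A. \<Phi> d)" using X_pow_diff_nz[of 1] by simp
  hence "modulus n = (\<Prod>d\<in>A. \<Phi> d) * \<Phi> n ^ 3" by (simp add: modulus_def monom_eq_X \<Phi>_def)
  also have "A = insert n (A - {n})" using assms by (auto simp: A_def)
  also have "(\<Prod>d\<in>insert n (A - {n}). \<Phi> d) * \<Phi> n ^ 3 = \<Phi> n ^ 4 * (\<Prod>d\<in>A - {n}. \<Phi> d)"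
    using fin by (subst prod.insert) (auto simp: A_def eval_nat_numeral mult_ac)
  also have "\<dots> = (\<Prod>d\<in>insert n (A - {n}). if d = n then \<Phi> n ^ 4 else \<Phi> d)"
    using fin by (subst prod.insert) (auto simp: A_def intro!: prod.cong)
  also have "insert n (A - {n}) = A" using assms by (auto simp: A_def)
  finally show ?thesis by (simp add: A_def)
qed

lemma qpoch_eq_qfact: "qpoch = qfact"
  by (simp add: fun_eq_iff qpoch_def qfact_def)

theorem theorem1p2:
  fixes n M :: nat
  assumes "odd n" and "n > 1" and "M = (n + 1) div 2 \<or> M = n - 1"
  shows "qcong
    (\<Sum>k\<le>M. qint (4 * int k - 1)
        * qpoch (qq powi (-1)) (qq^2) k ^ 4
        * qpoch (cc * qq powi (-1)) (qq^2) k * qpoch (dd * qq powi (-1)) (qq^2) k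
        / (qpoch (qq^2) (qq^2) k ^ 4 * qpoch (qq^2 / cc) (qq^2) k * qpoch (qq^2 / dd) (qq^2) k)
        * (qq^7 / (cc * dd)) ^ k)
    (Omega n * (1 - qq)^2 * qpoch (qq^3 / (cc * dd)) (qq^2) 2
        / ((1 + qq)^2 * qpoch (qq^2 / cc) (qq^2) 2 * qpoch (qq^2 / dd) (qq^2) 2)
      * (\<Sum>k\<le>(n - 3) div 2.
          qpoch (qq^3) (qq^2) k ^ 3 * qpoch (qq^7 / (cc * dd)) (qq^2) k
          / (qpoch (qq^2) (qq^2) k * qpoch (qq^6) (qq^2) k
             * qpoch (qq^6 / cc) (qq^2) k * qpoch (qq^6 / dd) (qq^2) k)
          * qq ^ (2 * k)))
    (modulus n)" (is "qcong (\<Sum>k\<le>M. ?f k) ?R _")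
proof -
  interpret W: wp_series qq cc dd by (rule wp_series_qq)
  have L: "(\<Sum>k\<le>M. ?f k) = W.S 1 1 1 M"
    unfolding W.S_def
  proof (intro sum.cong refl)
    fix k
    have "qint (4 * int k - 1) = W.qnum k"
    proof -
      have "qq powi (4 * int k - 1) = qq powi int (4 * k) / qq"
        using W.q0 by (simp add: power_int_diff)
      thus ?thesis by (simp only: qint_def W.qnum_def power_int_of_nat)
    qed
    thus "?f k = W.qnum k * (\<Prod>i<k. W.ratio 1 1 1 i)"
      unfolding W.prod_ratio qpoch_eq_qfact
      by (simp add: power_int_minus divide_inverse power4_eq_xxxx mult_ac)
  qed
  have R: "?R = W.rhs n"
  proof -
    have "int n - 1 = int (n - 1)" "int n + 1 = int (n + 1)" using assms(2) by simp_all
    hence "qint (int n) = (1 - qq ^ n) / (1 - qq)" "qint (int n - 1) = (1 - qq ^ (n - 1)) / (1 - qq)"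
      "qint (int n + 1) = (1 - qq ^ (n + 1)) / (1 - qq)"
      by (simp_all only: qint_def power_int_of_nat)
    hence "Omega n = W.omega n" unfolding Omega_def W.omega_def by (simp only:)
    thus ?thesis unfolding W.rhs_def W.tail_def qpoch_eq_qfact by (simp only:)
  qed
  define A where "A = {d. d dvd n \<and> d \<noteq> 1}"
  define P where "P d = (if d = n then \<Phi> n ^ 4 else \<Phi> d)" for d
  have A: "odd d" "1 < d" "d dvd n" if "d \<in> A" for d
  proof -
    show "d dvd n" using that by (simp add: A_def)
    thus "odd d" using assms(1) by (auto dest: dvd_trans)
    thus "1 < d" using that by (cases d; cases "d - 1") (auto simp: A_def)
  qed
  have "divisible (\<Prod>d\<in>A. P d) ((\<Sum>k\<le>M. ?f k) - ?R)"
  proof (rule divisible_prod)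
    show "finite A" using assms(2) by (auto simp: A_def)
    fix d assume d: "d \<in> A"
    note dA = A[OF d]
    interpret C: cyclotomic_place qq cc dd "regular (\<Phi> d)" "emb (\<Phi> d)" d
      by (rule cyclotomic_place_Phi[OF dA(1,2)])
    have J: "divisible (\<Phi> d ^ k) x" if x: "x \<in> C.J k" for x k
    proof -
      obtain y where y: "x = emb (\<Phi> d) ^ k * y" "y \<in> regular (\<Phi> d)" using x unfolding C.J_def by blast
      moreover obtain a b where "y = emb a / emb b" "b \<noteq> 0" "bezout b (\<Phi> d)"
        using y(2) unfolding regular_def by blast
      ultimately have "x = emb (\<Phi> d) ^ k * (emb a / emb b)" "b \<noteq> 0" "bezout b (\<Phi> d)" by auto
      thus ?thesis unfolding divisible_def
        by (intro exI[of _ a] exI[of _ b]) (simp add: emb_mult emb_power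
        bezout_commute[OF bezout_power[OF bezout_commute]])
    qed
    show "\<not> P d dvd 1"
      using Phi_not_unit[of d] dA(2) by (auto simp: P_def is_unit_power_iff)
    show "divisible (P d) ((\<Sum>k\<le>M. ?f k) - ?R)"
    proof (cases "d = n")
      case True
      have "W.S 1 1 1 M - W.S 1 1 1 C.N \<in> C.J 4"
      proof (rule C.S_extend)
        have "2 * M = n + 1 \<or> M = n - 1" using assms by auto
        thus "C.N \<le> M" "M < d" using C.N2 C.N_ge assms(2) True by linarith+
      qed
      from C.J_add[OF this C.S_congruence] have "W.S 1 1 1 M - W.rhs n \<in> C.J 4" using True by simp
      from J[OF this] show ?thesis unfolding L R P_def using True by simp
    next
      \<comment> \<open>At a proper divisor both sides vanish separately, so nothing has to be
        compared.\<close>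
      case False
      have "W.S 1 1 1 M - W.rhs n \<in> C.J 1"
        using C.S_dvd_J[OF dA(3) assms(1,3)] C.rhs_J[OF dA(3)] assms(2) by (intro C.J_diff) auto
      from J[OF this] show ?thesis unfolding L R P_def using False by simp
    qed
    fix e assume e: "e \<in> A" "d \<noteq> e"
    have "bezout (\<Phi> d) (\<Phi> e)" using e dA(2) A(2)[OF e(1)] by (intro bezout_Phi) auto
    hence "bezout (\<Phi> d ^ i) (\<Phi> e ^ j)" for i j
      by (intro bezout_power bezout_commute[OF bezout_power[OF bezout_commute]])
    from this[of "if d = n then 4 else 1" "if e = n then 4 else 1"] show "bezout (P d) (P e)"
      by (simp add: P_def split: if_splits)
  qed
  hence "divisible (modulus n) ((\<Sum>k\<le>M. ?f k) - ?R)" unfolding modulus_eq[OF assms(2)] A_def P_def .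
  thus ?thesis by (rule divisible_imp_qcong)
qed

end
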